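(* Let $A=(A_1,\dots,A_n)$ and $B=(B_1,\dots,B_n)$ be contractive $n$-tuples on finite dimensional Hilbert spaces $\mathcal V_A$ and $\mathcal V_B$ respectively. Let $S=(S_1,\dots,S_n)$ and $T=(T_1,\dots,T_n)$ be their joint minimal isometric dilations on Hilbert spaces $\mathcal H_A$ and $\mathcal H_B$; and let $\sigma_A$ and $\sigma_B$ be the induced representations of the Cuntz–Toeplitz algebra $\mathcal E_n$. Let $\widetilde{\mathcal V}_A$ be the subspace of $\mathcal V_A$ spanned by all minimal $\mathfrak A^*$-invariant subspaces $\mathcal W$ on which $\sum_{i=1}^nA_iA_i^*|_{\mathcal W}=I_{\mathcal W}$; and let $\widetilde{\mathcal V}_B\subseteq\mathcal V_B$ be defined similarly from $B$. Then $\sigma_A$ and $\sigma_B$ are unitarily equivalent if and only if (1) $\operatorname{rank}\bigl(I_{\mathcal V_A}-\sum_{i=1}^nA_iA_i^*\bigr)=\operatorname{rank}\bigl(I_{\mathcal V_B}-\sum_{i=1}^nB_iB_i^*\bigr)$; and (2) $A^*|_{\widetilde{\mathcal V}_A}$ is unitarily equivalent to $B^*|_{\widetilde{\mathcal V}_B}$, i.e. there is a single unitary $U:\widetilde{\mathcal V}_A\to\widetilde{\mathcal V}_B$ with $U A_i^*|_{\widetilde{\mathcal V}_A}=B_i^*|_{\widetilde{\mathcal V}_B}U$ for $1\le i\le n$.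
   Context: Fix an integer $n\ge2$. $\mathcal F_n$ is the unital free semigroup on letters $1,\dots,n$; for an $n$-tuple $T$ and $w=i_1\cdots i_k$, $T_w=T_{i_1}\cdots T_{i_k}$, with $T_e=I$ for the empty word $e$. An $n$-tuple $A$ on a Hilbert space $\mathcal V$ is contractive if $\sum_iA_iA_i^*\le I$. Its minimal joint isometric dilation is an $n$-tuple $S$ of isometries with pairwise orthogonal ranges on $\mathcal H\supseteq\mathcal V$ with $\mathcal V$ invariant for each $S_i^*$, $S_i^*|_{\mathcal V}=A_i^*$, and $\mathcal H$ the closed span of $\{S_w\mathcal V:w\in\mathcal F_n\}$; it exists and is unique up to a unitary equivalence fixing $\mathcal V$. $\mathfrak A$ (resp. $\mathfrak B$) is the unital algebra generated by the $A_i$ (resp. $B_i$), and $\mathfrak A^*$, $\mathfrak B^*$ are the algebras of adjoints. "Minimal invariant subspace" means minimal among nonzero invariant subspaces. Let $\mathcal K_n=\ell^2(\mathcal F_n)$ with basis $\{\xi_w\}$ and $L_i\xi_w=\xi_{iw}$. The Cuntz–Toeplitz algebra is $\mathcal E_n=C^*(L_1,\dots,L_n)$; every $n$-tuple of isometries $S_i$ with pairwise orthogonal ranges induces a unique unital $*$-representation of $\mathcal E_n$ with $L_i\mapsto S_i$. $\sigma_A$ and $\sigma_B$ are the representations with $\sigma_A(L_i)=S_i$ and $\sigma_B(L_i)=T_i$. (When (2) concerns zero subspaces, they are regarded as unitarily equivalent.) *)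

theory Defs
  imports "HOL-Analysis.Analysis"
begin

section \<open>Complex Hilbert spaces\<close>

text \<open>
  Complex Hilbert spaces are obtained from the real ones of the library, so that the norm, the
  topology and \<^const>\<open>bounded_linear\<close> are the library's. The complex inner product is linear in
  its first argument. Zero-dimensional spaces are allowed.
\<close>

class chilbert_space = real_inner + complete_space +
  fixes scaleC :: "complex \<Rightarrow> 'a \<Rightarrow> 'a" (infixr "*\<^sub>C" 75)
    and cinner :: "'a \<Rightarrow> 'a \<Rightarrow> complex"
  assumes scaleC_add_right: "a *\<^sub>C (x + y) = a *\<^sub>C x + a *\<^sub>C y"
    and scaleC_add_left: "(a + b) *\<^sub>C x = a *\<^sub>C x + b *\<^sub>C x"
    and scaleC_scaleC: "a *\<^sub>C (b *\<^sub>C x) = (a * b) *\<^sub>C x"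
    and scaleR_scaleC: "r *\<^sub>R x = complex_of_real r *\<^sub>C x"
    and cinner_commute: "cinner x y = cnj (cinner y x)"
    and cinner_add_left: "cinner (x + y) z = cinner x z + cinner y z"
    and cinner_scaleC_left: "cinner (a *\<^sub>C x) y = a * cinner x y"
    and inner_eq_Re_cinner: "inner x y = Re (cinner x y)"

lemma vector_space_scaleC: "vector_space (scaleC :: complex \<Rightarrow> 'a::chilbert_space \<Rightarrow> 'a)"
proof
  fix x :: 'a
  show "1 *\<^sub>C x = x"
    using scaleR_scaleC[of 1 x] by simp
qed (simp_all add: scaleC_add_right scaleC_add_left scaleC_scaleC)

global_interpretation cvs: vector_space "scaleC :: complex \<Rightarrow> 'a::chilbert_space \<Rightarrow> 'a"
  defines csubspace = cvs.subspace
    and cspan = cvs.span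
    and cdim = cvs.dim
  by (rule vector_space_scaleC)

definition finite_cdim :: "'a::chilbert_space set \<Rightarrow> bool" where
  "finite_cdim M \<longleftrightarrow> (\<exists>B. finite B \<and> cspan B = M)"

definition bounded_clinear :: "('a::chilbert_space \<Rightarrow> 'b::chilbert_space) \<Rightarrow> bool" where
  "bounded_clinear f \<longleftrightarrow> bounded_linear f \<and> (\<forall>c x. f (c *\<^sub>C x) = c *\<^sub>C f x)"

definition cadjoint :: "('a::chilbert_space \<Rightarrow> 'b::chilbert_space) \<Rightarrow> 'b \<Rightarrow> 'a" where
  "cadjoint f = (THE g. \<forall>x y. cinner (f x) y = cinner x (g y))"

definition cisometry :: "('a::chilbert_space \<Rightarrow> 'b::chilbert_space) \<Rightarrow> bool" where
  "cisometry f \<longleftrightarrow> bounded_clinear f \<and> (\<forall>x. norm (f x) = norm x)"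

definition unitary_between ::
    "'a::chilbert_space set \<Rightarrow> 'b::chilbert_space set \<Rightarrow> ('a \<Rightarrow> 'b) \<Rightarrow> bool" where
  "unitary_between M N U \<longleftrightarrow>
     (\<forall>x\<in>M. \<forall>y\<in>M. U (x + y) = U x + U y) \<and>
     (\<forall>c. \<forall>x\<in>M. U (c *\<^sub>C x) = c *\<^sub>C U x) \<and>
     (\<forall>x\<in>M. \<forall>y\<in>M. cinner (U x) (U y) = cinner x y) \<and>
     U ` M = N"

definition positive_op :: "('a::chilbert_space \<Rightarrow> 'a) \<Rightarrow> bool" where
  "positive_op P \<longleftrightarrow> (\<forall>x. cinner (P x) x \<in> \<real> \<and> 0 \<le> Re (cinner (P x) x))"

definition crank :: "('a::chilbert_space \<Rightarrow> 'b::chilbert_space) \<Rightarrow> nat" where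
  "crank f = cdim (range f)"


section \<open>Tuples of operators and dilations\<close>

text \<open>
  An \<open>n\<close>-tuple is indexed by a finite type of letters with \<open>n\<close> elements; the words over these
  letters are the lists.
\<close>

definition word_op :: "('n \<Rightarrow> 'a \<Rightarrow> 'a) \<Rightarrow> 'n list \<Rightarrow> 'a \<Rightarrow> 'a" where
  "word_op T w = foldr (\<lambda>i f. T i \<circ> f) w id"

definition defect :: "('n::finite \<Rightarrow> 'a::chilbert_space \<Rightarrow> 'a) \<Rightarrow> 'a \<Rightarrow> 'a" where
  "defect A = (\<lambda>x. x - (\<Sum>i\<in>UNIV. A i (cadjoint (A i) x)))"

definition contractive :: "('n::finite \<Rightarrow> 'a::chilbert_space \<Rightarrow> 'a) \<Rightarrow> bool" where
  "contractive A \<longleftrightarrow> (\<forall>i. bounded_clinear (A i)) \<and> positive_op (defect A)"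

definition isometries_orthogonal_ranges ::
    "('n::finite \<Rightarrow> 'h::chilbert_space \<Rightarrow> 'h) \<Rightarrow> bool" where
  "isometries_orthogonal_ranges S \<longleftrightarrow>
     (\<forall>i. cisometry (S i)) \<and> (\<forall>i j x y. i \<noteq> j \<longrightarrow> cinner (S i x) (S j y) = 0)"

text \<open>
  The inclusion of the space of \<open>A\<close> in the space of \<open>S\<close> is an isometry \<open>J\<close>. The third condition
  says that the range of \<open>J\<close> is invariant for the adjoints of the \<open>S i\<close>, which restrict there to
  the adjoints of the \<open>A i\<close>.
\<close>

definition minimal_isometric_dilation ::
    "('n::finite \<Rightarrow> 'v::chilbert_space \<Rightarrow> 'v) \<Rightarrow> ('v \<Rightarrow> 'h::chilbert_space) \<Rightarrow>
     ('n \<Rightarrow> 'h \<Rightarrow> 'h) \<Rightarrow> bool" where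
  "minimal_isometric_dilation A J S \<longleftrightarrow>
     cisometry J \<and>
     isometries_orthogonal_ranges S \<and>
     (\<forall>i v. cadjoint (S i) (J v) = J (cadjoint (A i) v)) \<and>
     closure (cspan (\<Union>w. word_op S w ` range J)) = UNIV"

inductive_set unital_alg :: "('n \<Rightarrow> 'a::chilbert_space \<Rightarrow> 'a) \<Rightarrow> ('a \<Rightarrow> 'a) set"
  for A :: "'n \<Rightarrow> 'a \<Rightarrow> 'a" where
  one: "id \<in> unital_alg A"
| gen: "A i \<in> unital_alg A"
| add: "X \<in> unital_alg A \<Longrightarrow> Y \<in> unital_alg A \<Longrightarrow> (\<lambda>v. X v + Y v) \<in> unital_alg A"
| scale: "X \<in> unital_alg A \<Longrightarrow> (\<lambda>v. c *\<^sub>C X v) \<in> unital_alg A"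
| mult: "X \<in> unital_alg A \<Longrightarrow> Y \<in> unital_alg A \<Longrightarrow> X \<circ> Y \<in> unital_alg A"

definition adjoint_alg :: "('n \<Rightarrow> 'a::chilbert_space \<Rightarrow> 'a) \<Rightarrow> ('a \<Rightarrow> 'a) set" where
  "adjoint_alg A = cadjoint ` unital_alg A"

definition invariant_subspace :: "('a::chilbert_space \<Rightarrow> 'a) set \<Rightarrow> 'a set \<Rightarrow> bool" where
  "invariant_subspace \<X> W \<longleftrightarrow> csubspace W \<and> (\<forall>X\<in>\<X>. X ` W \<subseteq> W)"

definition minimal_invariant_subspace ::
    "('a::chilbert_space \<Rightarrow> 'a) set \<Rightarrow> 'a set \<Rightarrow> bool" where
  "minimal_invariant_subspace \<X> W \<longleftrightarrow>
     invariant_subspace \<X> W \<and> W \<noteq> {0} \<and>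
     (\<forall>W'. invariant_subspace \<X> W' \<and> W' \<noteq> {0} \<and> W' \<subseteq> W \<longrightarrow> W' = W)"

definition tilde_space :: "('n::finite \<Rightarrow> 'v::chilbert_space \<Rightarrow> 'v) \<Rightarrow> 'v set" where
  "tilde_space A =
     cspan (\<Union>{W. minimal_invariant_subspace (adjoint_alg A) W \<and>
                  (\<forall>w\<in>W. (\<Sum>i\<in>UNIV. A i (cadjoint (A i) w)) = w)})"


section \<open>The space of square-summable functions\<close>

definition sq_summable :: "('i \<Rightarrow> complex) \<Rightarrow> bool" where
  "sq_summable f \<longleftrightarrow> (\<lambda>i. (cmod (f i))\<^sup>2) summable_on UNIV"

lemma sq_summable_0: "sq_summable (\<lambda>_. 0)"
  by (simp add: sq_summable_def)

lemma sq_summable_mult: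
  assumes "sq_summable f"
  shows "sq_summable (\<lambda>i. c * f i)"
  using summable_on_cmult_right[OF assms[unfolded sq_summable_def], of "(cmod c)\<^sup>2"]
  by (simp add: sq_summable_def norm_mult power_mult_distrib)

lemma sq_summable_add:
  assumes "sq_summable f" "sq_summable g"
  shows "sq_summable (\<lambda>i. f i + g i)"
  unfolding sq_summable_def
proof (rule summable_on_comparison_test)
  show "(\<lambda>i. 2 * (cmod (f i))\<^sup>2 + 2 * (cmod (g i))\<^sup>2) summable_on UNIV"
    using assms unfolding sq_summable_def by (intro summable_on_add summable_on_cmult_right)
  fix i
  have "(cmod (f i + g i))\<^sup>2 \<le> (cmod (f i) + cmod (g i))\<^sup>2"
    by (intro power_mono norm_triangle_ineq) simp
  also have "\<dots> \<le> 2 * (cmod (f i))\<^sup>2 + 2 * (cmod (g i))\<^sup>2"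
    using zero_le_power2[of "cmod (f i) - cmod (g i)"] by (simp add: power2_sum power2_diff)
  finally show "(cmod (f i + g i))\<^sup>2 \<le> 2 * (cmod (f i))\<^sup>2 + 2 * (cmod (g i))\<^sup>2" .
qed simp

lemma summable_mult_cnj:
  assumes "sq_summable f" "sq_summable g"
  shows "(\<lambda>i. f i * cnj (g i)) summable_on UNIV"
proof -
  have "(\<lambda>i. norm (f i * f i)) summable_on UNIV" "(\<lambda>i. norm (cnj (g i) * cnj (g i))) summable_on UNIV"
    using assms by (simp_all add: sq_summable_def norm_mult power2_eq_square)
  from abs_summable_product[OF this] show ?thesis
    by (rule abs_summable_summable)
qed

typedef 'i ell2 = "{f :: 'i \<Rightarrow> complex. sq_summable f}"
  by (rule exI[of _ "\<lambda>_. 0"]) (simp add: sq_summable_0)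

setup_lifting type_definition_ell2

lemma sq_summable_Rep: "sq_summable (Rep_ell2 f)"
  using Rep_ell2[of f] by simp

lemma infsum_mult_cnj_self: "infsum (\<lambda>i. f i * cnj (f i)) UNIV = complex_of_real (infsum (\<lambda>i. (cmod (f i))\<^sup>2) UNIV)"
  if "sq_summable f"
proof -
  have "((\<lambda>i. (cmod (f i))\<^sup>2) has_sum infsum (\<lambda>i. (cmod (f i))\<^sup>2) UNIV) UNIV"
    using that by (simp add: sq_summable_def)
  then have "((\<lambda>i. complex_of_real ((cmod (f i))\<^sup>2)) has_sum
      complex_of_real (infsum (\<lambda>i. (cmod (f i))\<^sup>2) UNIV)) UNIV"
    by (rule has_sum_of_real)
  then show ?thesis
    by (simp add: infsumI complex_norm_square[symmetric] del: of_real_power)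
qed

instantiation ell2 :: (type) real_vector
begin

lift_definition zero_ell2 :: "'i ell2" is "\<lambda>_. 0"
  by (rule sq_summable_0)

lift_definition plus_ell2 :: "'i ell2 \<Rightarrow> 'i ell2 \<Rightarrow> 'i ell2" is "\<lambda>f g i. f i + g i"
  by (rule sq_summable_add)

lift_definition uminus_ell2 :: "'i ell2 \<Rightarrow> 'i ell2" is "\<lambda>f i. - f i"
proof -
  fix f :: "'i \<Rightarrow> complex"
  assume "sq_summable f"
  then show "sq_summable (\<lambda>i. - f i)"
    using sq_summable_mult[of f "-1"] by simp
qed

lift_definition minus_ell2 :: "'i ell2 \<Rightarrow> 'i ell2 \<Rightarrow> 'i ell2" is "\<lambda>f g i. f i - g i"
proof -
  fix f g :: "'i \<Rightarrow> complex"
  assume "sq_summable f" "sq_summable g"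
  then show "sq_summable (\<lambda>i. f i - g i)"
    using sq_summable_add[of f "\<lambda>i. - 1 * g i"] sq_summable_mult[of g "-1"] by simp
qed

lift_definition scaleR_ell2 :: "real \<Rightarrow> 'i ell2 \<Rightarrow> 'i ell2" is "\<lambda>r f i. complex_of_real r * f i"
  by (rule sq_summable_mult)

instance
proof
  fix f g h :: "'i ell2" and r s :: real
  show "f + g + h = f + (g + h)" "f + g = g + f" "0 + f = f" "- f + f = 0" "f - g = f + - g"
    "r *\<^sub>R (f + g) = r *\<^sub>R f + r *\<^sub>R g" "(r + s) *\<^sub>R f = r *\<^sub>R f + s *\<^sub>R f"
    "r *\<^sub>R s *\<^sub>R f = (r * s) *\<^sub>R f" "1 *\<^sub>R f = f"
    by (transfer; simp add: algebra_simps)+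
qed

end

instantiation ell2 :: (type) real_inner
begin

lift_definition inner_ell2 :: "'i ell2 \<Rightarrow> 'i ell2 \<Rightarrow> real"
  is "\<lambda>f g. Re (infsum (\<lambda>i. f i * cnj (g i)) UNIV)" .

definition norm_ell2 :: "'i ell2 \<Rightarrow> real" where
  "norm_ell2 f = sqrt (inner f f)"

definition dist_ell2 :: "'i ell2 \<Rightarrow> 'i ell2 \<Rightarrow> real" where
  "dist_ell2 f g = norm (f - g)"

definition sgn_ell2 :: "'i ell2 \<Rightarrow> 'i ell2" where
  "sgn_ell2 f = f /\<^sub>R norm f"

definition uniformity_ell2 :: "('i ell2 \<times> 'i ell2) filter" where
  "uniformity_ell2 = (INF e\<in>{0 <..}. principal {(x, y). dist x y < e})"

definition open_ell2 :: "'i ell2 set \<Rightarrow> bool" where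
  "open_ell2 U = (\<forall>x\<in>U. eventually (\<lambda>(x', y). x' = x \<longrightarrow> y \<in> U) uniformity)"

instance
proof
  fix f g h :: "'i ell2" and r :: real
  show "dist f g = norm (f - g)" "sgn f = f /\<^sub>R norm f" "norm f = sqrt (inner f f)"
    "uniformity = (INF e\<in>{0 <..}. principal {(x, y). dist x (y::'i ell2) < e})"
    by (simp_all add: dist_ell2_def sgn_ell2_def norm_ell2_def uniformity_ell2_def)
  show "open U = (\<forall>x\<in>U. eventually (\<lambda>(x', y). x' = x \<longrightarrow> y \<in> U) uniformity)" for U :: "'i ell2 set"
    by (simp add: open_ell2_def)
  show "inner f g = inner g f"
  proof transfer
    fix f g :: "'i \<Rightarrow> complex"
    have "infsum (\<lambda>i. f i * cnj (g i)) UNIV = cnj (infsum (\<lambda>i. g i * cnj (f i)) UNIV)"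
      by (simp add: mult.commute flip: infsum_cnj)
    then show "Re (infsum (\<lambda>i. f i * cnj (g i)) UNIV) = Re (infsum (\<lambda>i. g i * cnj (f i)) UNIV)"
      by simp
  qed
  show "inner (f + g) h = inner f h + inner g h"
    by transfer (simp add: distrib_right infsum_add summable_mult_cnj)
  show "inner (r *\<^sub>R f) g = r * inner f g"
    by transfer (simp add: mult.assoc infsum_cmult_right summable_mult_cnj)
  show "0 \<le> inner f f"
    by transfer (simp add: infsum_mult_cnj_self infsum_nonneg)
  show "inner f f = 0 \<longleftrightarrow> f = 0"
  proof transfer
    fix f :: "'i \<Rightarrow> complex"
    assume f: "sq_summable f"
    have "f = (\<lambda>_. 0)" if "infsum (\<lambda>i. (cmod (f i))\<^sup>2) UNIV = 0"
    proof
      fix i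
      have "(cmod (f i))\<^sup>2 = 0"
        by (rule nonneg_infsum_le_0D[where A = UNIV]) (use that f in \<open>auto simp: sq_summable_def\<close>)
      then show "f i = 0" by simp
    qed
    then show "Re (infsum (\<lambda>i. f i * cnj (f i)) UNIV) = 0 \<longleftrightarrow> f = (\<lambda>_. 0)"
      using f by (auto simp: infsum_mult_cnj_self)
  qed
qed

end

lemma norm_ell2_sq: "(norm f)\<^sup>2 = infsum (\<lambda>i. (cmod (Rep_ell2 f i))\<^sup>2) UNIV"
  by (simp add: norm_ell2_def inner_ell2.rep_eq infsum_mult_cnj_self sq_summable_Rep infsum_nonneg)

lemma sum_le_norm_ell2_sq: "finite F \<Longrightarrow> (\<Sum>i\<in>F. (cmod (Rep_ell2 f i))\<^sup>2) \<le> (norm f)\<^sup>2"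
  unfolding norm_ell2_sq
  by (rule finite_sum_le_infsum) (use sq_summable_Rep[of f] in \<open>auto simp: sq_summable_def\<close>)

lemma sq_summable_bounded:
  assumes "\<And>F. finite F \<Longrightarrow> (\<Sum>i\<in>F. (cmod (f i))\<^sup>2) \<le> C"
  shows "sq_summable f" "infsum (\<lambda>i. (cmod (f i))\<^sup>2) UNIV \<le> C"
proof -
  show *: "sq_summable f"
    unfolding sq_summable_def
    by (rule nonneg_bdd_above_summable_on) (use assms in \<open>auto intro!: bdd_aboveI[of _ C]\<close>)
  show "infsum (\<lambda>i. (cmod (f i))\<^sup>2) UNIV \<le> C"
    by (rule infsum_le_finite_sums) (use * assms in \<open>auto simp: sq_summable_def\<close>)
qed

instance ell2 :: (type) complete_space
proof
  fix X :: "nat \<Rightarrow> 'i ell2"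
  assume X: "Cauchy X"
  have coord: "cmod (Rep_ell2 f i) \<le> norm f" for f :: "'i ell2" and i
    using sum_le_norm_ell2_sq[of "{i}" f] by (simp add: power2_le_iff_abs_le)
  have "Cauchy (\<lambda>n. Rep_ell2 (X n) i)" for i
  proof (rule metric_CauchyI)
    fix e :: real
    assume "e > 0"
    then obtain M where M: "\<forall>m\<ge>M. \<forall>n\<ge>M. dist (X m) (X n) < e"
      using metric_CauchyD[OF X] by blast
    have "dist (Rep_ell2 (X m) i) (Rep_ell2 (X n) i) \<le> dist (X m) (X n)" for m n
      using coord[of "X m - X n" i] by (simp add: dist_norm minus_ell2.rep_eq)
    then show "\<exists>M. \<forall>m\<ge>M. \<forall>n\<ge>M. dist (Rep_ell2 (X m) i) (Rep_ell2 (X n) i) < e"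
      using M by (meson le_less_trans)
  qed
  then have "\<forall>i. \<exists>l. (\<lambda>n. Rep_ell2 (X n) i) \<longlonglongrightarrow> l"
    by (simp add: Cauchy_convergent_iff convergent_def)
  then obtain g where g: "\<And>i. (\<lambda>n. Rep_ell2 (X n) i) \<longlonglongrightarrow> g i"
    by metis
  have bound: "(\<Sum>i\<in>F. (cmod (Rep_ell2 (X m) i - g i))\<^sup>2) \<le> e\<^sup>2"
    if "finite F" "e > 0" "\<forall>n\<ge>M. dist (X m) (X n) < e" for F e m M
  proof (rule tendsto_upperbound)
    show "(\<lambda>n. \<Sum>i\<in>F. (cmod (Rep_ell2 (X m) i - Rep_ell2 (X n) i))\<^sup>2)
        \<longlonglongrightarrow> (\<Sum>i\<in>F. (cmod (Rep_ell2 (X m) i - g i))\<^sup>2)"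
      by (intro tendsto_sum tendsto_power tendsto_norm tendsto_diff tendsto_const g)
    have "(\<Sum>i\<in>F. (cmod (Rep_ell2 (X m) i - Rep_ell2 (X n) i))\<^sup>2) \<le> e\<^sup>2" if "n \<ge> M" for n
    proof -
      have "(\<Sum>i\<in>F. (cmod (Rep_ell2 (X m - X n) i))\<^sup>2) \<le> (norm (X m - X n))\<^sup>2"
        by (rule sum_le_norm_ell2_sq) fact
      also have "\<dots> \<le> e\<^sup>2"
        using \<open>\<forall>n\<ge>M. dist (X m) (X n) < e\<close> that
        by (intro power_mono) (auto simp: dist_norm less_imp_le)
      finally show ?thesis by (simp add: minus_ell2.rep_eq)
    qed
    then show "\<forall>\<^sub>F n in sequentially. (\<Sum>i\<in>F. (cmod (Rep_ell2 (X m) i - Rep_ell2 (X n) i))\<^sup>2) \<le> e\<^sup>2"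
      unfolding eventually_sequentially by blast
  qed simp
  obtain M1 where M1: "\<forall>m\<ge>M1. \<forall>n\<ge>M1. dist (X m) (X n) < 1"
    using metric_CauchyD[OF X, of 1] by auto
  have diff: "sq_summable (\<lambda>i. Rep_ell2 (X M1) i - g i)"
    by (rule sq_summable_bounded(1)[of _ "1\<^sup>2"], rule bound[of _ _ M1]) (use M1 in auto)
  have "sq_summable g"
    using sq_summable_add[OF sq_summable_Rep[of "X M1"] sq_summable_mult[OF diff, of "-1"]] by simp
  then have Rep: "Rep_ell2 (Abs_ell2 g) = g"
    by (simp add: Abs_ell2_inverse)
  have "X \<longlonglongrightarrow> Abs_ell2 g"
  proof (rule metric_LIMSEQ_I)
    fix e :: real
    assume "e > 0"
    then obtain M where M: "\<forall>m\<ge>M. \<forall>n\<ge>M. dist (X m) (X n) < e / 2"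
      using metric_CauchyD[OF X, of "e / 2"] by auto
    have "dist (X m) (Abs_ell2 g) < e" if "m \<ge> M" for m
    proof -
      have "(norm (X m - Abs_ell2 g))\<^sup>2 \<le> (e / 2)\<^sup>2"
        unfolding norm_ell2_sq minus_ell2.rep_eq Rep
        by (rule sq_summable_bounded(2), rule bound[of _ _ M]) (use M that \<open>e > 0\<close> in auto)
      then have "norm (X m - Abs_ell2 g) \<le> e / 2"
        by (rule power2_le_imp_le) (use \<open>e > 0\<close> in simp)
      then show ?thesis
        using \<open>e > 0\<close> by (simp add: dist_norm)
    qed
    then show "\<exists>M. \<forall>m\<ge>M. dist (X m) (Abs_ell2 g) < e" by blast
  qed
  then show "convergent X" by (rule convergentI)
qed

instantiation ell2 :: (type) chilbert_space
begin

lift_definition scaleC_ell2 :: "complex \<Rightarrow> 'i ell2 \<Rightarrow> 'i ell2" is "\<lambda>c f i. c * f i"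
  by (rule sq_summable_mult)

lift_definition cinner_ell2 :: "'i ell2 \<Rightarrow> 'i ell2 \<Rightarrow> complex"
  is "\<lambda>f g. infsum (\<lambda>i. f i * cnj (g i)) UNIV" .

instance
proof
  fix f g h :: "'i ell2" and a b :: complex and r :: real
  show "a *\<^sub>C (f + g) = a *\<^sub>C f + a *\<^sub>C g" "(a + b) *\<^sub>C f = a *\<^sub>C f + b *\<^sub>C f"
    "a *\<^sub>C b *\<^sub>C f = (a * b) *\<^sub>C f" "r *\<^sub>R f = complex_of_real r *\<^sub>C f"
    by (transfer; simp add: algebra_simps)+
  show "cinner f g = cnj (cinner g f)"
    by transfer (simp add: mult.commute flip: infsum_cnj)
  show "cinner (f + g) h = cinner f h + cinner g h"
    by transfer (simp add: distrib_right infsum_add summable_mult_cnj)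
  show "cinner (a *\<^sub>C f) g = a * cinner f g"
    by transfer (simp add: mult.assoc infsum_cmult_right summable_mult_cnj)
  show "inner f g = Re (cinner f g)"
    by transfer simp
qed

end


section \<open>The Cuntz--Toeplitz algebra and its representations\<close>

lift_definition ket :: "'i \<Rightarrow> 'i ell2" is "\<lambda>i j. if j = i then 1 else 0"
proof -
  fix i :: 'i
  show "sq_summable (\<lambda>j. if j = i then 1 else 0)"
    unfolding sq_summable_def by (rule finite_nonzero_values_imp_summable_on) simp
qed

lemma has_sum_left_creation:
  assumes "sq_summable f"
  shows "((\<lambda>w. (cmod (case w of [] \<Rightarrow> 0 | j # v \<Rightarrow> if j = i then f v else 0))\<^sup>2)
    has_sum infsum (\<lambda>v. (cmod (f v))\<^sup>2) UNIV) UNIV" (is "(?F has_sum ?s) UNIV")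
proof -
  have "((?F \<circ> (#) i) has_sum ?s) UNIV"
    using assms by (simp add: sq_summable_def comp_def)
  then have "(?F has_sum ?s) (range ((#) i))"
    by (subst has_sum_reindex) auto
  then show ?thesis
    by (rule has_sum_cong_neutral[THEN iffD1, rotated 3]) (auto split: list.splits)
qed

text \<open>The isometry with \<open>left_creation i (ket w) = ket (i # w)\<close>.\<close>

lift_definition left_creation :: "'n \<Rightarrow> 'n list ell2 \<Rightarrow> 'n list ell2"
  is "\<lambda>i f w. case w of [] \<Rightarrow> 0 | j # v \<Rightarrow> if j = i then f v else 0"
  using has_sum_imp_summable[OF has_sum_left_creation] by (simp add: sq_summable_def)

lemma left_creation_ket: "left_creation i (ket w) = ket (i # w)"
  by transfer (auto simp: fun_eq_iff split: list.splits)

lemma norm_left_creation: "norm (left_creation i f) = norm f"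
proof (rule power2_eq_imp_eq)
  show "(norm (left_creation i f))\<^sup>2 = (norm f)\<^sup>2"
    unfolding norm_ell2_sq left_creation.rep_eq
    by (rule infsumI[OF has_sum_left_creation[OF sq_summable_Rep]])
qed simp_all

lemma cisometry_left_creation: "cisometry (left_creation i)"
proof -
  have "left_creation i (f + g) = left_creation i f + left_creation i g" for f g
    by transfer (auto simp: fun_eq_iff split: list.splits)
  moreover have "left_creation i (c *\<^sub>C f) = c *\<^sub>C left_creation i f" for c f
    by transfer (auto simp: fun_eq_iff split: list.splits)
  ultimately show ?thesis
    by (simp add: cisometry_def bounded_clinear_def norm_left_creation scaleR_scaleC
        bounded_linear_intro[where K = 1])
qed

inductive_set star_alg :: "('a::chilbert_space \<Rightarrow> 'a) set \<Rightarrow> ('a \<Rightarrow> 'a) set"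
  for G :: "('a \<Rightarrow> 'a) set" where
  one: "id \<in> star_alg G"
| gen: "X \<in> G \<Longrightarrow> X \<in> star_alg G"
| add: "X \<in> star_alg G \<Longrightarrow> Y \<in> star_alg G \<Longrightarrow> (\<lambda>v. X v + Y v) \<in> star_alg G"
| scale: "X \<in> star_alg G \<Longrightarrow> (\<lambda>v. c *\<^sub>C X v) \<in> star_alg G"
| mult: "X \<in> star_alg G \<Longrightarrow> Y \<in> star_alg G \<Longrightarrow> X \<circ> Y \<in> star_alg G"
| adj: "X \<in> star_alg G \<Longrightarrow> cadjoint X \<in> star_alg G"

text \<open>The closure of the unital *-algebra generated by \<open>G\<close> in the operator norm.\<close>

definition C_star_alg :: "('a::chilbert_space \<Rightarrow> 'a) set \<Rightarrow> ('a \<Rightarrow> 'a) set" where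
  "C_star_alg G =
     {X. bounded_clinear X \<and> (\<forall>e>0. \<exists>Y\<in>star_alg G. onorm (\<lambda>v. X v - Y v) < e)}"

definition cuntz_toeplitz :: "('n list ell2 \<Rightarrow> 'n list ell2) set" where
  "cuntz_toeplitz = C_star_alg (range left_creation)"

definition unital_star_rep ::
    "('a::chilbert_space \<Rightarrow> 'a) set \<Rightarrow> (('a \<Rightarrow> 'a) \<Rightarrow> ('h::chilbert_space \<Rightarrow> 'h)) \<Rightarrow> bool" where
  "unital_star_rep \<A> \<sigma> \<longleftrightarrow>
     (\<forall>X\<in>\<A>. bounded_clinear (\<sigma> X)) \<and>
     \<sigma> id = id \<and>
     (\<forall>X\<in>\<A>. \<forall>Y\<in>\<A>. \<sigma> (\<lambda>v. X v + Y v) = (\<lambda>v. \<sigma> X v + \<sigma> Y v)) \<and>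
     (\<forall>c. \<forall>X\<in>\<A>. \<sigma> (\<lambda>v. c *\<^sub>C X v) = (\<lambda>v. c *\<^sub>C \<sigma> X v)) \<and>
     (\<forall>X\<in>\<A>. \<forall>Y\<in>\<A>. \<sigma> (X \<circ> Y) = \<sigma> X \<circ> \<sigma> Y) \<and>
     (\<forall>X\<in>\<A>. \<sigma> (cadjoint X) = cadjoint (\<sigma> X))"

text \<open>
  For an \<open>n\<close>-tuple \<open>S\<close> of isometries with pairwise orthogonal ranges there is exactly one such
  representation, up to its values outside the algebra.
\<close>

definition induced_rep ::
    "('n \<Rightarrow> 'h::chilbert_space \<Rightarrow> 'h) \<Rightarrow>
     (('n list ell2 \<Rightarrow> 'n list ell2) \<Rightarrow> ('h \<Rightarrow> 'h)) \<Rightarrow> bool" where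
  "induced_rep S \<sigma> \<longleftrightarrow>
     unital_star_rep cuntz_toeplitz \<sigma> \<and> (\<forall>i. \<sigma> (left_creation i) = S i)"

definition unitarily_equivalent_reps ::
    "('a::chilbert_space \<Rightarrow> 'a) set \<Rightarrow> (('a \<Rightarrow> 'a) \<Rightarrow> ('h::chilbert_space \<Rightarrow> 'h)) \<Rightarrow>
     (('a \<Rightarrow> 'a) \<Rightarrow> ('k::chilbert_space \<Rightarrow> 'k)) \<Rightarrow> bool" where
  "unitarily_equivalent_reps \<A> \<sigma> \<tau> \<longleftrightarrow>
     (\<exists>U. unitary_between UNIV UNIV U \<and> (\<forall>X\<in>\<A>. U \<circ> \<sigma> X = \<tau> X \<circ> U))"

end

theory Submission
  imports Defs
begin

text \<open>
  A unitary equivalence of the representations is a unitary intertwining \<open>S\<close> and \<open>T\<close>, because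
  unital *-representations are contractive. Such unitaries preserve the wandering space (the common
  kernel of the adjoints), whose dimension is the rank of the defect. They also preserve the core,
  the span of the finite-dimensional minimal coinvariant subspaces of the dilation space on which
  the defect vanishes.

  The core is the image of the tilde space. Indeed, for every \<open>x\<close> the vectors \<open>S\<^sub>w\<^sup>* x\<close> with \<open>w\<close>
  long are close, in the square mean, to the original space \<open>V\<close>. By compactness every subspace
  \<open>W\<close> as above meets \<open>V\<close>, and by minimality \<open>W \<subseteq> V\<close>.

  Conversely, the wandering space and the core together generate the dilation space, since a
  nonzero reducing complement would contain another such \<open>W\<close>. Unitaries between the wandering
  spaces and between the tilde spaces therefore extend as in the proof that the minimal isometric
  dilation is unique.
\<close>

\<comment> \<open>A unitary that intertwines \<open>S\<close> and \<open>T\<close> need not carry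
  the range of \<open>J\<^sub>A\<close> to that of \<open>J\<^sub>B\<close>, so it does not act on
  the tilde spaces directly. Hence \<open>wandering_space\<close> and \<open>cuntz_core\<close> are
  defined from the tuple alone: such spaces are preserved automatically, and the embedded space
  enters only when the core is identified with the image of the tilde space. A rank is enough on the
  wandering part because all adjoints vanish there, so any unitary of the wandering spaces respects
  them. On the core the adjoints act, and a genuine unitary equivalence is required. Contractivity
  of representations must be proved because \<open>unital_star_rep\<close> contains no continuity.
  It comes from a self-adjoint V in the algebra with V^2 + X* X = 1. Such a V is produced by a fixed
  point argument, so no spectral theory is involved.\<close>
subclass (in chilbert_space) banach ..


section \<open>Complex inner products, projections and adjoints\<close>

lemma cinner_add_right: "cinner x (y + z) = cinner x y + cinner x (z::'a::chilbert_space)"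
  using cinner_commute[of x "y + z"] cinner_commute[of x y] cinner_commute[of x z]
  by (simp add: cinner_add_left)

lemma cinner_scaleC_right: "cinner x (c *\<^sub>C y) = cnj c * cinner x (y::'a::chilbert_space)"
  using cinner_commute[of x "c *\<^sub>C y"] cinner_commute[of x y] by (simp add: cinner_scaleC_left)

lemma scaleC_simps [simp]:
  fixes x :: "'a::chilbert_space"
  shows "1 *\<^sub>C x = x" "0 *\<^sub>C x = 0" "c *\<^sub>C (0::'a) = 0" "(- c) *\<^sub>C x = - (c *\<^sub>C x)"
    "c *\<^sub>C (- x) = - (c *\<^sub>C x)" "a *\<^sub>C b *\<^sub>C x = (a * b) *\<^sub>C x"
  by (simp_all add: scaleC_scaleC)

lemma scaleC_diff_right: "c *\<^sub>C (x - y) = c *\<^sub>C x - c *\<^sub>C (y::'a::chilbert_space)"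
  by (rule cvs.scale_right_diff_distrib)

lemma cinner_zero [simp]:
  "cinner 0 (x::'a::chilbert_space) = 0" "cinner (x::'a::chilbert_space) 0 = 0"
  using cinner_scaleC_left[of 0 0 x] cinner_scaleC_right[of x 0 0] by simp_all

lemma cinner_minus [simp]:
  "cinner (- x) (y::'a::chilbert_space) = - cinner x y" "cinner (x::'a::chilbert_space) (- y) = - cinner x y"
  using cinner_scaleC_left[of "-1" x y] cinner_scaleC_right[of x "-1" y] by simp_all

lemma cinner_diff:
  "cinner (x - y) (z::'a::chilbert_space) = cinner x z - cinner y z"
  "cinner (z::'a::chilbert_space) (x - y) = cinner z x - cinner z y"
  using cinner_add_left[of x "-y" z] cinner_add_right[of z x "-y"] by simp_all

lemma cinner_sum_left: "cinner (\<Sum>i\<in>I. f i) (y::'a::chilbert_space) = (\<Sum>i\<in>I. cinner (f i) y)"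
  by (induction I rule: infinite_finite_induct) (simp_all add: cinner_add_left)

lemma cinner_sum_right: "cinner (y::'a::chilbert_space) (\<Sum>i\<in>I. f i) = (\<Sum>i\<in>I. cinner y (f i))"
  by (induction I rule: infinite_finite_induct) (simp_all add: cinner_add_right)

lemma cinner_self: "cinner x x = complex_of_real ((norm (x::'a::chilbert_space))\<^sup>2)"
proof -
  have "Im (cinner x x) = 0"
    using arg_cong[OF cinner_commute[of x x], of Im] by simp
  then show ?thesis
    using inner_eq_Re_cinner[of x x] by (simp add: complex_eq_iff power2_norm_eq_inner)
qed

lemma cinner_self_eq_0 [simp]: "cinner x x = 0 \<longleftrightarrow> (x::'a::chilbert_space) = 0"
  by (simp add: cinner_self)

lemma cinner_extI: "(\<And>z. cinner x z = cinner y z) \<Longrightarrow> x = (y::'a::chilbert_space)"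
  using cinner_self_eq_0[of "x - y"] by (simp add: cinner_diff(1))

lemma cinner_extI2: "(\<And>z. cinner z x = cinner z y) \<Longrightarrow> x = (y::'a::chilbert_space)"
  using cinner_self_eq_0[of "x - y"] by (simp add: cinner_diff(2))

lemma cinner_eq_0_commute: "cinner x y = 0 \<longleftrightarrow> cinner y (x::'a::chilbert_space) = 0"
  by (metis cinner_commute complex_cnj_zero_iff)

text \<open>Since Re (-i z) = Im z, the real inner product determines the complex one. Continuity,
  limits and polarization are thereby inherited from the real theory.\<close>

lemma cinner_eq_Complex: "cinner x (y::'a::chilbert_space) = Complex (inner x y) (inner x (\<i> *\<^sub>C y))"
  by (simp add: complex_eq_iff inner_eq_Re_cinner cinner_scaleC_right)

lemma norm_scaleC [simp]: "norm (c *\<^sub>C x) = cmod c * norm (x::'a::chilbert_space)"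
proof -
  have "complex_of_real ((norm (c *\<^sub>C x))\<^sup>2) = (c * cnj c) * cinner x x"
    unfolding cinner_self[symmetric] cinner_scaleC_left cinner_scaleC_right by simp
  also have "\<dots> = complex_of_real ((cmod c * norm x)\<^sup>2)"
    unfolding complex_norm_square[symmetric] cinner_self by (simp add: power_mult_distrib)
  finally show ?thesis
    by (subst (asm) of_real_eq_iff) (simp add: power2_eq_iff_nonneg)
qed

lemma bounded_linear_scaleC: "bounded_linear (\<lambda>x::'a::chilbert_space. c *\<^sub>C x)"
  by (rule bounded_linear_intro[where K = "cmod c"])
     (simp_all add: scaleC_add_right scaleR_scaleC mult.commute)

lemma bounded_linear_scaleC_left: "bounded_linear (\<lambda>c. c *\<^sub>C (x::'a::chilbert_space))"
  by (rule bounded_linear_intro[where K = "norm x"])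
     (simp_all add: scaleC_add_left scaleR_scaleC scaleR_conv_of_real)

lemma continuous_on_scaleC [continuous_intros]:
  "continuous_on X f \<Longrightarrow> continuous_on X (\<lambda>z. c *\<^sub>C (f z :: 'a::chilbert_space))"
  by (rule bounded_linear.continuous_on[OF bounded_linear_scaleC])

lemma continuous_on_cinner [continuous_intros]:
  assumes "continuous_on X f" "continuous_on X g"
  shows "continuous_on X (\<lambda>z. cinner (f z) (g z :: 'a::chilbert_space))"
  unfolding cinner_eq_Complex by (intro continuous_intros assms)

lemma tendsto_scaleC: "(f \<longlongrightarrow> (x::'a::chilbert_space)) F \<Longrightarrow> ((\<lambda>z. c *\<^sub>C f z) \<longlongrightarrow> c *\<^sub>C x) F"
  by (rule bounded_linear.tendsto[OF bounded_linear_scaleC])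

lemma tendsto_cinner:
  assumes "(f \<longlongrightarrow> (x::'a::chilbert_space)) F" "(g \<longlongrightarrow> y) F"
  shows "((\<lambda>z. cinner (f z) (g z)) \<longlongrightarrow> cinner x y) F"
  unfolding cinner_eq_Complex by (intro tendsto_intros tendsto_scaleC assms)

lemma norm_sq_add_orthogonal:
  fixes x y :: "'a::chilbert_space"
  assumes "cinner x y = 0"
  shows "(norm (x + y))\<^sup>2 = (norm x)\<^sup>2 + (norm y)\<^sup>2"
proof -
  have "inner x y = 0"
    using assms by (simp add: inner_eq_Re_cinner)
  then show ?thesis
    by (simp add: power2_norm_eq_inner inner_add inner_commute)
qed

lemma norm_sq_diff_scaleR:
  "(norm (u - t *\<^sub>R y))\<^sup>2 = (norm u)\<^sup>2 - 2 * t * inner u y + t\<^sup>2 * (norm (y::'a::real_inner))\<^sup>2"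
  unfolding power2_norm_eq_inner
  by (simp add: inner_diff inner_commute algebra_simps power2_eq_square)

lemma norm_sq_sum_orthogonal:
  fixes f :: "'i \<Rightarrow> 'a::chilbert_space"
  assumes "finite I" "\<And>i j. i \<in> I \<Longrightarrow> j \<in> I \<Longrightarrow> i \<noteq> j \<Longrightarrow> cinner (f i) (f j) = 0"
  shows "(norm (\<Sum>i\<in>I. f i))\<^sup>2 = (\<Sum>i\<in>I. (norm (f i))\<^sup>2)"
  using assms
proof (induction I)
  case (insert i I)
  have "cinner (f i) (\<Sum>i\<in>I. f i) = 0"
    unfolding cinner_sum_right using insert by (intro sum.neutral) auto
  then show ?case
    using insert by (simp add: norm_sq_add_orthogonal)
qed simp

section \<open>Closed subspaces and orthogonal projections\<close>

lemma csubspace_imp_subspace: "csubspace M \<Longrightarrow> subspace (M :: 'a::chilbert_space set)"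
  by (auto simp: subspace_def cvs.subspace_def scaleR_scaleC)

lemma closure_csubspace:
  fixes M :: "'a::chilbert_space set"
  assumes M: "csubspace M"
  shows "csubspace (closure M)"
proof (rule cvs.subspaceI)
  show "0 \<in> closure M"
    using cvs.subspace_0[OF M] closure_subset by blast
  show "x + y \<in> closure M" if xy: "x \<in> closure M" "y \<in> closure M" for x y
  proof -
    obtain f g where "\<And>n. f n \<in> M" "f \<longlonglongrightarrow> x" "\<And>n. g n \<in> M" "g \<longlonglongrightarrow> y"
      using xy unfolding closure_sequential by blast
    then show ?thesis
      unfolding closure_sequential
      by (intro exI[of _ "\<lambda>n. f n + g n"]) (auto intro: tendsto_add cvs.subspace_add[OF M])
  qed
  show "c *\<^sub>C x \<in> closure M" if x: "x \<in> closure M" for c x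
  proof -
    obtain f where "\<And>n. f n \<in> M" "f \<longlonglongrightarrow> x"
      using x unfolding closure_sequential by blast
    then show ?thesis
      unfolding closure_sequential
      by (intro exI[of _ "\<lambda>n. c *\<^sub>C f n"]) (auto intro: tendsto_scaleC cvs.subspace_scale[OF M])
  qed
qed

text \<open>A minimizing sequence is Cauchy by the parallelogram law.\<close>

lemma nearest_point_exists:
  fixes M :: "'a::chilbert_space set"
  assumes M: "subspace M" "closed M"
  obtains m where "m \<in> M" "\<And>y. y \<in> M \<Longrightarrow> norm (x - m) \<le> norm (x - y)"
proof -
  define d where "d = (INF y\<in>M. norm (x - y))"
  have ne: "M \<noteq> {}"
    using subspace_0[OF M(1)] by blast
  have bdd: "bdd_below ((\<lambda>y. norm (x - y)) ` M)"
    by (rule bdd_belowI[of _ 0]) auto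
  have d_le: "d \<le> norm (x - y)" if "y \<in> M" for y
    unfolding d_def by (rule cINF_lower[OF bdd that])
  have d0: "0 \<le> d"
    unfolding d_def by (rule cINF_greatest[OF ne]) simp
  have "\<exists>y\<in>M. norm (x - y) < d + inverse (Suc n)" for n
    using cINF_less_iff[OF ne bdd, of "d + inverse (Suc n)"] unfolding d_def by simp
  then obtain f where fM: "\<And>n. f n \<in> M" and f: "\<And>n. norm (x - f n) < d + inverse (Suc n)"
    by metis
  have inv0: "(\<lambda>n. inverse (real (Suc n))) \<longlonglongrightarrow> 0"
    by (rule LIMSEQ_inverse_real_of_nat)
  have lim: "(\<lambda>n. norm (x - f n)) \<longlonglongrightarrow> d"
  proof (rule tendsto_sandwich)
    show "(\<lambda>n. d) \<longlonglongrightarrow> d" "(\<lambda>n. d + inverse (real (Suc n))) \<longlonglongrightarrow> d"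
      using tendsto_add[OF tendsto_const inv0, of d] by simp_all
  qed (use d_le[OF fM] f in \<open>auto simp: less_imp_le\<close>)
  have para: "(norm (f m - f n))\<^sup>2 \<le> 2 * ((norm (x - f m))\<^sup>2 - d\<^sup>2) + 2 * ((norm (x - f n))\<^sup>2 - d\<^sup>2)" for m n
  proof -
    have "(1/2) *\<^sub>R (f m + f n) \<in> M"
      by (intro subspace_scale subspace_add fM M)
    then have "d \<le> norm (x - (1/2) *\<^sub>R (f m + f n))"
      by (rule d_le)
    then have "(2 * d)\<^sup>2 \<le> (2 * norm (x - (1/2) *\<^sub>R (f m + f n)))\<^sup>2"
      using d0 by (intro power_mono) auto
    also have "2 * norm (x - (1/2) *\<^sub>R (f m + f n)) = norm (2 *\<^sub>R (x - (1/2) *\<^sub>R (f m + f n)))"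
      by (simp del: scaleR_diff_right)
    also have "2 *\<^sub>R (x - (1/2) *\<^sub>R (f m + f n)) = (x - f m) + (x - f n)"
      by (simp add: scaleR_2 algebra_simps)
    finally have "4 * d\<^sup>2 \<le> (norm ((x - f m) + (x - f n)))\<^sup>2"
      by (simp add: power_mult_distrib)
    moreover have "(norm ((x - f m) + (x - f n)))\<^sup>2 + (norm ((x - f n) - (x - f m)))\<^sup>2
        = 2 * (norm (x - f m))\<^sup>2 + 2 * (norm (x - f n))\<^sup>2"
      by (simp add: power2_norm_eq_inner inner_add inner_diff inner_commute algebra_simps)
    moreover have "(x - f n) - (x - f m) = f m - f n"
      by simp
    ultimately show ?thesis
      by simp
  qed
  have "Cauchy f"
  proof (rule metric_CauchyI)
    fix e :: real
    assume "e > 0"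
    have "(\<lambda>n. (norm (x - f n))\<^sup>2 - d\<^sup>2) \<longlonglongrightarrow> d\<^sup>2 - d\<^sup>2"
      by (intro tendsto_intros lim)
    then have "\<forall>\<^sub>F n in sequentially. (norm (x - f n))\<^sup>2 - d\<^sup>2 < e\<^sup>2 / 4"
      using \<open>e > 0\<close> by (intro order_tendstoD(2)) auto
    then obtain K where K: "\<And>n. n \<ge> K \<Longrightarrow> (norm (x - f n))\<^sup>2 - d\<^sup>2 < e\<^sup>2 / 4"
      unfolding eventually_sequentially by blast
    have "dist (f m) (f n) < e" if "m \<ge> K" "n \<ge> K" for m n
    proof -
      have "(norm (f m - f n))\<^sup>2 < e\<^sup>2"
        using para[of m n] K[OF that(1)] K[OF that(2)] by simp
      then show ?thesis
        using \<open>e > 0\<close> by (simp add: dist_norm power_less_imp_less_base)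
    qed
    then show "\<exists>K. \<forall>m\<ge>K. \<forall>n\<ge>K. dist (f m) (f n) < e"
      by blast
  qed
  then obtain m where m: "f \<longlonglongrightarrow> m"
    using Cauchy_convergent convergent_def by blast
  have "m \<in> M"
    using closed_sequentially[OF M(2)] fM m by blast
  have "(\<lambda>n. norm (x - f n)) \<longlonglongrightarrow> norm (x - m)"
    by (intro tendsto_intros m)
  then have "norm (x - m) = d"
    using lim LIMSEQ_unique by blast
  with \<open>m \<in> M\<close> that d_le show ?thesis
    by metis
qed

text \<open>Moving the nearest point \<open>m\<close> along \<open>y\<close> cannot shorten the
  distance, so the real inner product vanishes. The same for \<open>\<i> *\<^sub>C y\<close> removes
  the imaginary part.\<close>

lemma orthogonal_decomposition:
  fixes M :: "'a::chilbert_space set"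
  assumes M: "csubspace M" "closed M"
  obtains m where "m \<in> M" "\<And>y. y \<in> M \<Longrightarrow> cinner (x - m) y = 0"
proof -
  obtain m where mM: "m \<in> M" and m: "\<And>y. y \<in> M \<Longrightarrow> norm (x - m) \<le> norm (x - y)"
    using nearest_point_exists[OF csubspace_imp_subspace[OF M(1)] M(2)] by metis
  have re: "inner (x - m) y = 0" if y: "y \<in> M" for y
  proof (cases "y = 0")
    case False
    \<comment> \<open>The minimizer of the quadratic in \<open>norm_sq_diff_scaleR\<close>; a
      nonzero inner product would make this step come strictly closer to \<open>x\<close>.\<close>
    define t where "t = inner (x - m) y / (norm y)\<^sup>2"
    have "m + complex_of_real t *\<^sub>C y \<in> M"
      by (intro cvs.subspace_add cvs.subspace_scale M mM y)
    then have "m + t *\<^sub>R y \<in> M"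
      by (simp add: scaleR_scaleC)
    from m[OF this] have "(norm (x - m))\<^sup>2 \<le> (norm ((x - m) - t *\<^sub>R y))\<^sup>2"
      by (intro power_mono) (auto simp: diff_diff_eq)
    also have "\<dots> = (norm (x - m))\<^sup>2 - 2 * t * inner (x - m) y + t\<^sup>2 * (norm y)\<^sup>2"
      by (rule norm_sq_diff_scaleR)
    also have "\<dots> = (norm (x - m))\<^sup>2 - (inner (x - m) y)\<^sup>2 / (norm y)\<^sup>2"
      using False by (simp add: t_def power2_eq_square field_simps)
    finally have "(inner (x - m) y)\<^sup>2 / (norm y)\<^sup>2 \<le> 0"
      by simp
    then show ?thesis
      using False by (simp add: divide_le_0_iff)
  qed simp
  have "cinner (x - m) y = 0" if y: "y \<in> M" for y
    using re[OF y] re[OF cvs.subspace_scale[OF M(1) y, of \<i>]]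
    by (simp add: cinner_eq_Complex complex_eq_iff)
  with mM that show ?thesis
    by blast
qed

text \<open>The choice makes the map total; for a closed subspace the chosen point is unique and
  this is the orthogonal projection.\<close>

definition cproj :: "'a::chilbert_space set \<Rightarrow> 'a \<Rightarrow> 'a" where
  "cproj M x = (SOME m. m \<in> M \<and> (\<forall>y\<in>M. cinner (x - m) y = 0))"

context
  fixes M :: "'a::chilbert_space set"
  assumes M: "csubspace M" "closed M"
begin

lemma cproj_in: "cproj M x \<in> M"
  and cproj_orthogonal: "y \<in> M \<Longrightarrow> cinner (x - cproj M x) y = 0"
proof -
  obtain m where "m \<in> M" "\<And>y. y \<in> M \<Longrightarrow> cinner (x - m) y = 0"
    using orthogonal_decomposition[OF M] by metis
  then have "\<exists>m. m \<in> M \<and> (\<forall>y\<in>M. cinner (x - m) y = 0)"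
    by blast
  from someI_ex[OF this]
  show "cproj M x \<in> M" "y \<in> M \<Longrightarrow> cinner (x - cproj M x) y = 0"
    unfolding cproj_def by blast+
qed

lemma cproj_unique:
  assumes "m \<in> M" "\<And>y. y \<in> M \<Longrightarrow> cinner (x - m) y = 0"
  shows "cproj M x = m"
proof -
  have "cproj M x - m \<in> M"
    by (intro cvs.subspace_diff M cproj_in assms)
  then have "cinner (x - m) (cproj M x - m) - cinner (x - cproj M x) (cproj M x - m) = 0"
    using assms(2) cproj_orthogonal by simp
  then have "cinner ((x - m) - (x - cproj M x)) (cproj M x - m) = 0"
    by (simp only: cinner_diff(1))
  moreover have "(x - m) - (x - cproj M x) = cproj M x - m"
    by simp
  ultimately show ?thesis
    by (metis cinner_self_eq_0 eq_iff_diff_eq_0)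
qed

lemma cproj_id: "x \<in> M \<Longrightarrow> cproj M x = x"
  by (rule cproj_unique) simp_all

lemma cproj_add: "cproj M (x + y) = cproj M x + cproj M y"
proof (rule cproj_unique)
  show "cproj M x + cproj M y \<in> M"
    by (intro cvs.subspace_add M cproj_in)
  fix z
  assume "z \<in> M"
  then have "cinner ((x - cproj M x) + (y - cproj M y)) z = 0"
    by (simp add: cinner_add_left cproj_orthogonal)
  then show "cinner (x + y - (cproj M x + cproj M y)) z = 0"
    by (simp add: algebra_simps)
qed

lemma cproj_scaleC: "cproj M (c *\<^sub>C x) = c *\<^sub>C cproj M x"
proof (rule cproj_unique)
  show "c *\<^sub>C cproj M x \<in> M"
    by (intro cvs.subspace_scale M cproj_in)
  show "cinner (c *\<^sub>C x - c *\<^sub>C cproj M x) z = 0" if "z \<in> M" for z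
    using cproj_orthogonal[OF that, of x] unfolding scaleC_diff_right[symmetric]
    by (simp only: cinner_scaleC_left mult_zero_right)
qed

lemma norm_cproj: "(norm x)\<^sup>2 = (norm (cproj M x))\<^sup>2 + (norm (x - cproj M x))\<^sup>2"
  using norm_sq_add_orthogonal[of "x - cproj M x" "cproj M x"] cproj_orthogonal[OF cproj_in]
  by simp

lemma norm_cproj_le: "norm (cproj M x) \<le> norm x" "norm (x - cproj M x) \<le> norm x"
  using norm_cproj[of x] by (auto intro: power2_le_imp_le)

end

section \<open>Bounded complex-linear maps, Riesz representation and adjoints\<close>

lemma bounded_clinearI:
  assumes "\<And>x y. f (x + y) = f x + f y" "\<And>c x. f (c *\<^sub>C x) = c *\<^sub>C f x"
    "\<And>x. norm (f x) \<le> norm x * K"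
  shows "bounded_clinear f"
  unfolding bounded_clinear_def
  using assms by (auto intro!: bounded_linear_intro[of f K] simp: scaleR_scaleC)

lemma bounded_clinear_bl: "bounded_clinear f \<Longrightarrow> bounded_linear f"
  by (simp add: bounded_clinear_def)

lemma bounded_clinear_scaleC: "bounded_clinear f \<Longrightarrow> f (c *\<^sub>C x) = c *\<^sub>C f x"
  by (simp add: bounded_clinear_def)

lemma bounded_clinear_add: "bounded_clinear f \<Longrightarrow> f (x + y) = f x + f y"
  by (rule linear_simps(1)[OF bounded_clinear_bl])

lemma bounded_clinear_diff: "bounded_clinear f \<Longrightarrow> f (x - y) = f x - f y"
  by (rule linear_simps(2)[OF bounded_clinear_bl])

lemma bounded_clinear_0 [simp]: "bounded_clinear f \<Longrightarrow> f 0 = 0"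
  by (rule linear_simps(3)[OF bounded_clinear_bl])

lemma bounded_clinear_sum: "bounded_clinear f \<Longrightarrow> f (\<Sum>i\<in>I. g i) = (\<Sum>i\<in>I. f (g i))"
  by (induction I rule: infinite_finite_induct) (simp_all add: bounded_clinear_add)

lemma bounded_clinear_id: "bounded_clinear id" "bounded_clinear (\<lambda>x. x)"
  by (simp_all add: bounded_clinear_def id_def)

lemma bounded_clinear_comp: "bounded_clinear f \<Longrightarrow> bounded_clinear g \<Longrightarrow> bounded_clinear (f \<circ> g)"
  by (simp add: bounded_clinear_def bounded_linear_compose comp_def)

lemma bounded_clinear_plus: "bounded_clinear f \<Longrightarrow> bounded_clinear g \<Longrightarrow> bounded_clinear (\<lambda>x. f x + g x)"
  by (simp add: bounded_clinear_def bounded_linear_add scaleC_add_right)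

lemma bounded_clinear_minus: "bounded_clinear f \<Longrightarrow> bounded_clinear g \<Longrightarrow> bounded_clinear (\<lambda>x. f x - g x)"
  by (simp add: bounded_clinear_def bounded_linear_sub scaleC_diff_right)

lemma bounded_clinear_zero: "bounded_clinear (\<lambda>x. 0)"
  by (simp add: bounded_clinear_def)

lemma bounded_clinear_sum_ops:
  "(\<And>i. i \<in> I \<Longrightarrow> bounded_clinear (f i)) \<Longrightarrow> bounded_clinear (\<lambda>x. \<Sum>i\<in>I. f i x)"
  by (induction I rule: infinite_finite_induct) (simp_all add: bounded_clinear_plus bounded_clinear_zero)

lemma bounded_clinear_scale: "bounded_clinear f \<Longrightarrow> bounded_clinear (\<lambda>x. c *\<^sub>C f x)"
  unfolding bounded_clinear_def
  using bounded_linear_compose[OF bounded_linear_scaleC] by (auto simp: mult.commute)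

lemma bounded_clinear_continuous_on: "bounded_clinear f \<Longrightarrow> continuous_on X f"
  by (simp add: bounded_clinear_bl linear_continuous_on)

lemma csubspace_vimage: "bounded_clinear f \<Longrightarrow> csubspace M \<Longrightarrow> csubspace (f -` M)"
  by (auto intro!: cvs.subspaceI
      simp: bounded_clinear_add bounded_clinear_scaleC cvs.subspace_0 cvs.subspace_add cvs.subspace_scale)

lemma csubspace_image: "bounded_clinear f \<Longrightarrow> csubspace M \<Longrightarrow> csubspace (f ` M)"
proof (rule cvs.subspaceI)
  assume f: "bounded_clinear f" and M: "csubspace M"
  show "0 \<in> f ` M"
    using f cvs.subspace_0[OF M] by (metis bounded_clinear_0 imageI)
  show "x + y \<in> f ` M" if "x \<in> f ` M" "y \<in> f ` M" for x y
    using that cvs.subspace_add[OF M] by (auto simp: bounded_clinear_add[OF f, symmetric])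
  show "c *\<^sub>C x \<in> f ` M" if "x \<in> f ` M" for c x
    using that cvs.subspace_scale[OF M] by (auto simp: bounded_clinear_scaleC[OF f, symmetric])
qed

lemma cspan_image: "bounded_clinear f \<Longrightarrow> cspan (f ` X) = f ` cspan X"
proof
  assume f: "bounded_clinear f"
  show "cspan (f ` X) \<subseteq> f ` cspan X"
    by (intro cvs.span_minimal csubspace_image f cvs.subspace_span image_mono cvs.span_superset)
  have "cspan X \<subseteq> f -` cspan (f ` X)"
    by (intro cvs.span_minimal csubspace_vimage f cvs.subspace_span) (auto intro: cvs.span_base)
  then show "f ` cspan X \<subseteq> cspan (f ` X)"
    by blast
qed

text \<open>The kernel of a nonzero \<open>f\<close> has a one-dimensional complement, spanned by
  the component \<open>u\<close> orthogonal to the kernel of any \<open>z\<close> outside it. The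
  representing vector is the multiple of \<open>u\<close> whose pairing with \<open>u\<close> is
  \<open>f u\<close>.\<close>

lemma riesz_representation:
  fixes f :: "'a::chilbert_space \<Rightarrow> complex"
  assumes f: "bounded_linear f" and scale: "\<And>c x. f (c *\<^sub>C x) = c * f x"
  obtains y where "\<And>x. f x = cinner x y"
proof -
  define M where "M = {x. f x = 0}"
  have M: "csubspace M"
    unfolding cvs.subspace_def M_def mem_Collect_eq linear_simps(1,3)[OF f] scale by simp
  have cl: "closed M"
    unfolding M_def
    by (rule closed_Collect_eq) (use f in \<open>auto intro: linear_continuous_on\<close>)
  show ?thesis
  proof (cases "M = UNIV")
    case True
    then have "f x = cinner x 0" for x
      by (auto simp: M_def)
    then show ?thesis ..
  next
    case False
    then obtain z where z: "z \<notin> M"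
      by blast
    define u where "u = z - cproj M z"
    have u: "cinner u x = 0" if "x \<in> M" for x
      unfolding u_def by (rule cproj_orthogonal[OF M cl that])
    have fu: "f u = f z" "f u \<noteq> 0"
      using z cproj_in[OF M cl, of z] by (auto simp: u_def M_def linear_simps[OF f])
    then have "u \<noteq> 0"
      using linear_simps(3)[OF f] by metis
    have "f x = cinner x ((cnj (f u) / (norm u)\<^sup>2) *\<^sub>C u)" for x
    proof -
      have "x - (f x / f u) *\<^sub>C u \<in> M"
        using fu by (simp add: M_def linear_simps[OF f] scale)
      then have "cinner (x - (f x / f u) *\<^sub>C u) u = 0"
        using u cinner_eq_0_commute by blast
      then have "cinner x u = f x / f u * (norm u)\<^sup>2"
        by (simp add: cinner_diff cinner_scaleC_left cinner_self)
      then show ?thesis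
        using fu \<open>u \<noteq> 0\<close> by (simp add: cinner_scaleC_right)
    qed
    then show ?thesis ..
  qed
qed

lemma cadjoint_eqI:
  assumes "\<And>x y. cinner (f x) y = cinner x (g y)"
  shows "cadjoint f = g"
  unfolding cadjoint_def
proof (rule the_equality)
  show "h = g" if "\<forall>x y. cinner (f x) y = cinner x (h y)" for h
    using that assms by (metis cinner_extI2 ext)
qed (use assms in blast)

text \<open>\<open>cadjoint\<close> is a definite description, so its defining equation needs
  existence. Riesz supplies the value at each \<open>y\<close> separately, and boundedness of the
  resulting map is deduced afterwards.\<close>

lemma cinner_cadjoint:
  assumes f: "bounded_clinear f"
  shows "cinner (f x) y = cinner x (cadjoint f y)"
proof -
  have "\<exists>z. \<forall>x. cinner (f x) y = cinner x z" for y
  proof -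
    have "bounded_linear (\<lambda>x. cinner (f x) y)"
    proof -
      have "bounded_linear (\<lambda>x. complex_of_real (inner x y) + \<i> * complex_of_real (inner x (\<i> *\<^sub>C y)))"
        by (intro bounded_linear_add bounded_linear_const_mult
            bounded_linear_compose[OF bounded_linear_of_real bounded_linear_inner_left])
      from bounded_linear_compose[OF this bounded_clinear_bl[OF f]] show ?thesis
        by (simp add: cinner_eq_Complex Complex_eq)
    qed
    then obtain z where "\<And>x. cinner (f x) y = cinner x z"
      by (rule riesz_representation) (simp_all add: bounded_clinear_scaleC[OF f] cinner_scaleC_left)
    then show ?thesis
      by blast
  qed
  then obtain g where g: "\<And>x y. cinner (f x) y = cinner x (g y)"
    by metis
  then have "cadjoint f = g"
    by (rule cadjoint_eqI)
  with g show ?thesis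
    by simp
qed

lemma cinner_cadjoint': "bounded_clinear f \<Longrightarrow> cinner (cadjoint f x) y = cinner x (f y)"
  by (metis cinner_cadjoint cinner_commute)

text \<open>The square of the left side is the pairing of \<open>f (cadjoint f y)\<close> with
  \<open>y\<close>; Cauchy-Schwarz bounds it, and one factor cancels.\<close>

lemma norm_cadjoint_le:
  assumes f: "bounded_clinear f"
  shows "norm (cadjoint f y) \<le> onorm f * norm y"
proof -
  have "inner (cadjoint f y) (cadjoint f y) = inner (f (cadjoint f y)) y"
    by (simp add: inner_eq_Re_cinner cinner_cadjoint[OF f])
  then have "(norm (cadjoint f y))\<^sup>2 \<le> norm (f (cadjoint f y)) * norm y"
    using Cauchy_Schwarz_ineq2[of "f (cadjoint f y)" y] by (simp add: power2_norm_eq_inner)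
  also have "\<dots> \<le> onorm f * norm (cadjoint f y) * norm y"
    by (intro mult_right_mono onorm bounded_clinear_bl f) simp
  finally have "norm (cadjoint f y) * norm (cadjoint f y) \<le> (onorm f * norm y) * norm (cadjoint f y)"
    by (simp add: power2_eq_square algebra_simps)
  moreover have "0 \<le> onorm f * norm y"
    by (intro mult_nonneg_nonneg onorm_pos_le bounded_clinear_bl f) simp
  ultimately show ?thesis
    by (cases "norm (cadjoint f y) = 0") (auto simp: mult_le_cancel_right)
qed

lemma bounded_clinear_cadjoint:
  assumes f: "bounded_clinear f"
  shows "bounded_clinear (cadjoint f)"
proof (rule bounded_clinearI)
  show "cadjoint f (x + y) = cadjoint f x + cadjoint f y" for x y
    by (rule cinner_extI2) (simp add: cinner_cadjoint[OF f, symmetric] cinner_add_right)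
  show "cadjoint f (c *\<^sub>C x) = c *\<^sub>C cadjoint f x" for c x
    by (rule cinner_extI2) (simp add: cinner_cadjoint[OF f, symmetric] cinner_scaleC_right)
  show "norm (cadjoint f x) \<le> norm x * onorm f" for x
    using norm_cadjoint_le[OF f, of x] by (simp add: mult.commute)
qed

lemma cadjoint_id: "cadjoint id = id"
  by (rule cadjoint_eqI) simp

lemma cadjoint_comp:
  "bounded_clinear f \<Longrightarrow> bounded_clinear g \<Longrightarrow> cadjoint (f \<circ> g) = cadjoint g \<circ> cadjoint f"
  by (rule cadjoint_eqI) (simp add: cinner_cadjoint)

lemma cadjoint_plus:
  "bounded_clinear f \<Longrightarrow> bounded_clinear g \<Longrightarrow> cadjoint (\<lambda>x. f x + g x) = (\<lambda>x. cadjoint f x + cadjoint g x)"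
  by (rule cadjoint_eqI) (simp add: cinner_add_left cinner_add_right cinner_cadjoint)

lemma cadjoint_scale:
  "bounded_clinear f \<Longrightarrow> cadjoint (\<lambda>x. c *\<^sub>C f x) = (\<lambda>x. cnj c *\<^sub>C cadjoint f x)"
  by (rule cadjoint_eqI) (simp add: cinner_scaleC_left cinner_scaleC_right cinner_cadjoint)

text \<open>Real polarization gives the real part, and replacing \<open>y\<close> by
  \<open>\<i> *\<^sub>C y\<close> the imaginary part.\<close>

lemma cisometry_cinner:
  assumes "cisometry f"
  shows "cinner (f x) (f y) = cinner x y"
proof -
  have f: "bounded_clinear f" and n: "\<And>x. norm (f x) = norm x"
    using assms by (auto simp: cisometry_def)
  have re: "inner (f x) (f y) = inner x y" for x y
  proof -
    have "(norm (f x + f y))\<^sup>2 = (norm (x + y))\<^sup>2"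
      by (simp add: n bounded_clinear_add[OF f, symmetric])
    then show ?thesis
      unfolding power2_norm_eq_inner
      using n[of x] n[of y] by (simp add: norm_eq_sqrt_inner inner_add inner_commute)
  qed
  show ?thesis
    using re[of x y] re[of x "\<i> *\<^sub>C y"] by (simp add: cinner_eq_Complex bounded_clinear_scaleC[OF f])
qed

lemma cadjoint_cisometry: "cisometry f \<Longrightarrow> cadjoint f (f x) = x"
  by (rule cinner_extI) (simp add: cinner_cadjoint' cisometry_cinner cisometry_def)

lemma bounded_clinear_eq_on_dense:
  assumes f: "bounded_clinear f" and g: "bounded_clinear g"
    and X: "closure (cspan X) = UNIV" and eq: "\<And>x. x \<in> X \<Longrightarrow> f x = g x"
  shows "f = g"
proof -
  let ?h = "\<lambda>x. f x - g x"
  have h: "bounded_clinear ?h"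
    by (rule bounded_clinear_minus[OF f g])
  have "cspan X \<subseteq> ?h -` {0}"
    by (intro cvs.span_minimal csubspace_vimage h cvs.subspace_single_0) (simp add: eq subset_iff)
  moreover have "closed (?h -` {0})"
    by (intro closed_vimage closed_singleton bounded_clinear_continuous_on h)
  ultimately have "UNIV \<subseteq> ?h -` {0}"
    using closure_minimal X by metis
  then show ?thesis
    by (auto simp: fun_eq_iff)
qed


section \<open>Finite-dimensional subspaces\<close>

definition corthonormal :: "'a::chilbert_space set \<Rightarrow> bool" where
  "corthonormal B \<longleftrightarrow> (\<forall>b\<in>B. norm b = 1) \<and> (\<forall>b\<in>B. \<forall>c\<in>B. b \<noteq> c \<longrightarrow> cinner b c = 0)"

lemma corthonormal_cinner:
  "corthonormal B \<Longrightarrow> b \<in> B \<Longrightarrow> c \<in> B \<Longrightarrow> cinner b c = (if b = c then 1 else 0)"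
  by (auto simp: corthonormal_def cinner_self)

lemma corthonormal_sum_coeff:
  assumes "finite B" "corthonormal B" "c \<in> B"
  shows "cinner (\<Sum>b\<in>B. f b *\<^sub>C b) c = f c"
proof -
  have "cinner (\<Sum>b\<in>B. f b *\<^sub>C b) c = (\<Sum>b\<in>B. if b = c then f b else 0)"
    unfolding cinner_sum_left
    by (rule sum.cong) (use assms in \<open>simp_all add: cinner_scaleC_left corthonormal_cinner\<close>)
  then show ?thesis
    using assms by simp
qed

lemma gram_schmidt:
  fixes B :: "'a::chilbert_space set"
  assumes "finite B"
  shows "\<exists>C. finite C \<and> corthonormal C \<and> cspan C = cspan B"
  using assms
proof (induction B)
  case empty
  show ?case
    by (intro exI[of _ "{}"]) (simp add: corthonormal_def)
next
  case (insert a B)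
  then obtain C where C: "finite C" "corthonormal C" "cspan C = cspan B"
    by blast
  define p where "p = (\<Sum>c\<in>C. cinner a c *\<^sub>C c)"
  have p: "p \<in> cspan C"
    unfolding p_def by (intro cvs.span_sum cvs.span_scale cvs.span_base)
  have orth: "cinner (a - p) c = 0" if "c \<in> C" for c
    using corthonormal_sum_coeff[OF C(1,2) that] by (simp add: cinner_diff(1) p_def)
  show ?case
  proof (cases "a = p")
    case True
    then have "a \<in> cspan B"
      using p C by simp
    then have "cspan (insert a B) = cspan B"
      by (rule cvs.span_redundant)
    then show ?thesis
      using C by auto
  next
    case False
    define u where "u = complex_of_real (inverse (norm (a - p))) *\<^sub>C (a - p)"
    have orth_u: "cinner u c = 0" "cinner c u = 0" if "c \<in> C" for c
      using orth[OF that] cinner_eq_0_commute[of u c] by (simp_all add: u_def cinner_scaleC_left)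
    have "norm u = 1"
      using False unfolding u_def by (simp add: norm_inverse)
    with C(2) orth_u have "corthonormal (insert u C)"
      by (auto simp: corthonormal_def)
    moreover have "cspan (insert u C) = cspan (insert a B)"
    proof
      have "p \<in> cspan (insert a B)"
        using p C(3) cvs.span_mono[of B "insert a B"] by auto
      then have "u \<in> cspan (insert a B)"
        unfolding u_def by (intro cvs.span_scale cvs.span_diff) (auto intro: cvs.span_base)
      moreover have "C \<subseteq> cspan (insert a B)"
        using C(3) cvs.span_superset[of C] cvs.span_mono[of B "insert a B"] by auto
      ultimately show "cspan (insert u C) \<subseteq> cspan (insert a B)"
        by (intro cvs.span_minimal cvs.subspace_span) auto
    next
      have "a = complex_of_real (norm (a - p)) *\<^sub>C u + p"
        using False by (simp add: u_def flip: of_real_mult)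
      moreover have "p \<in> cspan (insert u C)"
        using p cvs.span_mono[of C "insert u C"] by auto
      moreover have "u \<in> cspan (insert u C)"
        by (auto intro: cvs.span_base)
      ultimately have "a \<in> cspan (insert u C)"
        by (metis cvs.span_add cvs.span_scale)
      moreover have "B \<subseteq> cspan (insert u C)"
        using C(3) cvs.span_superset[of B] cvs.span_mono[of C "insert u C"] by auto
      ultimately show "cspan (insert a B) \<subseteq> cspan (insert u C)"
        by (intro cvs.span_minimal cvs.subspace_span) auto
    qed
    ultimately show ?thesis
      using C(1) by blast
  qed
qed

lemma finite_cdim_orthonormal_basis:
  assumes "finite_cdim M"
  obtains C where "finite C" "corthonormal C" "cspan C = M"
  using assms gram_schmidt unfolding finite_cdim_def by metis

lemma finite_cdim_csubspace: "finite_cdim M \<Longrightarrow> csubspace M"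
  unfolding finite_cdim_def using cvs.subspace_span by metis

lemma finite_cdim_image: "bounded_clinear f \<Longrightarrow> finite_cdim M \<Longrightarrow> finite_cdim (f ` M)"
  unfolding finite_cdim_def by (metis cspan_image finite_imageI)

lemma finite_cdim_subset:
  assumes "finite_cdim M" "csubspace W" "W \<subseteq> M"
  shows "finite_cdim W"
proof -
  obtain B where B: "finite B" "cspan B = M"
    using assms(1) unfolding finite_cdim_def by blast
  obtain C where C: "C \<subseteq> W" "cvs.independent C" "W \<subseteq> cspan C"
    using cvs.maximal_independent_subset by blast
  have "finite C"
    using cvs.independent_span_bound[OF B(1) C(2)] C(1) B(2) assms(3) by blast
  moreover have "cspan C = W"
    using C cvs.span_minimal[OF C(1) assms(2)] by blast
  ultimately show ?thesis
    unfolding finite_cdim_def by blast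
qed

lemma csubspace_eqI_cdim:
  assumes W: "csubspace W" "finite_cdim M" and "W \<subseteq> M" "cdim M \<le> cdim W"
  shows "W = M"
proof -
  obtain B where B: "finite B" "cspan B = M"
    using assms unfolding finite_cdim_def by blast
  obtain C where C: "C \<subseteq> W" "cvs.independent C" "W \<subseteq> cspan C"
    using cvs.maximal_independent_subset by blast
  obtain D where D: "C \<subseteq> D" "D \<subseteq> M" "cvs.independent D" "M \<subseteq> cspan D"
    using cvs.maximal_independent_subset_extend[of C M] C assms(3) by blast
  have "card C = cdim W" "card D = cdim M"
    using cvs.basis_card_eq_dim C D by blast+
  moreover have "finite D"
    using cvs.independent_span_bound[OF B(1) D(3)] D B by blast
  ultimately have "C = D"
    using D(1) assms(4) card_seteq by metis
  then show ?thesis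
    using D C cvs.span_minimal[OF C(1) W(1)] assms(3) by blast
qed

text \<open>Membership in the span becomes an equation between continuous functions of
  \<open>x\<close>, which yields closedness of finite-dimensional subspaces.\<close>

lemma corthonormal_expansion:
  assumes C: "finite C" "corthonormal C"
  shows "x \<in> cspan C \<longleftrightarrow> x = (\<Sum>c\<in>C. cinner x c *\<^sub>C c)"
proof
  have "csubspace {x. x = (\<Sum>c\<in>C. cinner x c *\<^sub>C c)}" (is "csubspace ?E")
    by (rule cvs.subspaceI)
       (simp_all add: cinner_add_left cinner_scaleC_left scaleC_add_left sum.distrib
         flip: scaleC_scaleC cvs.scale_sum_right)
  moreover have "C \<subseteq> ?E"
  proof
    fix b
    assume b: "b \<in> C"
    have "(\<Sum>c\<in>C. cinner b c *\<^sub>C c) = (\<Sum>c\<in>C. if c = b then b else 0)"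
      by (rule sum.cong) (use b C in \<open>auto simp: corthonormal_cinner\<close>)
    then show "b \<in> ?E"
      using b C by simp
  qed
  ultimately show "x = (\<Sum>c\<in>C. cinner x c *\<^sub>C c)" if "x \<in> cspan C"
    using cvs.span_minimal that by blast
  show "x \<in> cspan C" if "x = (\<Sum>c\<in>C. cinner x c *\<^sub>C c)"
    by (subst that) (intro cvs.span_sum cvs.span_scale cvs.span_base)
qed

lemma closed_finite_cdim:
  assumes "finite_cdim (M :: 'a::chilbert_space set)"
  shows "closed M"
proof -
  obtain C where C: "finite C" "corthonormal C" "cspan C = M"
    using finite_cdim_orthonormal_basis[OF assms] by metis
  have "continuous_on UNIV (\<lambda>x. cinner x c *\<^sub>C c)" for c :: 'a
    by (rule bounded_linear.continuous_on[OF bounded_linear_scaleC_left]) (intro continuous_intros)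
  then have "closed {x. x = (\<Sum>c\<in>C. cinner x c *\<^sub>C c)}"
    by (intro closed_Collect_eq continuous_intros)
  also have "\<dots> = M"
    using corthonormal_expansion[OF C(1,2)] C(3) by blast
  finally show ?thesis .
qed

text \<open>A Minkowski sum of finitely many continuous images of the closed unit disc. Closed
  bounded sets need not be compact in the ambient space, so compactness is taken from the
  coefficients.\<close>

lemma compact_combinations:
  fixes C :: "'a::chilbert_space set"
  assumes "finite C"
  shows "compact {\<Sum>c\<in>C. f c *\<^sub>C c |f. \<forall>c\<in>C. cmod (f c) \<le> 1}"
  using assms
proof (induction C)
  case (insert a C)
  let ?K = "\<lambda>C. {\<Sum>c\<in>C. f c *\<^sub>C c |f. \<forall>c\<in>C. cmod (f c) \<le> 1}"
  have "compact ((\<lambda>z. z *\<^sub>C a) ` cball 0 1)"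
    by (intro compact_continuous_image linear_continuous_on bounded_linear_scaleC_left compact_cball)
  from compact_sums[OF this insert.IH]
  have "compact {x + y |x y. x \<in> (\<lambda>z. z *\<^sub>C a) ` cball 0 1 \<and> y \<in> ?K C}" .
  also have "{x + y |x y. x \<in> (\<lambda>z. z *\<^sub>C a) ` cball 0 1 \<and> y \<in> ?K C} = ?K (insert a C)"
  proof (intro equalityI subsetI)
    fix v
    assume "v \<in> {x + y |x y. x \<in> (\<lambda>z. z *\<^sub>C a) ` cball 0 1 \<and> y \<in> ?K C}"
    then obtain z f where z: "cmod z \<le> 1" and f: "\<forall>c\<in>C. cmod (f c) \<le> 1"
      and v: "v = z *\<^sub>C a + (\<Sum>c\<in>C. f c *\<^sub>C c)"
      by auto
    have "(\<Sum>c\<in>C. (f(a := z)) c *\<^sub>C c) = (\<Sum>c\<in>C. f c *\<^sub>C c)"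
      by (rule sum.cong) (use insert.hyps in auto)
    then have "v = (\<Sum>c\<in>insert a C. (f(a := z)) c *\<^sub>C c)"
      using v insert.hyps by simp
    moreover have "\<forall>c\<in>insert a C. cmod ((f(a := z)) c) \<le> 1"
      using z f by simp
    ultimately show "v \<in> ?K (insert a C)"
      by blast
  next
    fix v
    assume "v \<in> ?K (insert a C)"
    then obtain f where f: "\<forall>c\<in>insert a C. cmod (f c) \<le> 1" and v: "v = (\<Sum>c\<in>insert a C. f c *\<^sub>C c)"
      by blast
    have "f a *\<^sub>C a \<in> (\<lambda>z. z *\<^sub>C a) ` cball 0 1" "(\<Sum>c\<in>C. f c *\<^sub>C c) \<in> ?K C"
      using f by auto
    moreover have "v = f a *\<^sub>C a + (\<Sum>c\<in>C. f c *\<^sub>C c)"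
      using v insert.hyps by simp
    ultimately show "v \<in> {x + y |x y. x \<in> (\<lambda>z. z *\<^sub>C a) ` cball 0 1 \<and> y \<in> ?K C}"
      by blast
  qed
  finally show ?case .
qed simp

text \<open>By Parseval the coefficients of a unit vector have modulus at most 1, so the sphere is a
  closed part of the compact set of \<open>compact_combinations\<close>.\<close>

lemma compact_unit_sphere:
  assumes "finite_cdim (M :: 'a::chilbert_space set)"
  shows "compact {x\<in>M. norm x = 1}"
proof -
  obtain C where C: "finite C" "corthonormal C" "cspan C = M"
    using finite_cdim_orthonormal_basis[OF assms] by metis
  let ?K = "{\<Sum>c\<in>C. f c *\<^sub>C c |f. \<forall>c\<in>C. cmod (f c) \<le> 1}"
  have "{x\<in>M. norm x = 1} = ?K \<inter> (M \<inter> {x. norm x = 1})"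
  proof (intro equalityI subsetI)
    fix x
    assume "x \<in> {x\<in>M. norm x = 1}"
    then have x: "x \<in> M" "norm x = 1"
      by auto
    have expand: "x = (\<Sum>c\<in>C. cinner x c *\<^sub>C c)"
      using corthonormal_expansion[OF C(1,2)] C(3) x(1) by blast
    have "(norm x)\<^sup>2 = (\<Sum>c\<in>C. (norm (cinner x c *\<^sub>C c))\<^sup>2)"
      by (subst expand, rule norm_sq_sum_orthogonal)
         (use C in \<open>auto simp: cinner_scaleC_left cinner_scaleC_right corthonormal_cinner\<close>)
    also have "\<dots> = (\<Sum>c\<in>C. (cmod (cinner x c))\<^sup>2)"
      using C(2) by (intro sum.cong) (auto simp: corthonormal_def)
    finally have "(cmod (cinner x c))\<^sup>2 \<le> 1" if "c \<in> C" for c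
      using member_le_sum[OF that, of "\<lambda>c. (cmod (cinner x c))\<^sup>2"] C(1) x(2) by simp
    then have "\<forall>c\<in>C. cmod (cinner x c) \<le> 1"
      by (simp add: abs_square_le_1)
    then show "x \<in> ?K \<inter> (M \<inter> {x. norm x = 1})"
      using expand x by auto
  qed auto
  moreover have "closed {x :: 'a. norm x = 1}"
    by (intro closed_Collect_eq continuous_intros)
  then have "compact (?K \<inter> (M \<inter> {x. norm x = 1}))"
    using closed_finite_cdim[OF assms] C(1)
    by (intro compact_Int_closed compact_combinations closed_Int)
  ultimately show ?thesis
    by simp
qed

lemma corthonormal_independent:
  assumes "corthonormal C"
  shows "cvs.independent C"
  unfolding cvs.dependent_def
proof
  assume "\<exists>a\<in>C. a \<in> cspan (C - {a})"
  then obtain a where a: "a \<in> C" "a \<in> cspan (C - {a})"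
    by blast
  have "csubspace {x. cinner x a = 0}"
    by (rule cvs.subspaceI) (simp_all add: cinner_add_left cinner_scaleC_left)
  moreover have "C - {a} \<subseteq> {x. cinner x a = 0}"
    using assms a(1) by (auto simp: corthonormal_cinner)
  ultimately have "cinner a a = 0"
    using cvs.span_minimal a(2) by blast
  then show False
    using corthonormal_cinner[OF assms a(1) a(1)] by simp
qed

lemma unitary_between_exists:
  fixes M :: "'a::chilbert_space set" and N :: "'b::chilbert_space set"
  assumes M: "finite_cdim M" and N: "finite_cdim N" and dim: "cdim M = cdim N"
  obtains U where "unitary_between M N U"
proof -
  obtain C where C: "finite C" "corthonormal C" "cspan C = M"
    using finite_cdim_orthonormal_basis[OF M] by metis
  obtain D where D: "finite D" "corthonormal D" "cspan D = N"
    using finite_cdim_orthonormal_basis[OF N] by metis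
  have "card C = card D"
    using cvs.dim_span_eq_card_independent[OF corthonormal_independent[OF C(2)]]
      cvs.dim_span_eq_card_independent[OF corthonormal_independent[OF D(2)]] C(3) D(3) dim by simp
  then obtain f where f: "bij_betw f C D"
    using finite_same_card_bij C(1) D(1) by blast
  \<comment> \<open>The formula is linear on the whole space and vanishes on the complement of
    \<open>M\<close>, so results on linear maps apply; isometry is claimed on \<open>M\<close>
    only.\<close>
  define U where "U x = (\<Sum>c\<in>C. cinner x c *\<^sub>C f c)" for x
  have add: "U (x + y) = U x + U y" and scale: "U (z *\<^sub>C x) = z *\<^sub>C U x" for x y z
    unfolding U_def
    by (simp_all add: cinner_add_left cinner_scaleC_left scaleC_add_left sum.distrib
         flip: scaleC_scaleC cvs.scale_sum_right)
  have orth: "cinner (f b) (f c) = (if b = c then 1 else 0)" if "b \<in> C" "c \<in> C" for b c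
    using that f corthonormal_cinner[OF D(2), of "f b" "f c"]
    by (auto simp: bij_betw_def inj_on_def)
  have inner: "cinner (U x) (U y) = cinner x y" if x: "x \<in> M" and y: "y \<in> M" for x y
  proof -
    have "cinner (U x) (f b) = cinner x b" if b: "b \<in> C" for b
    proof -
      have "cinner (U x) (f b) = (\<Sum>c\<in>C. if c = b then cinner x c else 0)"
        unfolding U_def cinner_sum_left
        by (rule sum.cong) (use b orth in \<open>auto simp: cinner_scaleC_left\<close>)
      then show ?thesis
        using b C(1) by simp
    qed
    then have "cinner (U x) (U y) = (\<Sum>b\<in>C. cnj (cinner y b) * cinner x b)"
      unfolding U_def[of y] cinner_sum_right by (simp add: cinner_scaleC_right)
    also have "\<dots> = cinner x (\<Sum>b\<in>C. cinner y b *\<^sub>C b)"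
      unfolding cinner_sum_right by (simp add: cinner_scaleC_right)
    also have "(\<Sum>b\<in>C. cinner y b *\<^sub>C b) = y"
      using corthonormal_expansion[OF C(1,2)] C(3) y by metis
    finally show ?thesis .
  qed
  have Uc: "U c = f c" if c: "c \<in> C" for c
  proof -
    have "U c = (\<Sum>b\<in>C. if b = c then f b else 0)"
      unfolding U_def by (rule sum.cong) (use c C in \<open>auto simp: corthonormal_cinner\<close>)
    then show ?thesis
      using c C(1) by simp
  qed
  have "U ` M = N"
  proof -
    have U_lin: "Vector_Spaces.linear scaleC scaleC U"
      by (intro Vector_Spaces.linear_iff[THEN iffD2] conjI allI vector_space_scaleC add scale)
    interpret mh: Vector_Spaces.linear "scaleC :: complex \<Rightarrow> 'a \<Rightarrow> 'a" "scaleC :: complex \<Rightarrow> 'b \<Rightarrow> 'b" U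
      by (rule U_lin)
    have "U ` M = cspan (U ` C)"
      using mh.span_image[of C] C(3) by (simp add: cspan_def)
    also have "U ` C = D"
      using Uc f by (auto simp: bij_betw_def)
    finally show ?thesis
      using D(3) by simp
  qed
  with add scale inner that show ?thesis
    unfolding unitary_between_def by blast
qed

lemma cdim_image_eq:
  assumes f: "bounded_clinear (f :: 'a::chilbert_space \<Rightarrow> 'b::chilbert_space)"
    and M: "csubspace M" and inj: "inj_on f M"
  shows "cdim (f ` M) = cdim M"
proof -
  interpret mh: Vector_Spaces.linear "scaleC :: complex \<Rightarrow> 'a \<Rightarrow> 'a" "scaleC :: complex \<Rightarrow> 'b \<Rightarrow> 'b" f
    by (intro Vector_Spaces.linear_iff[THEN iffD2] conjI allI vector_space_scaleC
        bounded_clinear_add bounded_clinear_scaleC f)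
  obtain B where B: "B \<subseteq> M" "cvs.independent B" "M \<subseteq> cspan B" "card B = cdim M"
    using cvs.basis_exists by blast
  have span: "cspan B = M"
    using B cvs.span_minimal[OF B(1) M] by blast
  have "cvs.independent (f ` B)"
    using mh.independent_inj_on_image[of B] B(2) inj span by (simp add: cspan_def)
  moreover have "card (f ` B) = card B"
    using inj_on_subset[OF inj B(1)] by (rule card_image)
  moreover have "cspan (f ` B) = f ` M"
    using cspan_image[OF f] span by simp
  ultimately show ?thesis
    using cvs.dim_span_eq_card_independent[of "f ` B"] B(4) by simp
qed

text \<open>A nonzero member of least dimension is minimal for inclusion, because a proper subspace
  would have smaller dimension.\<close>

lemma minimal_csubspace_exists:
  assumes "finite_cdim W0" "P W0" "W0 \<noteq> {0}" and P: "\<And>W. P W \<Longrightarrow> csubspace W"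
  obtains W where "P W" "W \<noteq> {0}" "W \<subseteq> W0" "\<And>W'. P W' \<Longrightarrow> W' \<noteq> {0} \<Longrightarrow> W' \<subseteq> W \<Longrightarrow> W' = W"
proof -
  let ?Q = "\<lambda>W. P W \<and> W \<noteq> {0} \<and> W \<subseteq> W0"
  obtain W where W: "?Q W" and min: "\<And>W'. ?Q W' \<Longrightarrow> cdim W \<le> cdim W'"
    using ex_has_least_nat[of ?Q W0 cdim] assms by blast
  have "W' = W" if "P W'" "W' \<noteq> {0}" "W' \<subseteq> W" for W'
  proof (rule csubspace_eqI_cdim)
    show "csubspace W'" "finite_cdim W" "W' \<subseteq> W"
      using that W P finite_cdim_subset[OF assms(1)] by blast+
    show "cdim W \<le> cdim W'"
      using that W min by blast
  qed
  with W that show ?thesis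
    by blast
qed


section \<open>Representations of C*-algebras\<close>

lemma star_alg_bounded_clinear:
  assumes "\<And>X. X \<in> G \<Longrightarrow> bounded_clinear X" "X \<in> star_alg G"
  shows "bounded_clinear X"
  using assms(2)
  by induction
     (blast intro: assms(1) bounded_clinear_id bounded_clinear_plus bounded_clinear_scale
       bounded_clinear_comp bounded_clinear_cadjoint)+

lemma C_star_alg_bounded_clinear: "X \<in> C_star_alg G \<Longrightarrow> bounded_clinear X"
  by (simp add: C_star_alg_def)

lemma star_alg_subset_C_star_alg:
  assumes "\<And>X. X \<in> G \<Longrightarrow> bounded_clinear X" "X \<in> star_alg G"
  shows "X \<in> C_star_alg G"
proof -
  have "\<exists>Y\<in>star_alg G. onorm (\<lambda>v. X v - Y v) < e" if "e > 0" for e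
    using that assms(2) by (intro bexI[of _ X]) (simp_all add: onorm_zero)
  then show ?thesis
    using star_alg_bounded_clinear[OF assms] by (simp add: C_star_alg_def)
qed

text \<open>The C*-algebra seen inside the normed space of bounded real-linear operators, where
  limits, closed sets and the Banach fixed point theorem are at hand.\<close>

definition star_alg_closure :: "('a::chilbert_space \<Rightarrow> 'a) set \<Rightarrow> ('a \<Rightarrow>\<^sub>L 'a) set" where
  "star_alg_closure G = closure {Y. blinfun_apply Y \<in> star_alg G}"

context
  fixes G :: "('a::chilbert_space \<Rightarrow> 'a) set"
  assumes G: "\<And>X. X \<in> G \<Longrightarrow> bounded_clinear X"
begin

lemma blinfun_apply_in_C_star_alg:
  "blinfun_apply Y \<in> C_star_alg G \<longleftrightarrow> Y \<in> star_alg_closure G"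
proof
  assume Y: "blinfun_apply Y \<in> C_star_alg G"
  show "Y \<in> star_alg_closure G"
    unfolding star_alg_closure_def closure_approachable
  proof (intro allI impI)
    fix e :: real
    assume "e > 0"
    then obtain Z where Z: "Z \<in> star_alg G" "onorm (\<lambda>v. Y v - Z v) < e"
      using Y unfolding C_star_alg_def by blast
    have [simp]: "blinfun_apply (Blinfun Z) = Z"
      by (intro bounded_linear_Blinfun_apply bounded_clinear_bl star_alg_bounded_clinear[OF G Z(1)])
    have "dist (Blinfun Z) Y = onorm (\<lambda>v. Y v - Z v)"
      unfolding dist_norm norm_minus_commute[of _ Y]
      by (simp add: norm_blinfun.rep_eq minus_blinfun.rep_eq)
    with Z show "\<exists>Z\<in>{Y. blinfun_apply Y \<in> star_alg G}. dist Z Y < e"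
      by (intro bexI[of _ "Blinfun Z"]) auto
  qed
next
  assume Y: "Y \<in> star_alg_closure G"
  \<comment> \<open>The ambient operators are only real-linear. Complex homogeneity is a closed
    condition, so limits of algebra elements keep it.\<close>
  have "closed {Y :: 'a \<Rightarrow>\<^sub>L 'a. \<forall>c x. Y (c *\<^sub>C x) = c *\<^sub>C Y x}"
    by (intro closed_Collect_all closed_Collect_eq continuous_intros)
  moreover have "{Y. blinfun_apply Y \<in> star_alg G} \<subseteq> {Y :: 'a \<Rightarrow>\<^sub>L 'a. \<forall>c x. Y (c *\<^sub>C x) = c *\<^sub>C Y x}"
    using star_alg_bounded_clinear[OF G] bounded_clinear_scaleC by blast
  ultimately have "\<forall>c x. Y (c *\<^sub>C x) = c *\<^sub>C Y x"
    using Y closure_minimal unfolding star_alg_closure_def by blast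
  then have "bounded_clinear Y"
    by (simp add: bounded_clinear_def blinfun.bounded_linear_right)
  moreover have "\<exists>Z\<in>star_alg G. onorm (\<lambda>v. Y v - Z v) < e" if "e > 0" for e
  proof -
    obtain Z :: "'a \<Rightarrow>\<^sub>L 'a" where Z: "blinfun_apply Z \<in> star_alg G" "dist Z Y < e"
      using Y \<open>e > 0\<close> unfolding star_alg_closure_def closure_approachable by blast
    then show ?thesis
      unfolding dist_norm norm_minus_commute[of _ Y]
      by (intro bexI[of _ "blinfun_apply Z"]) (simp_all add: norm_blinfun.rep_eq minus_blinfun.rep_eq)
  qed
  ultimately show "blinfun_apply Y \<in> C_star_alg G"
    by (simp add: C_star_alg_def)
qed

lemma star_alg_closure_compose:
  assumes "X \<in> star_alg_closure G" "Y \<in> star_alg_closure G"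
  shows "X o\<^sub>L Y \<in> star_alg_closure G"
proof -
  obtain f g where f: "\<And>n. blinfun_apply (f n) \<in> star_alg G" "f \<longlonglongrightarrow> X"
    and g: "\<And>n. blinfun_apply (g n) \<in> star_alg G" "g \<longlonglongrightarrow> Y"
    using assms unfolding star_alg_closure_def closure_sequential by blast
  have "(\<lambda>n. f n o\<^sub>L g n) \<longlonglongrightarrow> (X o\<^sub>L Y)"
    by (rule bounded_bilinear.tendsto[OF bounded_bilinear_blinfun_compose f(2) g(2)])
  moreover have "blinfun_apply (f n o\<^sub>L g n) \<in> star_alg G" for n
    using star_alg.mult[OF f(1)[of n] g(1)[of n]] by (simp add: blinfun_compose.rep_eq)
  ultimately show ?thesis
    unfolding star_alg_closure_def closure_sequential by (intro exI[of _ "\<lambda>n. f n o\<^sub>L g n"]) simp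
qed

lemma star_alg_closure_add:
  assumes "X \<in> star_alg_closure G" "Y \<in> star_alg_closure G"
  shows "X + Y \<in> star_alg_closure G"
proof -
  obtain f g where f: "\<And>n. blinfun_apply (f n) \<in> star_alg G" "f \<longlonglongrightarrow> X"
    and g: "\<And>n. blinfun_apply (g n) \<in> star_alg G" "g \<longlonglongrightarrow> Y"
    using assms unfolding star_alg_closure_def closure_sequential by blast
  have "blinfun_apply (f n + g n) \<in> star_alg G" for n
    using star_alg.add[OF f(1)[of n] g(1)[of n]] by (simp add: plus_blinfun.rep_eq)
  with tendsto_add[OF f(2) g(2)] show ?thesis
    unfolding star_alg_closure_def closure_sequential by (intro exI[of _ "\<lambda>n. f n + g n"]) simp
qed

lemma star_alg_closure_scaleR:
  assumes "X \<in> star_alg_closure G"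
  shows "c *\<^sub>R X \<in> star_alg_closure G"
proof -
  obtain f where f: "\<And>n. blinfun_apply (f n) \<in> star_alg G" "f \<longlonglongrightarrow> X"
    using assms unfolding star_alg_closure_def closure_sequential by blast
  have "blinfun_apply (c *\<^sub>R f n) \<in> star_alg G" for n
    using star_alg.scale[OF f(1)[of n], of "complex_of_real c"]
    by (simp add: scaleR_blinfun.rep_eq scaleR_scaleC)
  with tendsto_scaleR[OF tendsto_const f(2), of c] show ?thesis
    unfolding star_alg_closure_def closure_sequential by (intro exI[of _ "\<lambda>n. c *\<^sub>R f n"]) simp
qed

lemma star_alg_closure_id: "id_blinfun \<in> star_alg_closure G"
  using star_alg.one[of G] closure_subset
  unfolding star_alg_closure_def by (force simp: id_blinfun.rep_eq id_def)

text \<open>Taking adjoints does not increase the operator norm, so adjoints of approximants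
  approximate the adjoint.\<close>

lemma C_star_alg_cadjoint:
  assumes X: "X \<in> C_star_alg G"
  shows "cadjoint X \<in> C_star_alg G"
proof -
  have Xb: "bounded_clinear X"
    using C_star_alg_bounded_clinear[OF X] .
  have "\<exists>Z\<in>star_alg G. onorm (\<lambda>v. cadjoint X v - Z v) < e" if "e > 0" for e
  proof -
    obtain Y where Y: "Y \<in> star_alg G" "onorm (\<lambda>v. X v - Y v) < e"
      using X \<open>e > 0\<close> unfolding C_star_alg_def by blast
    have Yb: "bounded_clinear Y"
      by (rule star_alg_bounded_clinear[OF G Y(1)])
    have XY: "bounded_clinear (\<lambda>v. X v - Y v)"
      by (rule bounded_clinear_minus[OF Xb Yb])
    have "cadjoint (\<lambda>v. X v - Y v) = (\<lambda>v. cadjoint X v - cadjoint Y v)"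
      by (rule cadjoint_eqI) (simp add: cinner_diff cinner_cadjoint[OF Xb] cinner_cadjoint[OF Yb])
    then have "onorm (\<lambda>v. cadjoint X v - cadjoint Y v) \<le> onorm (\<lambda>v. X v - Y v)"
      using norm_cadjoint_le[OF XY] onorm_pos_le[OF bounded_clinear_bl[OF XY]]
      by (intro onorm_bound) auto
    then show ?thesis
      using Y star_alg.adj[OF Y(1)] by (intro bexI[of _ "cadjoint Y"]) auto
  qed
  then show ?thesis
    using bounded_clinear_cadjoint[OF Xb] by (simp add: C_star_alg_def)
qed

lemma Blinfun_in_star_alg_closure: "X \<in> C_star_alg G \<Longrightarrow> Blinfun X \<in> star_alg_closure G"
  using bounded_linear_Blinfun_apply[OF bounded_clinear_bl[OF C_star_alg_bounded_clinear[of X G]]]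
  by (metis blinfun_apply_in_C_star_alg)

text \<open>
  The element \<open>Y\<close> is \<open>1\<close> minus the positive square root of \<open>1 - Z\<close>, found as the fixed point of
  the contraction sending \<open>Y\<close> to \<open>(Z + Y\<^sup>2) / 2\<close>.
\<close>

lemma one_minus_square_root_exists:
  assumes Z: "Z \<in> star_alg_closure G" "norm Z < 1"
    and Z_sa: "\<And>x y. cinner (Z x) y = cinner x (Z y)"
  obtains Y where "Y \<in> star_alg_closure G" "\<And>x y. cinner (Y x) y = cinner x (Y y)"
    "2 *\<^sub>R Y = Z + (Y o\<^sub>L Y)"
proof -
  \<comment> \<open>The smaller root of s^2 - 2 s + \<open>norm Z\<close> = 0. The ball of radius
    \<open>s\<close> is then mapped into itself, and \<open>s\<close> is also the Lipschitz constant
    there.\<close>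
  define s where "s = 1 - sqrt (1 - norm Z)"
  have s: "0 \<le> s" "s < 1" and s_eq: "norm Z + s * s = 2 * s"
    using Z(2) by (auto simp: s_def algebra_simps)
  \<comment> \<open>Membership in the algebra and self-adjointness are closed conditions kept by
    \<open>F\<close>, so the fixed point inherits them. Completeness of \<open>K\<close> holds
    because operators into a Banach space form a Banach space.\<close>
  define K where
    "K = star_alg_closure G \<inter> (cball 0 s \<inter> {Y :: 'a \<Rightarrow>\<^sub>L 'a. \<forall>x y. cinner (Y x) y = cinner x (Y y)})"
  define F where "F Y = (1/2) *\<^sub>R (Z + (Y o\<^sub>L Y))" for Y :: "'a \<Rightarrow>\<^sub>L 'a"
  have "\<exists>!Y. Y \<in> K \<and> F Y = Y"
  proof (rule Banach_fix)
    have "closed {Y :: 'a \<Rightarrow>\<^sub>L 'a. \<forall>x y. cinner (Y x) y = cinner x (Y y)}"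
      by (intro closed_Collect_all closed_Collect_eq continuous_intros)
    then show "complete K"
      unfolding K_def star_alg_closure_def complete_eq_closed
      by (intro closed_Int closed_closure closed_cball)
    have "0 \<in> star_alg_closure G"
      using star_alg_closure_scaleR[OF star_alg_closure_id, of 0] by simp
    then show "K \<noteq> {}"
      using s by (auto simp: K_def)
    show "F ` K \<subseteq> K"
    proof clarify
      fix Y
      assume Y: "Y \<in> K"
      then have sa: "\<And>x y. cinner (Y x) y = cinner x (Y y)" and n: "norm Y \<le> s"
        by (auto simp: K_def)
      have "F Y \<in> star_alg_closure G"
        unfolding F_def using Y
        by (intro star_alg_closure_scaleR star_alg_closure_add star_alg_closure_compose Z)
           (auto simp: K_def)
      moreover have "norm (F Y) \<le> s"
      proof -
        have "norm (Y o\<^sub>L Y) \<le> norm Y * norm Y"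
          by (rule norm_blinfun_compose)
        also have "\<dots> \<le> s * s"
          using n s by (intro mult_mono) auto
        finally have "norm (Z + (Y o\<^sub>L Y)) \<le> norm Z + s * s"
          by (intro norm_triangle_le) simp
        then show ?thesis
          using s_eq by (simp add: F_def)
      qed
      moreover have "cinner (F Y x) y = cinner x (F Y y)" for x y
        by (simp add: F_def blinfun.bilinear_simps scaleR_scaleC cinner_scaleC_left
            cinner_scaleC_right cinner_add_left cinner_add_right sa Z_sa)
      ultimately show "F Y \<in> K"
        by (simp add: K_def)
    qed
    show "dist (F X) (F Y) \<le> s * dist X Y" if "X \<in> K" "Y \<in> K" for X Y
    proof -
      \<comment> \<open>X^2 - Y^2 = X (X - Y) + (X - Y) Y holds without commutativity.\<close>
      have "F X - F Y = (1/2) *\<^sub>R ((X o\<^sub>L (X - Y)) + ((X - Y) o\<^sub>L Y))"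
        by (rule blinfun_eqI) (simp add: F_def blinfun.bilinear_simps algebra_simps)
      then have "norm (F X - F Y) \<le> (norm (X o\<^sub>L (X - Y)) + norm ((X - Y) o\<^sub>L Y)) / 2"
        using norm_triangle_ineq[of "X o\<^sub>L (X - Y)" "(X - Y) o\<^sub>L Y"] by simp
      also have "\<dots> \<le> (norm X * norm (X - Y) + norm (X - Y) * norm Y) / 2"
        by (intro divide_right_mono add_mono norm_blinfun_compose) simp
      also have "\<dots> \<le> (s * norm (X - Y) + norm (X - Y) * s) / 2"
        using that by (intro divide_right_mono add_mono mult_right_mono mult_left_mono)
          (auto simp: K_def)
      finally show ?thesis
        by (simp add: dist_norm mult.commute)
    qed
  qed (use s in auto)
  then obtain Y where Y: "Y \<in> K" "F Y = Y"
    by blast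
  have "2 *\<^sub>R Y = 2 *\<^sub>R F Y"
    using Y(2) by simp
  also have "\<dots> = Z + (Y o\<^sub>L Y)"
    by (simp add: F_def)
  finally show ?thesis
    using that Y(1) by (auto simp: K_def)
qed

text \<open>With V^2 + X* X = 1 and V self-adjoint in the algebra, \<open>\<sigma>\<close> turns the
  identity into a splitting of the squared norm of \<open>x\<close> as a sum of squares, one of
  which is that of \<open>\<sigma> X x\<close>. The strict bound on \<open>onorm X\<close> makes the
  fixed point construction of V possible.\<close>

lemma unital_star_rep_contractive:
  assumes rep: "unital_star_rep (C_star_alg G) \<sigma>" and X: "X \<in> C_star_alg G" and less: "onorm X < 1"
  shows "norm (\<sigma> X x) \<le> norm x"
proof -
  have Xb: "bounded_clinear X"
    using C_star_alg_bounded_clinear[OF X] .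
  define Xl where "Xl = Blinfun X"
  define Xs where "Xs = Blinfun (cadjoint X)"
  have [simp]: "blinfun_apply Xl = X" "blinfun_apply Xs = cadjoint X"
    unfolding Xl_def Xs_def
    by (intro bounded_linear_Blinfun_apply bounded_clinear_bl bounded_clinear_cadjoint Xb)+
  define Z where "Z = Xs o\<^sub>L Xl"
  have Zapp: "Z v = cadjoint X (X v)" for v
    by (simp add: Z_def)
  have nX: "norm Xl < 1"
    using less by (simp add: norm_blinfun.rep_eq)
  have nXs: "norm Xs \<le> norm Xl"
    using norm_cadjoint_le[OF Xb] norm_ge_zero[of Xl]
    by (intro norm_blinfun_bound) (simp_all add: norm_blinfun.rep_eq)
  have ZC: "Z \<in> star_alg_closure G"
    unfolding Z_def Xl_def Xs_def
    by (intro star_alg_closure_compose Blinfun_in_star_alg_closure C_star_alg_cadjoint X)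
  have "norm Z \<le> norm Xs * norm Xl"
    unfolding Z_def by (rule norm_blinfun_compose)
  also have "\<dots> \<le> 1 * norm Xl"
    using nX nXs by (intro mult_right_mono) auto
  finally have nZ: "norm Z < 1"
    using nX by simp
  have "cinner (Z u) v = cinner u (Z v)" for u v
    by (simp add: Zapp cinner_cadjoint'[OF Xb] cinner_cadjoint[OF Xb, symmetric])
  from one_minus_square_root_exists[OF ZC nZ this]
  obtain Y where Y: "Y \<in> star_alg_closure G" and Y_sa: "\<And>u v. cinner (Y u) v = cinner u (Y v)"
    and Y_eq: "2 *\<^sub>R Y = Z + (Y o\<^sub>L Y)"
    by metis
  define V where "V = id_blinfun + (-1) *\<^sub>R Y"
  have Vapp: "V u = u - Y u" for u
    by (simp add: V_def blinfun.bilinear_simps)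
  have "V \<in> star_alg_closure G"
    unfolding V_def by (intro star_alg_closure_add star_alg_closure_scaleR star_alg_closure_id Y)
  then have V: "blinfun_apply V \<in> C_star_alg G"
    by (simp add: blinfun_apply_in_C_star_alg)
  have V_sa: "cadjoint V = V"
    by (rule cadjoint_eqI) (simp add: Vapp cinner_diff Y_sa)
  \<comment> \<open>(1 - Y)^2 = 1 - 2 Y + Y^2, and 2 Y - Y^2 = Z by the fixed point
    equation.\<close>
  have sum_id: "(\<lambda>u. (V \<circ> V) u + (cadjoint X \<circ> X) u) = id"
  proof
    fix u
    have "2 *\<^sub>R Y u = Z u + Y (Y u)"
      using arg_cong[OF Y_eq, of "\<lambda>T. blinfun_apply T u"] by (simp add: blinfun.bilinear_simps)
    then have "Z u = 2 *\<^sub>R Y u - Y (Y u)"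
      by simp
    then show "(V \<circ> V) u + (cadjoint X \<circ> X) u = id u"
      by (simp add: Vapp Zapp[symmetric] blinfun.bilinear_simps scaleR_2)
  qed
  have VV: "V \<circ> V \<in> C_star_alg G" and XX: "cadjoint X \<circ> X \<in> C_star_alg G"
    using star_alg_closure_compose[OF \<open>V \<in> _\<close> \<open>V \<in> _\<close>] ZC
    unfolding blinfun_apply_in_C_star_alg[symmetric] Z_def by (simp_all add: blinfun_compose.rep_eq)
  have Xa: "cadjoint X \<in> C_star_alg G"
    by (rule C_star_alg_cadjoint[OF X])
  have \<sigma>: "bounded_clinear (\<sigma> X)" "bounded_clinear (\<sigma> V)"
    using rep X V unfolding unital_star_rep_def by blast+
  have "\<sigma> (\<lambda>u. (V \<circ> V) u + (cadjoint X \<circ> X) u) = (\<lambda>u. \<sigma> (V \<circ> V) u + \<sigma> (cadjoint X \<circ> X) u)"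
    using rep VV XX unfolding unital_star_rep_def by blast
  moreover have "\<sigma> (V \<circ> V) = \<sigma> V \<circ> \<sigma> V"
    using rep V unfolding unital_star_rep_def by blast
  moreover have "\<sigma> (cadjoint X \<circ> X) = cadjoint (\<sigma> X) \<circ> \<sigma> X"
    using rep X Xa unfolding unital_star_rep_def by metis
  moreover have "\<sigma> id = id"
    using rep unfolding unital_star_rep_def by blast
  ultimately have "x = \<sigma> V (\<sigma> V x) + cadjoint (\<sigma> X) (\<sigma> X x)"
    unfolding sum_id by (simp add: fun_eq_iff)
  moreover have "\<sigma> V = cadjoint (\<sigma> V)"
    using rep V V_sa unfolding unital_star_rep_def by metis
  ultimately have "x = cadjoint (\<sigma> V) (\<sigma> V x) + cadjoint (\<sigma> X) (\<sigma> X x)"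
    by simp
  then have "cinner x x = cinner (\<sigma> V x) (\<sigma> V x) + cinner (\<sigma> X x) (\<sigma> X x)"
    by (metis cinner_add_left cinner_cadjoint'[OF \<sigma>(1)] cinner_cadjoint'[OF \<sigma>(2)])
  then have "complex_of_real ((norm x)\<^sup>2) = complex_of_real ((norm (\<sigma> V x))\<^sup>2 + (norm (\<sigma> X x))\<^sup>2)"
    by (simp add: cinner_self)
  then have "(norm x)\<^sup>2 = (norm (\<sigma> V x))\<^sup>2 + (norm (\<sigma> X x))\<^sup>2"
    unfolding of_real_eq_iff .
  then have "(norm (\<sigma> X x))\<^sup>2 \<le> (norm x)\<^sup>2"
    using zero_le_power2[of "norm (\<sigma> V x)"] by linarith
  then show ?thesis
    by (rule power2_le_imp_le) (rule norm_ge_zero)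
qed

lemma unital_star_rep_bound:
  assumes rep: "unital_star_rep (C_star_alg G) \<sigma>" and X: "X \<in> C_star_alg G" and less: "onorm X < e"
  shows "norm (\<sigma> X x) \<le> e * norm x"
proof -
  have Xb: "bounded_clinear X"
    using C_star_alg_bounded_clinear[OF X] .
  have "e > 0"
    using onorm_pos_le[OF bounded_clinear_bl[OF Xb]] less by simp
  let ?W = "\<lambda>v. complex_of_real (inverse e) *\<^sub>C X v"
  have [simp]: "blinfun_apply (Blinfun X) = X"
    by (intro bounded_linear_Blinfun_apply bounded_clinear_bl Xb)
  have "inverse e *\<^sub>R Blinfun X \<in> star_alg_closure G"
    by (intro star_alg_closure_scaleR Blinfun_in_star_alg_closure X)
  then have W: "?W \<in> C_star_alg G"
    unfolding blinfun_apply_in_C_star_alg[symmetric] by (simp add: scaleR_blinfun.rep_eq scaleR_scaleC)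
  have "onorm ?W = inverse e * onorm X"
    using onorm_scaleR[OF bounded_clinear_bl[OF Xb], of "inverse e"] \<open>e > 0\<close> by (simp add: scaleR_scaleC)
  also have "\<dots> < 1"
    using less \<open>e > 0\<close> by (simp add: field_simps)
  finally have "norm (\<sigma> ?W x) \<le> norm x"
    by (rule unital_star_rep_contractive[OF rep W])
  moreover have "\<sigma> ?W = (\<lambda>v. complex_of_real (inverse e) *\<^sub>C \<sigma> X v)"
    using rep X unfolding unital_star_rep_def by blast
  ultimately have "inverse e * norm (\<sigma> X x) \<le> norm x"
    using \<open>e > 0\<close> by (simp add: norm_inverse)
  then show ?thesis
    using \<open>e > 0\<close> by (simp add: field_simps)
qed

end

section \<open>From intertwining the generators to intertwining the whole algebra\<close>

lemma unital_star_rep_add: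
  "unital_star_rep \<A> \<sigma> \<Longrightarrow> X \<in> \<A> \<Longrightarrow> Y \<in> \<A> \<Longrightarrow> \<sigma> (\<lambda>v. X v + Y v) = (\<lambda>v. \<sigma> X v + \<sigma> Y v)"
  by (simp add: unital_star_rep_def)

lemma unitary_between_UNIV_cisometry: "unitary_between UNIV UNIV U \<Longrightarrow> cisometry U"
  unfolding cisometry_def unitary_between_def
proof (intro conjI allI)
  assume U: "(\<forall>x\<in>UNIV. \<forall>y\<in>UNIV. U (x + y) = U x + U y) \<and>
     (\<forall>c. \<forall>x\<in>UNIV. U (c *\<^sub>C x) = c *\<^sub>C U x) \<and>
     (\<forall>x\<in>UNIV. \<forall>y\<in>UNIV. cinner (U x) (U y) = cinner x y) \<and> U ` UNIV = UNIV"
  then have "inner (U x) (U x) = inner x x" for x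
    by (simp add: inner_eq_Re_cinner)
  then show n: "norm (U x) = norm x" for x
    by (simp add: norm_eq_sqrt_inner)
  show "bounded_clinear U"
    by (rule bounded_clinearI[where K = 1]) (use U n in simp_all)
qed

text \<open>Surjectivity of \<open>U\<close> allows testing against vectors \<open>U y\<close> only;
  on these the claim is the adjoint form of \<open>eq\<close>.\<close>

lemma intertwiner_cadjoint:
  assumes U: "unitary_between UNIV UNIV U" and P: "bounded_clinear P" and Q: "bounded_clinear Q"
    and eq: "\<And>x. U (P x) = Q (U x)"
  shows "U (cadjoint P x) = cadjoint Q (U x)"
proof (rule cinner_extI)
  fix z
  have inner: "cinner (U x) (U y) = cinner x y" for x y
    using U unfolding unitary_between_def by blast
  obtain y where z: "z = U y"
    using U unfolding unitary_between_def by blast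
  show "cinner (U (cadjoint P x)) z = cinner (cadjoint Q (U x)) z"
    unfolding z inner cinner_cadjoint'[OF P] cinner_cadjoint'[OF Q] eq[symmetric] inner ..
qed

text \<open>Induction settles the algebra generated by \<open>G\<close>, with
  \<open>intertwiner_cadjoint\<close> for the adjoint case. The passage to the norm closure rests on
  \<open>unital_star_rep_bound\<close>, applied to both representations.\<close>

lemma unital_star_reps_intertwine:
  assumes G: "\<And>X. X \<in> G \<Longrightarrow> bounded_clinear X"
    and \<sigma>: "unital_star_rep (C_star_alg G) \<sigma>" and \<tau>: "unital_star_rep (C_star_alg G) \<tau>"
    and U: "unitary_between UNIV UNIV U"
    and eq: "\<And>X x. X \<in> G \<Longrightarrow> U (\<sigma> X x) = \<tau> X (U x)"
    and X: "X \<in> C_star_alg G"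
  shows "U (\<sigma> X x) = \<tau> X (U x)"
proof -
  have sub: "Y \<in> C_star_alg G" if "Y \<in> star_alg G" for Y
    by (rule star_alg_subset_C_star_alg[OF G that])
  have iso: "cisometry U"
    by (rule unitary_between_UNIV_cisometry[OF U])
  then have Ub: "bounded_clinear U" and nU: "\<And>x. norm (U x) = norm x"
    by (simp_all add: cisometry_def)
  have alg: "\<forall>x. U (\<sigma> Y x) = \<tau> Y (U x)" if "Y \<in> star_alg G" for Y
    using that
  proof induction
    case one
    have "\<sigma> id = id" "\<tau> id = id"
      using \<sigma> \<tau> unfolding unital_star_rep_def by blast+
    then show ?case
      unfolding id_def by simp
  next
    case (gen X)
    then show ?case
      using eq by blast
  next
    case (add X Y)
    have "\<sigma> (\<lambda>v. X v + Y v) = (\<lambda>v. \<sigma> X v + \<sigma> Y v)" "\<tau> (\<lambda>v. X v + Y v) = (\<lambda>v. \<tau> X v + \<tau> Y v)"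
      using \<sigma> \<tau> sub[OF add.hyps(1)] sub[OF add.hyps(2)] unfolding unital_star_rep_def by blast+
    then show ?case
      using add.IH by (simp add: bounded_clinear_add[OF Ub])
  next
    case (scale X c)
    have "\<sigma> (\<lambda>v. c *\<^sub>C X v) = (\<lambda>v. c *\<^sub>C \<sigma> X v)" "\<tau> (\<lambda>v. c *\<^sub>C X v) = (\<lambda>v. c *\<^sub>C \<tau> X v)"
      using \<sigma> \<tau> sub[OF scale.hyps] unfolding unital_star_rep_def by blast+
    then show ?case
      using scale.IH by (simp add: bounded_clinear_scaleC[OF Ub])
  next
    case (mult X Y)
    have "\<sigma> (X \<circ> Y) = \<sigma> X \<circ> \<sigma> Y" "\<tau> (X \<circ> Y) = \<tau> X \<circ> \<tau> Y"
      using \<sigma> \<tau> sub[OF mult.hyps(1)] sub[OF mult.hyps(2)] unfolding unital_star_rep_def by blast+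
    then show ?case
      using mult.IH by (simp add: comp_def)
  next
    case (adj X)
    have *: "\<sigma> (cadjoint X) = cadjoint (\<sigma> X)" "\<tau> (cadjoint X) = cadjoint (\<tau> X)"
      "bounded_clinear (\<sigma> X)" "bounded_clinear (\<tau> X)"
      using \<sigma> \<tau> sub[OF adj.hyps] unfolding unital_star_rep_def by blast+
    then show ?case
      using intertwiner_cadjoint[OF U *(3,4)] adj.IH by simp
  qed
  have "norm (U (\<sigma> X x) - \<tau> X (U x)) \<le> 0"
  proof (rule field_le_epsilon)
    fix e :: real
    assume "e > 0"
    \<comment> \<open>Each of the two representations contributes \<open>d * norm x\<close>, hence
      the factor 2; the added 1 covers \<open>x = 0\<close>.\<close>
    define d where "d = e / (2 * norm x + 1)"
    have nonzero: "2 * norm x + 1 \<noteq> 0"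
      using norm_ge_zero[of x] by linarith
    have "d > 0"
      using \<open>e > 0\<close> by (simp add: d_def add_nonneg_pos)
    obtain Y where Y: "Y \<in> star_alg G" "onorm (\<lambda>v. X v - Y v) < d"
      using X \<open>d > 0\<close> unfolding C_star_alg_def by blast
    have YC: "Y \<in> C_star_alg G"
      by (rule sub[OF Y(1)])
    \<comment> \<open>The difference is written as a sum with a scalar multiple, the two operations
      that the definition of a representation mentions.\<close>
    let ?D = "\<lambda>v. X v + (-1) *\<^sub>C Y v"
    have Yn: "(\<lambda>v. (-1) *\<^sub>C Y v) \<in> C_star_alg G"
      by (intro sub star_alg.scale Y)
    have bl: "blinfun_apply (Blinfun f) = f" if "f \<in> C_star_alg G" for f
      using bounded_linear_Blinfun_apply bounded_clinear_bl C_star_alg_bounded_clinear that by blast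
    have "Blinfun X + Blinfun (\<lambda>v. (-1) *\<^sub>C Y v) \<in> star_alg_closure G"
      by (intro star_alg_closure_add Blinfun_in_star_alg_closure G X Yn)
    then have D: "?D \<in> C_star_alg G"
      using blinfun_apply_in_C_star_alg[OF G, of G "Blinfun X + Blinfun (\<lambda>v. (-1) *\<^sub>C Y v)"]
      unfolding plus_blinfun.rep_eq bl[OF X] bl[OF Yn] by blast
    have nD: "onorm ?D < d"
      using Y(2) by simp
    have "\<sigma> ?D = (\<lambda>v. \<sigma> X v + \<sigma> (\<lambda>v. (-1) *\<^sub>C Y v) v)"
      by (rule unital_star_rep_add[OF \<sigma> X Yn])
    moreover have "\<tau> ?D = (\<lambda>v. \<tau> X v + \<tau> (\<lambda>v. (-1) *\<^sub>C Y v) v)"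
      by (rule unital_star_rep_add[OF \<tau> X Yn])
    moreover have "\<sigma> (\<lambda>v. (-1) *\<^sub>C Y v) = (\<lambda>v. (-1) *\<^sub>C \<sigma> Y v)" "\<tau> (\<lambda>v. (-1) *\<^sub>C Y v) = (\<lambda>v. (-1) *\<^sub>C \<tau> Y v)"
      using \<sigma> \<tau> YC unfolding unital_star_rep_def by blast+
    ultimately have "U (\<sigma> X x) - \<tau> X (U x) = U (\<sigma> ?D x) - \<tau> ?D (U x)"
      using alg[OF Y(1)] by (simp add: bounded_clinear_diff[OF Ub])
    also have "norm \<dots> \<le> norm (U (\<sigma> ?D x)) + norm (\<tau> ?D (U x))"
      by (rule norm_triangle_ineq4)
    also have "\<dots> \<le> d * norm x + d * norm (U x)"
      unfolding nU[of "\<sigma> ?D x"]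
      by (intro add_mono unital_star_rep_bound[OF G \<sigma> D nD] unital_star_rep_bound[OF G \<tau> D nD])
    also have "\<dots> = d * (2 * norm x)"
      by (simp add: nU)
    also have "\<dots> \<le> d * (2 * norm x + 1)"
      using \<open>d > 0\<close> by (intro mult_left_mono) auto
    also have "\<dots> = e"
      using nonzero by (simp add: d_def)
    finally show "norm (U (\<sigma> X x) - \<tau> X (U x)) \<le> 0 + e"
      by simp
  qed
  then show ?thesis
    by simp
qed


section \<open>Unitaries from equal Gram matrices\<close>

text \<open>A relation rather than a function: linear dependences among first components could a
  priori give conflicting values. Single-valuedness comes later, from the Gram matrices.\<close>

inductive_set graph_span :: "('a::chilbert_space \<times> 'b::chilbert_space) set \<Rightarrow> ('a \<times> 'b) set"
  for R :: "('a \<times> 'b) set" where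
  zero: "(0, 0) \<in> graph_span R"
| base: "(a, b) \<in> R \<Longrightarrow> (a, b) \<in> graph_span R"
| add: "(a, b) \<in> graph_span R \<Longrightarrow> (a', b') \<in> graph_span R \<Longrightarrow> (a + a', b + b') \<in> graph_span R"
| scale: "(a, b) \<in> graph_span R \<Longrightarrow> (c *\<^sub>C a, c *\<^sub>C b) \<in> graph_span R"

lemma graph_span_converse: "(a, b) \<in> graph_span R \<Longrightarrow> (b, a) \<in> graph_span (R\<inverse>)"
  by (induction rule: graph_span.induct) (auto intro: graph_span.intros)

lemma graph_span_domain: "a \<in> cspan (fst ` R) \<Longrightarrow> \<exists>b. (a, b) \<in> graph_span R"
proof -
  have "csubspace {a. \<exists>b. (a, b) \<in> graph_span R}"
    by (rule cvs.subspaceI) (blast intro: graph_span.intros)+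
  moreover have "fst ` R \<subseteq> {a. \<exists>b. (a, b) \<in> graph_span R}"
    using graph_span.base by fastforce
  ultimately show "a \<in> cspan (fst ` R) \<Longrightarrow> \<exists>b. (a, b) \<in> graph_span R"
    using cvs.span_minimal by blast
qed

definition equal_grams :: "('a::chilbert_space \<times> 'b::chilbert_space) set \<Rightarrow> bool" where
  "equal_grams R \<longleftrightarrow> (\<forall>(a, b)\<in>R. \<forall>(a', b')\<in>R. cinner a a' = cinner b b')"

lemma equal_gramsD: "equal_grams R \<Longrightarrow> (a, b) \<in> R \<Longrightarrow> (a', b') \<in> R \<Longrightarrow> cinner a a' = cinner b b'"
  unfolding equal_grams_def by blast

lemma equal_grams_graph_span:
  assumes R: "equal_grams R"
  shows "equal_grams (graph_span R)"
proof -
  have 1: "cinner a a' = cinner b b'" if "(a, b) \<in> graph_span R" "(a', b') \<in> R" for a b a' b'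
    using that(1)
    by induction (simp_all add: cinner_add_left cinner_scaleC_left equal_gramsD[OF R _ that(2)])
  have "cinner a a' = cinner b b'" if "(a', b') \<in> graph_span R" "(a, b) \<in> graph_span R" for a b a' b'
    using that(1)
    by induction (simp_all add: cinner_add_right cinner_scaleC_right 1[OF that(2)])
  then show ?thesis
    unfolding equal_grams_def by blast
qed

definition graph_closure :: "('a::chilbert_space \<times> 'b::chilbert_space) set \<Rightarrow> ('a \<times> 'b) set" where
  "graph_closure R = {(x, y). \<exists>f g. (\<forall>n. (f n, g n) \<in> graph_span R) \<and> f \<longlonglongrightarrow> x \<and> g \<longlonglongrightarrow> y}"

lemma graph_closure_converse: "(x, y) \<in> graph_closure R \<Longrightarrow> (y, x) \<in> graph_closure (R\<inverse>)"
  unfolding graph_closure_def using graph_span_converse by blast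

lemma graph_closure_base: "(x, y) \<in> R \<Longrightarrow> (x, y) \<in> graph_closure R"
  unfolding graph_closure_def
  by (auto intro!: exI[of _ "\<lambda>n. x"] exI[of _ "\<lambda>n. y"] graph_span.base)

lemma graph_closure_add:
  assumes "(x, y) \<in> graph_closure R" "(x', y') \<in> graph_closure R"
  shows "(x + x', y + y') \<in> graph_closure R"
proof -
  obtain f g f' g' where "\<And>n. (f n, g n) \<in> graph_span R" "f \<longlonglongrightarrow> x" "g \<longlonglongrightarrow> y"
    "\<And>n. (f' n, g' n) \<in> graph_span R" "f' \<longlonglongrightarrow> x'" "g' \<longlonglongrightarrow> y'"
    using assms unfolding graph_closure_def by blast
  then have "(\<forall>n. (f n + f' n, g n + g' n) \<in> graph_span R) \<and>
      (\<lambda>n. f n + f' n) \<longlonglongrightarrow> x + x' \<and> (\<lambda>n. g n + g' n) \<longlonglongrightarrow> y + y'"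
    by (blast intro: graph_span.add tendsto_add)
  then show ?thesis
    unfolding graph_closure_def mem_Collect_eq prod.case by (intro exI)
qed

lemma graph_closure_scale:
  assumes "(x, y) \<in> graph_closure R"
  shows "(c *\<^sub>C x, c *\<^sub>C y) \<in> graph_closure R"
proof -
  obtain f g where "\<And>n. (f n, g n) \<in> graph_span R" "f \<longlonglongrightarrow> x" "g \<longlonglongrightarrow> y"
    using assms unfolding graph_closure_def by blast
  then have "(\<forall>n. (c *\<^sub>C f n, c *\<^sub>C g n) \<in> graph_span R) \<and>
      (\<lambda>n. c *\<^sub>C f n) \<longlonglongrightarrow> c *\<^sub>C x \<and> (\<lambda>n. c *\<^sub>C g n) \<longlonglongrightarrow> c *\<^sub>C y"
    by (blast intro: graph_span.scale tendsto_scaleC)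
  then show ?thesis
    unfolding graph_closure_def mem_Collect_eq prod.case by (intro exI)
qed

lemma equal_grams_graph_closure:
  assumes R: "equal_grams R"
  shows "equal_grams (graph_closure R)"
proof -
  have "cinner x x' = cinner y y'"
    if xy: "(x, y) \<in> graph_closure R" "(x', y') \<in> graph_closure R" for x y x' y'
  proof -
    obtain f g f' g' where *: "\<And>n. (f n, g n) \<in> graph_span R" "f \<longlonglongrightarrow> x" "g \<longlonglongrightarrow> y"
      "\<And>n. (f' n, g' n) \<in> graph_span R" "f' \<longlonglongrightarrow> x'" "g' \<longlonglongrightarrow> y'"
      using xy unfolding graph_closure_def by blast
    have "(\<lambda>n. cinner (f n) (f' n)) = (\<lambda>n. cinner (g n) (g' n))"
      using equal_gramsD[OF equal_grams_graph_span[OF R]] *(1,4) by blast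
    with tendsto_cinner[OF *(2,5)] tendsto_cinner[OF *(3,6)] show ?thesis
      using LIMSEQ_unique by metis
  qed
  then show ?thesis
    unfolding equal_grams_def by blast
qed

text \<open>With equal first components this is single-valuedness; along a sequence it transports
  the Cauchy property, so the relation extends to limits.\<close>

lemma equal_grams_dist:
  assumes "equal_grams R" "(x, y) \<in> R" "(x', y') \<in> R"
  shows "norm (x - x') = norm (y - y')"
proof -
  have "cinner (x - x') (x - x') = cinner (y - y') (y - y')"
    using assms equal_gramsD[OF assms(1)] by (simp add: cinner_diff)
  then show ?thesis
    unfolding cinner_self of_real_eq_iff by (simp add: power2_eq_iff_nonneg)
qed

lemma graph_closure_total:
  assumes R: "equal_grams R" and dense: "closure (cspan (fst ` R)) = UNIV"
  shows "\<exists>y. (x, y) \<in> graph_closure R"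
proof -
  have "x \<in> closure (cspan (fst ` R))"
    using dense by simp
  then obtain f where f: "\<And>n. f n \<in> cspan (fst ` R)" "f \<longlonglongrightarrow> x"
    unfolding closure_sequential by blast
  have "\<forall>n. \<exists>b. (f n, b) \<in> graph_span R"
    using graph_span_domain f(1) by blast
  then obtain g where g: "\<And>n. (f n, g n) \<in> graph_span R"
    by metis
  have "dist (g m) (g n) = dist (f m) (f n)" for m n
    using equal_grams_dist[OF equal_grams_graph_span[OF R] g g] by (simp add: dist_norm)
  then have "Cauchy g"
    using LIMSEQ_imp_Cauchy[OF f(2)] unfolding Cauchy_def by simp
  then obtain y where "g \<longlonglongrightarrow> y"
    using Cauchy_convergent convergent_def by blast
  then show ?thesis
    using f g unfolding graph_closure_def by blast
qed

text \<open>\<open>U\<close> is picked pointwise from the closed relation. That relation is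
  single-valued and stable under sums and multiples, so linearity is automatic.\<close>

lemma unitary_of_equal_grams:
  assumes R: "equal_grams R"
    and dense: "closure (cspan (fst ` R)) = UNIV" "closure (cspan (snd ` R)) = UNIV"
  obtains U where "unitary_between UNIV UNIV U" "\<And>a b. (a, b) \<in> R \<Longrightarrow> U a = b"
proof -
  note gram = equal_grams_graph_closure[OF R]
  have uniq: "y = y'" if "(x, y) \<in> graph_closure R" "(x, y') \<in> graph_closure R" for x y y'
    using equal_grams_dist[OF gram that] by simp
  obtain U where U: "\<And>x. (x, U x) \<in> graph_closure R"
    using graph_closure_total[OF R dense(1)] by metis
  have "R\<inverse> = prod.swap ` R"
    by force
  \<comment> \<open>The hypotheses are symmetric in the two spaces; totality of the converse
    relation is surjectivity of \<open>U\<close>.\<close>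
  have "equal_grams (R\<inverse>)"
    using R unfolding equal_grams_def by fastforce
  moreover have "closure (cspan (fst ` (R\<inverse>))) = UNIV"
    using dense(2) by (simp add: \<open>R\<inverse> = _\<close> image_comp)
  ultimately have "\<exists>x. (y, x) \<in> graph_closure (R\<inverse>)" for y
    by (rule graph_closure_total)
  then have "\<exists>x. (x, y) \<in> graph_closure R" for y
    using graph_closure_converse[of _ _ "R\<inverse>"] by fastforce
  then have surj: "U ` UNIV = UNIV"
    using U uniq by blast
  have "unitary_between UNIV UNIV U"
    unfolding unitary_between_def
    using uniq U graph_closure_add graph_closure_scale equal_gramsD[OF gram U U] surj by metis
  moreover have "U a = b" if "(a, b) \<in> R" for a b
    using uniq U graph_closure_base that by blast
  ultimately show ?thesis
    using that by blast
qed


section \<open>Coinvariant subspaces\<close>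

definition coinvariant :: "('n \<Rightarrow> 'a::chilbert_space \<Rightarrow> 'a) \<Rightarrow> 'a set \<Rightarrow> bool" where
  "coinvariant T W \<longleftrightarrow> csubspace W \<and> (\<forall>i. \<forall>x\<in>W. cadjoint (T i) x \<in> W)"

text \<open>Formulated for an arbitrary tuple so that it applies both to \<open>A\<close> and to its
  dilation. Finite dimension is a separate clause since the dilation space need not be
  finite-dimensional, and the compactness argument needs it.\<close>

definition cuntz_minimal :: "('n::finite \<Rightarrow> 'a::chilbert_space \<Rightarrow> 'a) \<Rightarrow> 'a set \<Rightarrow> bool" where
  "cuntz_minimal T W \<longleftrightarrow> coinvariant T W \<and> W \<noteq> {0} \<and> finite_cdim W \<and>
     (\<forall>W'. coinvariant T W' \<and> W' \<noteq> {0} \<and> W' \<subseteq> W \<longrightarrow> W' = W) \<and> (\<forall>x\<in>W. defect T x = 0)"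

definition cuntz_core :: "('n::finite \<Rightarrow> 'a::chilbert_space \<Rightarrow> 'a) \<Rightarrow> 'a set" where
  "cuntz_core T = cspan (\<Union>{W. cuntz_minimal T W})"

definition wandering_space :: "('n \<Rightarrow> 'a::chilbert_space \<Rightarrow> 'a) \<Rightarrow> 'a set" where
  "wandering_space T = {x. \<forall>i. cadjoint (T i) x = 0}"

lemma coinvariant_inter: "coinvariant T V \<Longrightarrow> coinvariant T W \<Longrightarrow> coinvariant T (V \<inter> W)"
  unfolding coinvariant_def by (intro conjI cvs.subspace_inter allI ballI IntI) simp_all

lemma cuntz_minimalI:
  assumes "coinvariant T W" "W \<noteq> {0}" "finite_cdim W"
    "\<And>W'. coinvariant T W' \<Longrightarrow> W' \<noteq> {0} \<Longrightarrow> W' \<subseteq> W \<Longrightarrow> W' = W"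
    "\<And>x. x \<in> W \<Longrightarrow> defect T x = 0"
  shows "cuntz_minimal T W"
  using assms unfolding cuntz_minimal_def by simp

lemma cuntz_minimalD:
  assumes "cuntz_minimal T W"
  shows "coinvariant T W" "W \<noteq> {0}" "finite_cdim W"
    "coinvariant T W' \<Longrightarrow> W' \<noteq> {0} \<Longrightarrow> W' \<subseteq> W \<Longrightarrow> W' = W"
    "x \<in> W \<Longrightarrow> defect T x = 0"
  using assms unfolding cuntz_minimal_def by simp_all

lemma invariant_subspace_adjoint_alg:
  assumes A: "\<And>i. bounded_clinear (A i)"
  shows "invariant_subspace (adjoint_alg A) W \<longleftrightarrow> coinvariant A W"
proof
  assume "invariant_subspace (adjoint_alg A) W"
  then show "coinvariant A W"
    using unital_alg.gen[of A] unfolding invariant_subspace_def coinvariant_def adjoint_alg_def by blast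
next
  assume W: "coinvariant A W"
  then have sub: "csubspace W"
    by (simp add: coinvariant_def)
  \<comment> \<open>Boundedness is carried through the induction because the rules for adjoints of
    sums and products require it.\<close>
  have "bounded_clinear X \<and> (\<forall>x\<in>W. cadjoint X x \<in> W)" if "X \<in> unital_alg A" for X
    using that
  proof induction
    case one
    show ?case
      by (simp add: bounded_clinear_id cadjoint_id[unfolded id_def])
  next
    case (gen i)
    then show ?case
      using W A by (simp add: coinvariant_def)
  next
    case (add X Y)
    then show ?case
      by (simp add: bounded_clinear_plus cadjoint_plus cvs.subspace_add[OF sub])
  next
    case (scale X c)
    then show ?case
      by (simp add: bounded_clinear_scale cadjoint_scale cvs.subspace_scale[OF sub])
  next
    case (mult X Y)
    then show ?case
      using bounded_clinear_comp[of X Y] cadjoint_comp[of X Y] by (simp add: comp_def)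
  qed
  then show "invariant_subspace (adjoint_alg A) W"
    using sub unfolding invariant_subspace_def adjoint_alg_def by blast
qed

text \<open>Invariance under the adjoint algebra is invariance under the adjoints of the generators,
  and the finiteness clause of \<open>cuntz_minimal\<close> is automatic here.\<close>

lemma tilde_space_eq_cuntz_core:
  fixes A :: "'n::finite \<Rightarrow> 'v::chilbert_space \<Rightarrow> 'v"
  assumes A: "\<And>i. bounded_clinear (A i)" and fin: "finite_cdim (UNIV :: 'v set)"
  shows "tilde_space A = cuntz_core A"
proof -
  have "(minimal_invariant_subspace (adjoint_alg A) W \<and> (\<forall>w\<in>W. (\<Sum>i\<in>UNIV. A i (cadjoint (A i) w)) = w))
      \<longleftrightarrow> cuntz_minimal A W" for W
  proof -
    have "coinvariant A W \<Longrightarrow> finite_cdim W"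
      using finite_cdim_subset[OF fin] by (simp add: coinvariant_def)
    then show ?thesis
      unfolding minimal_invariant_subspace_def invariant_subspace_adjoint_alg[OF A] cuntz_minimal_def
        defect_def right_minus_eq eq_commute[of "\<Sum>i\<in>UNIV. A i (cadjoint (A i) _)"] by blast
  qed
  then show ?thesis
    unfolding tilde_space_def cuntz_core_def by simp
qed

lemma bounded_clinear_defect:
  assumes "\<And>i. bounded_clinear (A i)"
  shows "bounded_clinear (defect A)"
proof -
  have "bounded_clinear (\<lambda>x. A i (cadjoint (A i) x))" for i
    using bounded_clinear_comp[OF assms bounded_clinear_cadjoint[OF assms], of i i] by (simp add: comp_def)
  then show ?thesis
    unfolding defect_def by (intro bounded_clinear_minus bounded_clinear_id bounded_clinear_sum_ops)
qed

lemma cinner_defect: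
  assumes A: "\<And>i. bounded_clinear (A i)"
  shows "cinner (defect A x) y = cinner x y - (\<Sum>i\<in>UNIV. cinner (cadjoint (A i) x) (cadjoint (A i) y))"
  by (simp add: defect_def cinner_diff cinner_sum_left cinner_cadjoint[OF A])

lemma cuntz_core_props:
  fixes T :: "'n::finite \<Rightarrow> 'a::chilbert_space \<Rightarrow> 'a"
  assumes T: "\<And>i. bounded_clinear (T i)"
  shows coinvariant_cuntz_core: "coinvariant T (cuntz_core T)"
    and defect_cuntz_core: "x \<in> cuntz_core T \<Longrightarrow> defect T x = 0"
proof -
  have span: "cadjoint (T i) x \<in> cspan (\<Union>{W. cuntz_minimal T W})"
    if "cuntz_minimal T W" "x \<in> W" for i W x
    using that by (intro cvs.span_base) (auto simp: cuntz_minimal_def coinvariant_def)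
  have "cuntz_core T \<subseteq> cadjoint (T i) -` cuntz_core T" for i
    unfolding cuntz_core_def
    by (intro cvs.span_minimal csubspace_vimage bounded_clinear_cadjoint T cvs.subspace_span)
       (use span in blast)
  then show "coinvariant T (cuntz_core T)"
    unfolding coinvariant_def cuntz_core_def using cvs.subspace_span by blast
  have "cuntz_core T \<subseteq> defect T -` {0}"
    unfolding cuntz_core_def
    by (intro cvs.span_minimal csubspace_vimage bounded_clinear_defect T cvs.subspace_single_0)
       (auto simp: cuntz_minimal_def)
  then show "x \<in> cuntz_core T \<Longrightarrow> defect T x = 0"
    by blast
qed

text \<open>All adjoints kill \<open>n\<close>, so pairing \<open>defect T x\<close> with
  \<open>n\<close> leaves just the inner product of \<open>x\<close> and \<open>n\<close>; and the
  defect of \<open>x\<close> is 0.\<close>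

lemma wandering_orthogonal_core:
  assumes T: "\<And>i. bounded_clinear (T i)" and "n \<in> wandering_space T" "x \<in> cuntz_core T"
  shows "cinner n x = 0" "cinner x n = 0"
proof -
  show "cinner x n = 0"
    using cinner_defect[of T x n, OF T] defect_cuntz_core[OF T assms(3)] assms(2)
    by (simp add: wandering_space_def)
  then show "cinner n x = 0"
    by (simp only: cinner_eq_0_commute)
qed

lemma word_op_Nil [simp]: "word_op T [] x = x"
  by (simp add: word_op_def)

lemma word_op_Cons [simp]: "word_op T (i # w) x = T i (word_op T w x)"
  by (simp add: word_op_def)


section \<open>Isometries with orthogonal ranges\<close>

text \<open>The sum of \<open>q (S\<^sub>w\<^sup>* x)\<close> over all words w of length k,
  organized by the first letter.\<close>

primrec row_iterate :: "('n::finite \<Rightarrow> 'a::chilbert_space \<Rightarrow> 'a) \<Rightarrow> ('a \<Rightarrow> real) \<Rightarrow> nat \<Rightarrow> 'a \<Rightarrow> real" where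
  "row_iterate S q 0 x = q x"
| "row_iterate S q (Suc k) x = (\<Sum>i\<in>UNIV. row_iterate S q k (cadjoint (S i) x))"

text \<open>Level k consists of the vectors that every \<open>S\<^sub>w\<^sup>*\<close> with w of
  length k sends into \<open>V\<close>.\<close>

primrec coinvariant_tower :: "('n \<Rightarrow> 'a::chilbert_space \<Rightarrow> 'a) \<Rightarrow> 'a set \<Rightarrow> nat \<Rightarrow> 'a set" where
  "coinvariant_tower S V 0 = V"
| "coinvariant_tower S V (Suc k) = {x. \<forall>i. cadjoint (S i) x \<in> coinvariant_tower S V k}"

locale isometry_tuple =
  fixes S :: "'n::finite \<Rightarrow> 'h::chilbert_space \<Rightarrow> 'h"
  assumes isometries: "isometries_orthogonal_ranges S"
begin

lemma isometry: "cisometry (S i)" and S_bounded: "bounded_clinear (S i)"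
  using isometries by (auto simp: isometries_orthogonal_ranges_def cisometry_def)

lemma cadjoint_bounded: "bounded_clinear (cadjoint (S i))"
  by (rule bounded_clinear_cadjoint[OF S_bounded])

lemma cinner_S: "cinner (S i x) (S j y) = (if i = j then cinner x y else 0)"
  using isometries cisometry_cinner[OF isometry] by (auto simp: isometries_orthogonal_ranges_def)

lemma cadjoint_S: "cadjoint (S i) (S j x) = (if i = j then x else 0)"
  by (rule cinner_extI) (auto simp: cinner_cadjoint'[OF S_bounded] cinner_S)

text \<open>Each \<open>S i\<close> followed after its adjoint is a projection, and these have
  orthogonal ranges; so \<open>defect S\<close> is the orthogonal projection onto the wandering
  space. The next lemmas record this piecewise.\<close>

lemma defect_wandering: "defect S x \<in> wandering_space S"
proof -
  have "cadjoint (S i) (defect S x) = 0" for i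
    by (simp add: defect_def bounded_clinear_diff[OF cadjoint_bounded]
        bounded_clinear_sum[OF cadjoint_bounded] cadjoint_S)
  then show ?thesis
    by (simp add: wandering_space_def)
qed

lemma defect_id: "x \<in> wandering_space S \<Longrightarrow> defect S x = x"
  by (simp add: defect_def wandering_space_def bounded_clinear_0[OF S_bounded])

lemma defect_S: "defect S (S i x) = 0"
proof -
  have "(\<Sum>j\<in>UNIV. S j (cadjoint (S j) (S i x))) = (\<Sum>j\<in>UNIV. if j = i then S i x else 0)"
    by (rule sum.cong) (auto simp: cadjoint_S bounded_clinear_0[OF S_bounded])
  then show ?thesis
    by (simp add: defect_def)
qed

lemma norm_defect: "cinner (defect S x) x = (norm (defect S x))\<^sup>2"
proof -
  have "cinner (defect S x) (defect S x) = cinner x (defect S x)"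
    using cinner_defect[of S x "defect S x", OF S_bounded] defect_wandering[of x]
    by (simp add: wandering_space_def)
  then show ?thesis
    by (metis cinner_commute cinner_self complex_cnj_complex_of_real)
qed

text \<open>Pythagoras for the splitting into the wandering space and the ranges of the
  \<open>S i\<close>.\<close>

lemma norm_row: "(norm x)\<^sup>2 = (norm (defect S x))\<^sup>2 + (\<Sum>i\<in>UNIV. (norm (cadjoint (S i) x))\<^sup>2)"
proof -
  have "complex_of_real ((norm (defect S x))\<^sup>2)
      = complex_of_real ((norm x)\<^sup>2 - (\<Sum>i\<in>UNIV. (norm (cadjoint (S i) x))\<^sup>2))"
    using norm_defect[of x] cinner_defect[of S x x, OF S_bounded] by (simp add: cinner_self)
  then show ?thesis
    unfolding of_real_eq_iff by simp
qed

section \<open>Sums over words of fixed length\<close>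

lemma row_iterate_norm_le: "row_iterate S (\<lambda>x. (norm x)\<^sup>2) k x \<le> (norm x)\<^sup>2"
proof (induction k arbitrary: x)
  case (Suc k)
  have "row_iterate S (\<lambda>x. (norm x)\<^sup>2) (Suc k) x \<le> (\<Sum>i\<in>UNIV. (norm (cadjoint (S i) x))\<^sup>2)"
    using Suc.IH by (simp add: sum_mono)
  also have "\<dots> \<le> (norm x)\<^sup>2"
    using norm_row[of x] by simp
  finally show ?case .
qed simp

lemma row_iterate_mono: "(\<And>x. q x \<le> r x) \<Longrightarrow> row_iterate S q k x \<le> row_iterate S r k x"
  by (induction k arbitrary: x) (simp_all add: sum_mono)

text \<open>The model is (a + b)^2 \<le> 2 a^2 + 2 b^2. The recursion only sums values of
  \<open>q\<close>, so the factor 2 does not grow with \<open>k\<close>.\<close>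

lemma row_iterate_subadditive:
  assumes "\<And>x y. q (x + y) \<le> 2 * q x + 2 * q y"
  shows "row_iterate S q k (x + y) \<le> 2 * row_iterate S q k x + 2 * row_iterate S q k y"
proof (induction k arbitrary: x y)
  case (Suc k)
  have "row_iterate S q (Suc k) (x + y) \<le> (\<Sum>i\<in>UNIV. 2 * row_iterate S q k (cadjoint (S i) x)
      + 2 * row_iterate S q k (cadjoint (S i) y))"
    using Suc.IH by (simp add: bounded_clinear_add[OF cadjoint_bounded] sum_mono)
  then show ?case
    by (simp add: sum.distrib sum_distrib_left)
qed (simp add: assms)

text \<open>On \<open>W\<close> the defect vanishes, so \<open>norm_row\<close> distributes the
  squared norm over the letters without loss, and coinvariance keeps each piece in \<open>W\<close>.
  Hence \<open>d\<close> serves for every \<open>k\<close>.\<close>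

lemma row_iterate_lower_bound:
  assumes W: "coinvariant S W" "\<And>x. x \<in> W \<Longrightarrow> defect S x = 0"
    and q: "\<And>x. x \<in> W \<Longrightarrow> d * (norm x)\<^sup>2 \<le> q x"
  shows "x \<in> W \<Longrightarrow> d * (norm x)\<^sup>2 \<le> row_iterate S q k x"
proof (induction k arbitrary: x)
  case (Suc k)
  have "d * (norm x)\<^sup>2 = (\<Sum>i\<in>UNIV. d * (norm (cadjoint (S i) x))\<^sup>2)"
    using norm_row[of x] W(2)[OF Suc.prems] by (simp add: sum_distrib_left)
  also have "\<dots> \<le> row_iterate S q (Suc k) x"
    using W(1) Suc.prems by (simp add: coinvariant_def sum_mono Suc.IH)
  finally show ?case .
qed (simp add: q)

context
  fixes V :: "'h set"
  assumes V: "coinvariant S V"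
begin

lemma coinvariant_tower_csubspace: "csubspace (coinvariant_tower S V k)"
proof (induction k)
  case 0
  then show ?case
    using V by (simp add: coinvariant_def)
next
  case (Suc k)
  have "coinvariant_tower S V (Suc k) = (\<Inter>i. cadjoint (S i) -` coinvariant_tower S V k)"
    by auto
  then show ?case
    by (simp only:) (intro cvs.subspace_Int csubspace_vimage cadjoint_bounded Suc)
qed

lemma coinvariant_tower_mono: "k \<le> l \<Longrightarrow> coinvariant_tower S V k \<subseteq> coinvariant_tower S V l"
proof -
  have "coinvariant_tower S V k \<subseteq> coinvariant_tower S V (Suc k)" for k
    by (induction k) (use V in \<open>auto simp: coinvariant_def\<close>)
  then show "k \<le> l \<Longrightarrow> coinvariant_tower S V k \<subseteq> coinvariant_tower S V l"
    by (rule lift_Suc_mono_le)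
qed

text \<open>Each adjoint removes a matching first letter or gives 0, so after
  \<open>length w\<close> of them only \<open>v\<close> or 0 is left.\<close>

lemma word_op_in_tower: "v \<in> V \<Longrightarrow> word_op S w v \<in> coinvariant_tower S V (length w)"
  by (induction w)
     (auto simp: cadjoint_S cvs.subspace_0[OF coinvariant_tower_csubspace])

text \<open>A combination involves finitely many words, and the levels increase because
  \<open>V\<close> is coinvariant; so one level contains it.\<close>

lemma cspan_word_op_in_tower:
  "x \<in> cspan (\<Union>w. word_op S w ` V) \<Longrightarrow> \<exists>k. x \<in> coinvariant_tower S V k"
proof -
  have "csubspace (\<Union>k. coinvariant_tower S V k)"
  proof (rule cvs.subspaceI)
    fix x y
    assume "x \<in> (\<Union>k. coinvariant_tower S V k)" "y \<in> (\<Union>k. coinvariant_tower S V k)"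
    then obtain k l where "x \<in> coinvariant_tower S V k" "y \<in> coinvariant_tower S V l"
      by blast
    then have "x \<in> coinvariant_tower S V (max k l)" "y \<in> coinvariant_tower S V (max k l)"
      using coinvariant_tower_mono[of k "max k l"] coinvariant_tower_mono[of l "max k l"] by auto
    then show "x + y \<in> (\<Union>k. coinvariant_tower S V k)"
      using cvs.subspace_add[OF coinvariant_tower_csubspace] by blast
  qed (use cvs.subspace_0[OF coinvariant_tower_csubspace]
      cvs.subspace_scale[OF coinvariant_tower_csubspace] in blast)+
  moreover have "(\<Union>w. word_op S w ` V) \<subseteq> (\<Union>k. coinvariant_tower S V k)"
    using word_op_in_tower by blast
  ultimately show "x \<in> cspan (\<Union>w. word_op S w ` V) \<Longrightarrow> \<exists>k. x \<in> coinvariant_tower S V k"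
    using cvs.span_minimal by blast
qed

lemma row_iterate_tower:
  "(\<And>x. x \<in> V \<Longrightarrow> q x = 0) \<Longrightarrow> x \<in> coinvariant_tower S V k \<Longrightarrow> row_iterate S q k x = 0"
  by (induction k arbitrary: x) simp_all

text \<open>
  With \<open>q\<close> the squared distance to \<open>V\<close>, the sums of \<open>q (S\<^sub>w\<^sup>* x)\<close> over the words \<open>w\<close> of length \<open>k\<close>
  tend to \<open>0\<close>. On \<open>W\<close> the sums of \<open>norm (S\<^sub>w\<^sup>* x)\<^sup>2\<close> are constant, so compactness of the unit sphere
  of \<open>W\<close> yields a unit vector of \<open>W\<close> at distance \<open>0\<close> from \<open>V\<close>.
\<close>

lemma coinvariant_meets_generating:
  assumes V_fin: "finite_cdim V" and dense: "closure (cspan (\<Union>w. word_op S w ` V)) = UNIV"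
    and W: "coinvariant S W" "finite_cdim W" "W \<noteq> {0}" and W_defect: "\<And>x. x \<in> W \<Longrightarrow> defect S x = 0"
  shows "V \<inter> W \<noteq> {0}"
proof
  assume triv: "V \<inter> W = {0}"
  have Wsub: "csubspace W" and Vsub: "csubspace V"
    using W V by (auto simp: coinvariant_def)
  note Vcl = closed_finite_cdim[OF V_fin]
  define q where "q x = (norm (x - cproj V x))\<^sup>2" for x
  have q_le: "q x \<le> (norm x)\<^sup>2" for x
    unfolding q_def by (intro power_mono norm_cproj_le Vsub Vcl) simp
  have q_V: "q x = 0" if "x \<in> V" for x
    using cproj_id[OF Vsub Vcl that] by (simp add: q_def)
  have q_add: "q (x + y) \<le> 2 * q x + 2 * q y" for x y
  proof -
    have "x + y - cproj V (x + y) = (x - cproj V x) + (y - cproj V y)"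
      by (simp add: cproj_add[OF Vsub Vcl])
    then have "q (x + y) \<le> (norm (x - cproj V x) + norm (y - cproj V y))\<^sup>2"
      unfolding q_def by (metis norm_ge_zero norm_triangle_ineq power_mono)
    also have "\<dots> \<le> 2 * q x + 2 * q y"
      using zero_le_power2[of "norm (x - cproj V x) - norm (y - cproj V y)"]
      by (simp add: q_def power2_sum power2_diff)
    finally show ?thesis .
  qed
  let ?K = "{x\<in>W. norm x = 1}"
  have "bounded_clinear (cproj V)"
    by (rule bounded_clinearI[where K = 1])
       (use norm_cproj_le[OF Vsub Vcl] in \<open>simp_all add: cproj_add[OF Vsub Vcl] cproj_scaleC[OF Vsub Vcl]\<close>)
  then have "continuous_on ?K q"
    unfolding q_def by (intro continuous_intros bounded_clinear_continuous_on)
  have normalize: "complex_of_real (inverse (norm x)) *\<^sub>C x \<in> ?K" if "x \<in> W" "x \<noteq> 0" for x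
    using cvs.subspace_scale[OF Wsub that(1)] that(2) by (simp add: norm_inverse)
  obtain z where "z \<in> W" "z \<noteq> 0"
    using W(3) cvs.subspace_0[OF Wsub] by blast
  then have "?K \<noteq> {}"
    using normalize by blast
  then obtain x0 where x0: "x0 \<in> ?K" and min: "\<And>x. x \<in> ?K \<Longrightarrow> q x0 \<le> q x"
    using continuous_attains_inf[OF compact_unit_sphere[OF W(2)] _ \<open>continuous_on ?K q\<close>] by blast
  define d where "d = q x0"
  \<comment> \<open>Otherwise the unit vector \<open>x0\<close> would lie in \<open>V\<close> and in
    \<open>W\<close>.\<close>
  have "x0 \<noteq> cproj V x0"
    using cproj_in[OF Vsub Vcl, of x0] x0 triv by force
  then have "d > 0"
    by (simp add: d_def q_def)
  have lower: "d * (norm x)\<^sup>2 \<le> q x" if x: "x \<in> W" for x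
  proof (cases "x = 0")
    case False
    define c where "c = complex_of_real (inverse (norm x))"
    have "c *\<^sub>C x - cproj V (c *\<^sub>C x) = c *\<^sub>C (x - cproj V x)"
      by (simp only: cproj_scaleC[OF Vsub Vcl] scaleC_diff_right)
    then have "q (c *\<^sub>C x) = (inverse (norm x))\<^sup>2 * q x"
      by (simp add: q_def c_def norm_inverse power_mult_distrib)
    with min[OF normalize[OF x False]] have "d \<le> (inverse (norm x))\<^sup>2 * q x"
      by (simp add: d_def c_def)
    then show ?thesis
      using False by (simp add: field_simps)
  qed (simp add: q_def)
  \<comment> \<open>With this radius the closing estimate reads d \<le> 2 * (d / 4); the factor 2 is
    the one from \<open>row_iterate_subadditive\<close>.\<close>
  have "0 < sqrt d / 2"
    using \<open>d > 0\<close> by simp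
  moreover have "x0 \<in> closure (cspan (\<Union>w. word_op S w ` V))"
    using dense by simp
  ultimately obtain y where y: "y \<in> cspan (\<Union>w. word_op S w ` V)" "dist y x0 < sqrt d / 2"
    unfolding closure_approachable by blast
  obtain k where k: "y \<in> coinvariant_tower S V k"
    using cspan_word_op_in_tower[OF y(1)] by blast
  have "d = d * (norm x0)\<^sup>2"
    using x0 by simp
  also have "\<dots> \<le> row_iterate S q k x0"
    using x0 by (intro row_iterate_lower_bound[OF W(1) W_defect lower]) auto
  also have "\<dots> \<le> 2 * row_iterate S q k (x0 - y) + 2 * row_iterate S q k y"
    using row_iterate_subadditive[OF q_add, of k "x0 - y" y] by simp
  also have "row_iterate S q k y = 0"
    by (rule row_iterate_tower[OF q_V k])
  also have "row_iterate S q k (x0 - y) \<le> (norm (x0 - y))\<^sup>2"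
    using row_iterate_mono[OF q_le] row_iterate_norm_le by (rule order_trans)
  also have "(norm (x0 - y))\<^sup>2 \<le> (sqrt d / 2)\<^sup>2"
    using y(2) by (intro power_mono) (simp_all add: dist_norm norm_minus_commute)
  also have "(sqrt d / 2)\<^sup>2 = d / 4"
    using \<open>d > 0\<close> by (simp add: power_divide)
  finally show False
    using \<open>d > 0\<close> by simp
qed

end

end


section \<open>Dilations\<close>

text \<open>Neither minimality nor finite dimension is assumed, so the locale covers the embedding
  \<open>J\<close> of a dilation as well as a unitary between two dilation spaces.\<close>

locale isometric_intertwiner = isometry_tuple S
  for S :: "'n::finite \<Rightarrow> 'h::chilbert_space \<Rightarrow> 'h" +
  fixes A :: "'n \<Rightarrow> 'v::chilbert_space \<Rightarrow> 'v" and J :: "'v \<Rightarrow> 'h"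
  assumes J_isometry: "cisometry J"
    and A_bounded: "bounded_clinear (A i)"
    and cadjoint_J: "cadjoint (S i) (J v) = J (cadjoint (A i) v)"
begin

lemma J_bounded: "bounded_clinear J"
  using J_isometry by (simp add: cisometry_def)

lemma J_eq_iff: "J x = J y \<longleftrightarrow> x = y"
  using cadjoint_cisometry[OF J_isometry] by metis

lemma inj_J: "inj J"
  by (simp add: inj_on_def J_eq_iff)

lemma J_image_eq_0_iff: "J ` W = {0} \<longleftrightarrow> W = {0}"
  using bounded_clinear_0[OF J_bounded] inj_image_eq_iff[OF inj_J, of W "{0}"] by simp

lemma coinvariant_image: "coinvariant A W \<Longrightarrow> coinvariant S (J ` W)"
  by (auto simp: coinvariant_def cadjoint_J csubspace_image[OF J_bounded])

lemma coinvariant_vimage: "coinvariant S W \<Longrightarrow> coinvariant A (J -` W)"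
  using csubspace_vimage[OF J_bounded] by (auto simp: coinvariant_def cadjoint_J[symmetric])

lemma cinner_defect_J: "cinner (defect S (J v)) (J w) = cinner (defect A v) w"
  by (simp add: cinner_defect[of S, OF S_bounded] cinner_defect[of A, OF A_bounded] cadjoint_J
      cisometry_cinner[OF J_isometry])

text \<open>\<open>defect A\<close> is the compression of \<open>defect S\<close>. From
  \<open>A\<close> to \<open>S\<close> the projection property is used: the quadratic form of
  \<open>defect S\<close> at \<open>J v\<close> is a squared norm.\<close>

lemma defect_J_eq_0_iff: "defect S (J v) = 0 \<longleftrightarrow> defect A v = 0"
proof
  assume "defect S (J v) = 0"
  then have "cinner (defect A v) w = cinner 0 w" for w
    using cinner_defect_J[of v w] by simp
  then show "defect A v = 0"
    by (rule cinner_extI)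
next
  assume "defect A v = 0"
  then show "defect S (J v) = 0"
    using norm_defect[of "J v"] cinner_defect_J[of v v] by simp
qed

lemma cuntz_minimal_image:
  assumes W: "cuntz_minimal A W"
  shows "cuntz_minimal S (J ` W)"
proof (rule cuntz_minimalI)
  show "coinvariant S (J ` W)" "J ` W \<noteq> {0}" "finite_cdim (J ` W)"
    by (simp_all add: cuntz_minimalD[OF W] coinvariant_image finite_cdim_image[OF J_bounded]
        J_image_eq_0_iff)
  show "defect S x = 0" if "x \<in> J ` W" for x
    using that cuntz_minimalD(5)[OF W] by (auto simp: defect_J_eq_0_iff)
  fix W'
  assume W': "coinvariant S W'" "W' \<noteq> {0}" "W' \<subseteq> J ` W"
  then have *: "W' = J ` (J -` W')"
    by auto
  then have "J -` W' \<noteq> {0}"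
    using W'(2) J_image_eq_0_iff by metis
  moreover have "J -` W' \<subseteq> W"
    using W'(3) by (auto simp: J_eq_iff)
  ultimately have "J -` W' = W"
    by (intro cuntz_minimalD(4)[OF W] coinvariant_vimage W'(1))
  with * show "W' = J ` W"
    by simp
qed

lemma cuntz_minimal_vimage:
  assumes W: "cuntz_minimal S W" and sub: "W \<subseteq> range J"
  shows "cuntz_minimal A (J -` W)"
proof (rule cuntz_minimalI)
  have *: "W = J ` (J -` W)"
    using sub by auto
  \<comment> \<open>The adjoint inverts \<open>J\<close> on its range, so this preimage is the image
    of \<open>W\<close> under a bounded linear map and inherits finite dimension.\<close>
  have "J -` W = cadjoint J ` J ` (J -` W)"
    unfolding image_image cadjoint_cisometry[OF J_isometry] by simp
  then show "finite_cdim (J -` W)"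
    using * finite_cdim_image[OF bounded_clinear_cadjoint[OF J_bounded] cuntz_minimalD(3)[OF W]]
    by metis
  show "J -` W \<noteq> {0}"
    using * J_image_eq_0_iff cuntz_minimalD(2)[OF W] by metis
  show "coinvariant A (J -` W)"
    by (intro coinvariant_vimage cuntz_minimalD(1)[OF W])
  show "defect A v = 0" if "v \<in> J -` W" for v
    using that cuntz_minimalD(5)[OF W] by (simp add: defect_J_eq_0_iff[symmetric])
  fix W'
  assume W': "coinvariant A W'" "W' \<noteq> {0}" "W' \<subseteq> J -` W"
  then have "J ` W' = W"
    by (intro cuntz_minimalD(4)[OF W] coinvariant_image) (auto simp: J_image_eq_0_iff)
  then have "J -` J ` W' = J -` W"
    by simp
  then show "W' = J -` W"
    by (simp add: inj_vimage_image_eq[OF inj_J])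
qed

text \<open>The hypothesis is the hard compactness statement when \<open>J\<close> embeds the
  original space, and trivial when \<open>J\<close> is surjective.\<close>

lemma cuntz_core_image:
  assumes "\<And>W. cuntz_minimal S W \<Longrightarrow> W \<subseteq> range J"
  shows "J ` cuntz_core A = cuntz_core S"
proof -
  have "J ` \<Union>{W. cuntz_minimal A W} = \<Union>{W. cuntz_minimal S W}"
  proof (intro equalityI subsetI)
    fix x
    assume "x \<in> \<Union>{W. cuntz_minimal S W}"
    then obtain W where W: "cuntz_minimal S W" "x \<in> W"
      by blast
    then obtain v where "x = J v" "v \<in> J -` W"
      using assms by blast
    then show "x \<in> J ` \<Union>{W. cuntz_minimal A W}"
      using cuntz_minimal_vimage[OF W(1) assms[OF W(1)]] by blast
  qed (use cuntz_minimal_image in blast)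
  then show ?thesis
    unfolding cuntz_core_def cspan_image[OF J_bounded, symmetric] by simp
qed

lemma wandering_J_iff: "J v \<in> wandering_space S \<longleftrightarrow> v \<in> wandering_space A"
  using J_eq_iff[of _ 0] bounded_clinear_0[OF J_bounded] by (simp add: wandering_space_def cadjoint_J)

end

locale finite_dilation =
  fixes A :: "'n::finite \<Rightarrow> 'v::chilbert_space \<Rightarrow> 'v"
    and J :: "'v \<Rightarrow> 'h::chilbert_space"
    and S :: "'n \<Rightarrow> 'h \<Rightarrow> 'h"
  assumes dilation: "minimal_isometric_dilation A J S"
    and bounded: "bounded_clinear (A i)"
    and finite_dim: "finite_cdim (UNIV :: 'v set)"
begin

sublocale isometric_intertwiner S A J
  using dilation bounded by unfold_locales (simp_all add: minimal_isometric_dilation_def)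

lemma dense: "closure (cspan (\<Union>w. word_op S w ` range J)) = UNIV"
  using dilation by (simp add: minimal_isometric_dilation_def)

lemma coinvariant_range: "coinvariant S (range J)"
  by (rule coinvariant_image) (simp add: coinvariant_def)

lemma finite_cdim_range: "finite_cdim (range J)"
  by (rule finite_cdim_image[OF J_bounded finite_dim])

lemma cuntz_minimal_subset_range:
  assumes W: "cuntz_minimal S W"
  shows "W \<subseteq> range J"
proof -
  have "coinvariant S (range J \<inter> W)"
    by (intro coinvariant_inter coinvariant_range cuntz_minimalD(1)[OF W])
  moreover have "range J \<inter> W \<noteq> {0}"
    by (rule coinvariant_meets_generating[OF coinvariant_range finite_cdim_range dense cuntz_minimalD(1,3,2)[OF W]])
       (rule cuntz_minimalD(5)[OF W])
  ultimately have "range J \<inter> W = W"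
    by (rule cuntz_minimalD(4)[OF W]) simp
  then show ?thesis
    by blast
qed

lemma tilde_space_image: "J ` tilde_space A = cuntz_core S"
  using cuntz_core_image[OF cuntz_minimal_subset_range] tilde_space_eq_cuntz_core[of A, OF bounded finite_dim]
  by simp

lemma coinvariant_tilde_space: "coinvariant A (tilde_space A)"
  using coinvariant_cuntz_core[of A, OF bounded] tilde_space_eq_cuntz_core[of A, OF bounded finite_dim]
  by simp

text \<open>\<open>defect S\<close> kills the range of every \<open>S i\<close>, so only the empty
  word contributes on the dense span. The resulting range is finite-dimensional, hence closed, and
  therefore all of the wandering space.\<close>

lemma wandering_space_eq: "wandering_space S = range (\<lambda>v. defect S (J v))"
proof
  let ?P = "\<lambda>v. defect S (J v)"
  have P: "bounded_clinear (defect S)"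
    by (rule bounded_clinear_defect[of S, OF S_bounded])
  have PJ: "bounded_clinear ?P"
    using bounded_clinear_comp[OF P J_bounded] by (simp add: comp_def)
  have fin: "finite_cdim (range ?P)"
    by (rule finite_cdim_image[OF PJ finite_dim])
  have sub: "csubspace (range ?P)"
    by (rule finite_cdim_csubspace[OF fin])
  have "defect S (word_op S w (J v)) \<in> range ?P" for w v
    by (cases w) (simp_all add: defect_S cvs.subspace_0[OF sub])
  then have "cspan (\<Union>w. word_op S w ` range J) \<subseteq> defect S -` range ?P"
    by (intro cvs.span_minimal csubspace_vimage P sub) blast
  moreover have "closed (defect S -` range ?P)"
    by (intro closed_vimage bounded_clinear_continuous_on P closed_finite_cdim fin)
  ultimately have "UNIV \<subseteq> defect S -` range ?P"
    using closure_minimal dense by metis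
  then show "wandering_space S \<subseteq> range ?P"
    using defect_id by (metis UNIV_I subsetD subsetI vimageD)
qed (use defect_wandering in blast)

lemma finite_cdim_wandering_space: "finite_cdim (wandering_space S)"
proof -
  have "bounded_clinear (\<lambda>v. defect S (J v))"
    using bounded_clinear_comp[OF bounded_clinear_defect[of S, OF S_bounded] J_bounded]
    by (simp add: comp_def)
  then show ?thesis
    unfolding wandering_space_eq by (rule finite_cdim_image[OF _ finite_dim])
qed

text \<open>\<open>defect A\<close> is \<open>defect S\<close> compressed by \<open>J\<close>, so
  its range is the image of the wandering space under the adjoint of \<open>J\<close>. That adjoint
  is injective there by \<open>defect_J_eq_0_iff\<close>.\<close>

lemma crank_defect: "crank (defect A) = cdim (wandering_space S)"
proof -
  have eq: "defect A v = cadjoint J (defect S (J v))" for v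
    by (rule cinner_extI) (simp add: cinner_defect_J[symmetric] cinner_cadjoint'[OF J_bounded])
  then have range: "range (defect A) = cadjoint J ` wandering_space S"
    unfolding wandering_space_eq by (simp add: image_comp comp_def)
  have "n = n'" if n: "n \<in> wandering_space S" "n' \<in> wandering_space S" "cadjoint J n = cadjoint J n'" for n n'
  proof -
    have "n - n' \<in> wandering_space S"
      using finite_cdim_csubspace[OF finite_cdim_wandering_space] n cvs.subspace_diff by blast
    then obtain v where v: "n - n' = defect S (J v)"
      unfolding wandering_space_eq by blast
    have "cadjoint J (n - n') = 0"
      using n(3) by (simp add: bounded_clinear_diff[OF bounded_clinear_cadjoint[OF J_bounded]])
    then have "defect A v = 0"
      by (simp add: eq v)
    then have "n - n' = 0"
      unfolding v defect_J_eq_0_iff .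
    then show ?thesis
      by simp
  qed
  then have "inj_on (cadjoint J) (wandering_space S)"
    by (rule inj_onI)
  then show ?thesis
    unfolding crank_def range
    by (rule cdim_image_eq[OF bounded_clinear_cadjoint[OF J_bounded]
          finite_cdim_csubspace[OF finite_cdim_wandering_space]])
qed

text \<open>
  The orthogonal complement of the closed span \<open>M\<close> is reducing. If it is nonzero, then the
  projection of the range of \<open>J\<close> to it contains a minimal coinvariant subspace, which lies in
  the core and hence in \<open>M\<close>.
\<close>

lemma wandering_core_dense:
  "closure (cspan (\<Union>w. word_op S w ` (wandering_space S \<union> cuntz_core S))) = UNIV"
proof -
  let ?E = "wandering_space S \<union> cuntz_core S"
  define X where "X = (\<Union>w. word_op S w ` ?E)"
  define M where "M = closure (cspan X)"
  have M: "csubspace M" "closed M" and XM: "X \<subseteq> M"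
    unfolding M_def using closure_csubspace[OF cvs.subspace_span] cvs.span_superset[of X] closure_subset
    by auto
  \<comment> \<open>A continuous linear map need only be checked on the generators. Applied to each
    \<open>S i\<close> and its adjoint, this makes \<open>M\<close> reducing.\<close>
  have M_least: "M \<subseteq> f -` M" if f: "bounded_clinear f" and "f ` X \<subseteq> M" for f
  proof -
    have "cspan X \<subseteq> f -` M"
      using that by (intro cvs.span_minimal csubspace_vimage M) auto
    moreover have "closed (f -` M)"
      by (intro closed_vimage bounded_clinear_continuous_on f M)
    ultimately show ?thesis
      using closure_minimal[of "cspan X" "f -` M"] by (simp add: M_def)
  qed
  have EM: "?E \<subseteq> M"
    using XM unfolding X_def by (force intro: exI[of _ "[]"])
  have SX: "S i ` X \<subseteq> X" for i
  proof clarify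
    fix x
    assume "x \<in> X"
    then obtain w e where "x = word_op S w e" "e \<in> ?E"
      unfolding X_def by blast
    then have "S i x = word_op S (i # w) e" "e \<in> ?E"
      by simp_all
    then show "S i x \<in> X"
      unfolding X_def by blast
  qed
  then have SM: "S i m \<in> M" if "m \<in> M" for i m
    using M_least[OF S_bounded, of i] XM that by blast
  have E_co: "cadjoint (S i) e \<in> M" if "e \<in> ?E" for i e
    using that EM coinvariant_cuntz_core[of S, OF S_bounded] cvs.subspace_0[OF M(1)]
    by (auto simp: wandering_space_def coinvariant_def)
  have "cadjoint (S i) (word_op S w e) \<in> M" if "e \<in> ?E" for i w e
  proof (cases w)
    case (Cons j u)
    have "word_op S u e \<in> M"
      using XM that unfolding X_def by blast
    then show ?thesis
      using Cons cvs.subspace_0[OF M(1)] by (simp add: cadjoint_S)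
  qed (use E_co that in simp)
  then have "cadjoint (S i) ` X \<subseteq> M" for i
    unfolding X_def by blast
  then have coM: "cadjoint (S i) m \<in> M" if "m \<in> M" for i m
    using M_least[OF cadjoint_bounded, of i] that by blast
  have range_M: "range J \<subseteq> M"
  proof (rule ccontr)
    assume not: "\<not> range J \<subseteq> M"
    define R where "R v = J v - cproj M (J v)" for v
    have R_orth: "cinner (R v) m = 0" if "m \<in> M" for v m
      unfolding R_def by (rule cproj_orthogonal[OF M that])
    have R: "bounded_clinear R"
    proof (rule bounded_clinearI[where K = 1])
      show "R (u + v) = R u + R v" for u v
        by (simp add: R_def bounded_clinear_add[OF J_bounded] cproj_add[OF M])
      show "R (c *\<^sub>C v) = c *\<^sub>C R v" for c v
        by (simp add: R_def bounded_clinear_scaleC[OF J_bounded] cproj_scaleC[OF M] scaleC_diff_right)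
      show "norm (R v) \<le> norm v * 1" for v
        using norm_cproj_le(2)[OF M, of "J v"] J_isometry by (simp add: R_def cisometry_def)
    qed
    \<comment> \<open>As \<open>M\<close> is reducing, the projection commutes with the adjoints,
      and \<open>R\<close> inherits the intertwining relation of \<open>J\<close>.\<close>
    have co: "cadjoint (S i) (R v) = R (cadjoint (A i) v)" for i v
    proof -
      have "cproj M (J (cadjoint (A i) v)) = cadjoint (S i) (cproj M (J v))"
      proof (rule cproj_unique[OF M])
        show "cadjoint (S i) (cproj M (J v)) \<in> M"
          by (intro coM cproj_in M)
        fix m
        assume "m \<in> M"
        then have "cinner (R v) (S i m) = 0"
          by (intro R_orth SM)
        then have "cinner (cadjoint (S i) (R v)) m = 0"
          by (simp add: cinner_cadjoint'[OF S_bounded])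
        then show "cinner (J (cadjoint (A i) v) - cadjoint (S i) (cproj M (J v))) m = 0"
          by (simp add: R_def bounded_clinear_diff[OF cadjoint_bounded] cadjoint_J)
      qed
      then show ?thesis
        by (simp add: R_def bounded_clinear_diff[OF cadjoint_bounded] cadjoint_J)
    qed
    have fin: "finite_cdim (range R)"
      by (rule finite_cdim_image[OF R finite_dim])
    have "coinvariant S (range R)"
      unfolding coinvariant_def using co finite_cdim_csubspace[OF fin] by blast
    moreover have "range R \<noteq> {0}"
    proof -
      obtain v where "J v \<notin> M"
        using not by blast
      then have "R v \<noteq> 0"
        using cproj_in[OF M, of "J v"] by (auto simp: R_def)
      then show ?thesis
        by blast
    qed
    ultimately obtain W where W: "coinvariant S W" "W \<noteq> {0}" "W \<subseteq> range R"
      and min: "\<And>W'. coinvariant S W' \<Longrightarrow> W' \<noteq> {0} \<Longrightarrow> W' \<subseteq> W \<Longrightarrow> W' = W"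
      using minimal_csubspace_exists[OF fin, of "coinvariant S"] unfolding coinvariant_def by metis
    have "defect S x = 0" if "x \<in> W" for x
    proof -
      \<comment> \<open>\<open>x\<close> is orthogonal to \<open>M\<close>, which contains the
        wandering space where \<open>defect S x\<close> lies.\<close>
      have "cinner x (defect S x) = 0"
        using that W(3) R_orth EM defect_wandering by blast
      then have "cinner (defect S x) x = 0"
        by (simp only: cinner_eq_0_commute)
      then show ?thesis
        by (simp add: norm_defect)
    qed
    moreover have "finite_cdim W"
      using finite_cdim_subset[OF fin _ W(3)] W(1) by (simp add: coinvariant_def)
    ultimately have "cuntz_minimal S W"
      using W(1,2) min by (intro cuntz_minimalI)
    then have "W \<subseteq> cuntz_core S"
      unfolding cuntz_core_def by (blast intro: cvs.span_base)
    \<comment> \<open>\<open>W\<close> now lies both in \<open>M\<close> and in its orthogonal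
      complement.\<close>
    then have "cinner x x = 0" if "x \<in> W" for x
      using that W(3) R_orth EM by blast
    then have "W \<subseteq> {0}"
      by auto
    moreover have "0 \<in> W"
      using W(1) cvs.subspace_0 unfolding coinvariant_def by blast
    ultimately show False
      using W(2) by blast
  qed
  have "word_op S w (J v) \<in> M" for w v
    by (induction w) (use range_M SM in auto)
  then have "cspan (\<Union>w. word_op S w ` range J) \<subseteq> M"
    by (intro cvs.span_minimal M) blast
  then have "M = UNIV"
    using closure_minimal[OF _ M(2)] dense by blast
  then show ?thesis
    by (simp add: M_def X_def)
qed

end

text \<open>The Gram matrix of the word vectors is determined by \<open>\<rho>\<close>: equal first
  letters cancel, distinct ones give 0, and once one word is exhausted the remaining letters pass to
  the other side as adjoints, which stay in \<open>\<rho>\<close> by \<open>co\<close>.\<close>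

lemma unitary_of_generating_relation:
  fixes S :: "'n::finite \<Rightarrow> 'h::chilbert_space \<Rightarrow> 'h" and T :: "'n \<Rightarrow> 'k::chilbert_space \<Rightarrow> 'k"
  assumes S: "isometry_tuple S" and T: "isometry_tuple T" and gram: "equal_grams \<rho>"
    and co: "\<And>g h i. (g, h) \<in> \<rho> \<Longrightarrow> (cadjoint (S i) g, cadjoint (T i) h) \<in> \<rho>"
    and dense: "closure (cspan (\<Union>w. word_op S w ` fst ` \<rho>)) = UNIV"
      "closure (cspan (\<Union>w. word_op T w ` snd ` \<rho>)) = UNIV"
  obtains U where "unitary_between UNIV UNIV U" "\<And>i x. U (S i x) = T i (U x)"
proof -
  interpret S: isometry_tuple S by (rule S)
  interpret T: isometry_tuple T by (rule T)
  define R where "R = {(word_op S w g, word_op T w h) |w g h. (g, h) \<in> \<rho>}"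
  \<comment> \<open>Moving a letter across replaces the pair by its pair of adjoints, so
    \<open>g\<close> and \<open>h\<close> vary in the induction.\<close>
  have left: "cinner g (word_op S w g') = cinner h (word_op T w h')"
    if "(g, h) \<in> \<rho>" "(g', h') \<in> \<rho>" for g h g' h' w
    using that(1)
  proof (induction w arbitrary: g h)
    case Nil
    then show ?case
      using equal_gramsD[OF gram] that(2) by simp
  next
    case (Cons i w)
    then show ?case
      using Cons.IH[OF co[OF Cons.prems, of i]]
      by (simp add: cinner_cadjoint'[OF S.S_bounded] cinner_cadjoint'[OF T.S_bounded])
  qed
  have grams: "cinner (word_op S u g) (word_op S w g') = cinner (word_op T u h) (word_op T w h')"
    if gh: "(g, h) \<in> \<rho>" "(g', h') \<in> \<rho>" for g h g' h' u w
  proof (induction u arbitrary: w)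
    case Nil
    show ?case
      using left[OF gh] by simp
  next
    case (Cons i u)
    show ?case
    proof (cases w)
      case Nil
      have "cinner g' (word_op S (i # u) g) = cinner h' (word_op T (i # u) h)"
        by (rule left[OF gh(2,1)])
      then show ?thesis
        using Nil by (metis cinner_commute word_op_Nil)
    next
      case (Cons j v)
      then show ?thesis
        using Cons.IH by (simp add: S.cinner_S T.cinner_S)
    qed
  qed
  have "equal_grams R"
    unfolding equal_grams_def R_def using grams by auto
  moreover have fst_R: "fst ` R = (\<Union>w. word_op S w ` fst ` \<rho>)"
    and snd_R: "snd ` R = (\<Union>w. word_op T w ` snd ` \<rho>)"
    unfolding R_def by force+
  ultimately obtain U where U: "unitary_between UNIV UNIV U" and UR: "\<And>a b. (a, b) \<in> R \<Longrightarrow> U a = b"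
    using unitary_of_equal_grams[of R] dense by metis
  have "bounded_clinear U"
    using unitary_between_UNIV_cisometry[OF U] by (simp add: cisometry_def)
  then have bounded: "bounded_clinear (U \<circ> S i)" "bounded_clinear (T i \<circ> U)" for i
    by (simp_all add: bounded_clinear_comp S.S_bounded T.S_bounded del: o_apply)
  have eq: "(U \<circ> S i) x = (T i \<circ> U) x" if x: "x \<in> (\<Union>w. word_op S w ` fst ` \<rho>)" for i x
  proof -
    obtain w g h where x_eq: "x = word_op S w g" and gh: "(g, h) \<in> \<rho>"
      using x by force
    have "U (word_op S w g) = word_op T w h" "U (word_op S (i # w) g) = word_op T (i # w) h"
      using gh by (blast intro: UR[unfolded R_def])+
    then show ?thesis
      using x_eq by simp
  qed
  have "U \<circ> S i = T i \<circ> U" for i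
    by (rule bounded_clinear_eq_on_dense[OF bounded dense(1) eq])
  then have "U (S i x) = T i (U x)" for i x
    by (simp add: fun_eq_iff)
  with U that show ?thesis
    by blast
qed

theorem theorem6p8:
  fixes A :: "'n::finite \<Rightarrow> 'v::chilbert_space \<Rightarrow> 'v"
    and B :: "'n \<Rightarrow> 'w::chilbert_space \<Rightarrow> 'w"
    and J\<^sub>A :: "'v \<Rightarrow> 'h::chilbert_space"
    and J\<^sub>B :: "'w \<Rightarrow> 'k::chilbert_space"
    and S :: "'n \<Rightarrow> 'h \<Rightarrow> 'h"
    and T :: "'n \<Rightarrow> 'k \<Rightarrow> 'k"
    and \<sigma>\<^sub>A :: "('n list ell2 \<Rightarrow> 'n list ell2) \<Rightarrow> 'h \<Rightarrow> 'h"
    and \<sigma>\<^sub>B :: "('n list ell2 \<Rightarrow> 'n list ell2) \<Rightarrow> 'k \<Rightarrow> 'k"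
  assumes "CARD('n) \<ge> 2"
    and "finite_cdim (UNIV :: 'v set)" and "finite_cdim (UNIV :: 'w set)"
    and "contractive A" and "contractive B"
    and "minimal_isometric_dilation A J\<^sub>A S" and "minimal_isometric_dilation B J\<^sub>B T"
    and "induced_rep S \<sigma>\<^sub>A" and "induced_rep T \<sigma>\<^sub>B"
  shows "unitarily_equivalent_reps cuntz_toeplitz \<sigma>\<^sub>A \<sigma>\<^sub>B \<longleftrightarrow>
    crank (defect A) = crank (defect B) \<and>
    (\<exists>U. unitary_between (tilde_space A) (tilde_space B) U \<and>
         (\<forall>i. \<forall>v\<in>tilde_space A. U (cadjoint (A i) v) = cadjoint (B i) (U v)))"
proof -
  interpret A: finite_dilation A J\<^sub>A S
    using assms by unfold_locales (simp_all add: contractive_def)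
  interpret B: finite_dilation B J\<^sub>B T
    using assms by unfold_locales (simp_all add: contractive_def)
  have L_bounded: "bounded_clinear X" if "X \<in> range left_creation" for X :: "'n list ell2 \<Rightarrow> 'n list ell2"
    using that by (auto simp: cisometry_left_creation[unfolded cisometry_def])
  have \<sigma>: "unital_star_rep (C_star_alg (range left_creation)) \<sigma>\<^sub>A"
    "unital_star_rep (C_star_alg (range left_creation)) \<sigma>\<^sub>B"
    and gen: "\<And>i. \<sigma>\<^sub>A (left_creation i) = S i" "\<And>i. \<sigma>\<^sub>B (left_creation i) = T i"
    using assms(8,9) by (simp_all add: induced_rep_def cuntz_toeplitz_def)
  show ?thesis
  proof
    assume "unitarily_equivalent_reps cuntz_toeplitz \<sigma>\<^sub>A \<sigma>\<^sub>B"
    then obtain U where U: "unitary_between UNIV UNIV U"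
      and eq: "\<And>X. X \<in> cuntz_toeplitz \<Longrightarrow> U \<circ> \<sigma>\<^sub>A X = \<sigma>\<^sub>B X \<circ> U"
      unfolding unitarily_equivalent_reps_def by blast
    have "left_creation i \<in> cuntz_toeplitz" for i :: 'n
      unfolding cuntz_toeplitz_def
      by (rule star_alg_subset_C_star_alg[OF L_bounded]) (auto intro: star_alg.gen)
    then have US: "U (S i x) = T i (U x)" for i x
      using eq[of "left_creation i"] gen by (metis comp_apply)
    \<comment> \<open>Here \<open>U\<close> takes the place of the embedding, \<open>S\<close> that
      of the original tuple and \<open>T\<close> that of its dilation.\<close>
    interpret U: isometric_intertwiner T S U
    proof unfold_locales
      show "cisometry U"
        by (rule unitary_between_UNIV_cisometry[OF U])
      show "bounded_clinear (S i)" for i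
        by (rule A.S_bounded)
      show "cadjoint (T i) (U v) = U (cadjoint (S i) v)" for i v
        by (rule intertwiner_cadjoint[of U "S i" "T i" v, OF U A.S_bounded B.S_bounded US, symmetric])
    qed
    have surj: "range U = UNIV"
      using U by (simp add: unitary_between_def)
    have core: "U ` cuntz_core S = cuntz_core T"
      by (rule U.cuntz_core_image) (simp add: surj)
    have "U ` wandering_space S = wandering_space T"
      using U.wandering_J_iff surj by (auto simp: image_iff) (metis UNIV_I imageE)
    then have "cdim (wandering_space T) = cdim (wandering_space S)"
      using cdim_image_eq[OF U.J_bounded finite_cdim_csubspace[OF A.finite_cdim_wandering_space]
          inj_on_subset[OF U.inj_J subset_UNIV]] by simp
    then have rank: "crank (defect A) = crank (defect B)"
      by (simp add: A.crank_defect B.crank_defect)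
    \<comment> \<open>\<open>U\<close> maps core to core, hence \<open>J\<^sub>A v\<close> into the
      range of \<open>J\<^sub>B\<close> for \<open>v\<close> in the tilde space; there the adjoint
      of \<open>J\<^sub>B\<close> is its inverse.\<close>
    define V where "V v = cadjoint J\<^sub>B (U (J\<^sub>A v))" for v
    have V_in: "V v \<in> tilde_space B" and JV: "J\<^sub>B (V v) = U (J\<^sub>A v)" if v: "v \<in> tilde_space A" for v
    proof -
      have "U (J\<^sub>A v) \<in> J\<^sub>B ` tilde_space B"
        using v core A.tilde_space_image B.tilde_space_image by blast
      then obtain w where "w \<in> tilde_space B" "U (J\<^sub>A v) = J\<^sub>B w"
        by blast
      then show "V v \<in> tilde_space B" "J\<^sub>B (V v) = U (J\<^sub>A v)"
        by (simp_all add: V_def cadjoint_cisometry[OF B.J_isometry])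
    qed
    have "w \<in> V ` tilde_space A" if w: "w \<in> tilde_space B" for w
    proof -
      have "J\<^sub>B w \<in> U ` J\<^sub>A ` tilde_space A"
        using w core A.tilde_space_image B.tilde_space_image by blast
      then obtain v where "v \<in> tilde_space A" "J\<^sub>B w = U (J\<^sub>A v)"
        by blast
      then show ?thesis
        using JV B.J_eq_iff by (metis image_eqI)
    qed
    then have "V ` tilde_space A = tilde_space B"
      using V_in by blast
    moreover have "V (x + y) = V x + V y" "V (c *\<^sub>C x) = c *\<^sub>C V x" for c x y
      by (simp_all add: V_def bounded_clinear_add bounded_clinear_scaleC A.J_bounded U.J_bounded
          bounded_clinear_cadjoint B.J_bounded)
    moreover have "cinner (V x) (V y) = cinner x y" if "x \<in> tilde_space A" "y \<in> tilde_space A" for x y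
    proof -
      have "cinner (V x) (V y) = cinner (J\<^sub>B (V x)) (J\<^sub>B (V y))"
        by (simp add: cisometry_cinner[OF B.J_isometry])
      then show ?thesis
        using that by (simp add: JV cisometry_cinner[OF U.J_isometry] cisometry_cinner[OF A.J_isometry])
    qed
    ultimately have "unitary_between (tilde_space A) (tilde_space B) V"
      unfolding unitary_between_def by blast
    moreover have "V (cadjoint (A i) v) = cadjoint (B i) (V v)" if v: "v \<in> tilde_space A" for i v
    proof -
      have "cadjoint (A i) v \<in> tilde_space A"
        using A.coinvariant_tilde_space v by (simp add: coinvariant_def)
      then have "J\<^sub>B (V (cadjoint (A i) v)) = cadjoint (T i) (U (J\<^sub>A v))"
        by (simp add: JV A.cadjoint_J[symmetric] U.cadjoint_J)
      also have "\<dots> = J\<^sub>B (cadjoint (B i) (V v))"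
        using v by (simp add: JV[symmetric] B.cadjoint_J)
      finally show ?thesis
        by (simp add: B.J_eq_iff)
    qed
    ultimately show "crank (defect A) = crank (defect B) \<and>
      (\<exists>U. unitary_between (tilde_space A) (tilde_space B) U \<and>
         (\<forall>i. \<forall>v\<in>tilde_space A. U (cadjoint (A i) v) = cadjoint (B i) (U v)))"
      using rank by blast
  next
    assume "crank (defect A) = crank (defect B) \<and>
      (\<exists>U. unitary_between (tilde_space A) (tilde_space B) U \<and>
         (\<forall>i. \<forall>v\<in>tilde_space A. U (cadjoint (A i) v) = cadjoint (B i) (U v)))"
    then obtain u where rank: "crank (defect A) = crank (defect B)"
      and u: "unitary_between (tilde_space A) (tilde_space B) u"
      and u_co: "\<And>i v. v \<in> tilde_space A \<Longrightarrow> u (cadjoint (A i) v) = cadjoint (B i) (u v)"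
      by blast
    \<comment> \<open>Any unitary will do, since the adjoints vanish on both wandering spaces and
      leave nothing to intertwine.\<close>
    obtain n where n: "unitary_between (wandering_space S) (wandering_space T) n"
      using unitary_between_exists[OF A.finite_cdim_wandering_space B.finite_cdim_wandering_space]
        rank A.crank_defect B.crank_defect by metis
    define \<rho> where "\<rho> = {(x, n x) |x. x \<in> wandering_space S} \<union>
      {(J\<^sub>A v, J\<^sub>B (u v)) |v. v \<in> tilde_space A}"
    have n_in: "n x \<in> wandering_space T" if "x \<in> wandering_space S" for x
      using n that unfolding unitary_between_def by blast
    have JA_in: "J\<^sub>A v \<in> cuntz_core S" and JB_in: "J\<^sub>B (u v) \<in> cuntz_core T" if "v \<in> tilde_space A" for v
      using u that A.tilde_space_image B.tilde_space_image unfolding unitary_between_def by blast+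
    have "cinner a a' = cinner b b'" if "(a, b) \<in> \<rho>" "(a', b') \<in> \<rho>" for a b a' b'
    proof -
      have n_inner: "cinner (n x) (n y) = cinner x y" if "x \<in> wandering_space S" "y \<in> wandering_space S" for x y
        using n that unfolding unitary_between_def by blast
      have u_inner: "cinner (u x) (u y) = cinner x y" if "x \<in> tilde_space A" "y \<in> tilde_space A" for x y
        using u that unfolding unitary_between_def by blast
      \<comment> \<open>The mixed Gram entries, wandering against core, are 0 on both sides.\<close>
      note orth = wandering_orthogonal_core[of S, OF A.S_bounded] wandering_orthogonal_core[of T, OF B.S_bounded]
      show ?thesis
        using that unfolding \<rho>_def
        by (auto simp: n_inner u_inner orth n_in JA_in JB_in cisometry_cinner[OF A.J_isometry]
            cisometry_cinner[OF B.J_isometry])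
    qed
    then have gram: "equal_grams \<rho>"
      unfolding equal_grams_def by blast
    have co: "(cadjoint (S i) a, cadjoint (T i) b) \<in> \<rho>" if "(a, b) \<in> \<rho>" for a b i
      using that unfolding \<rho>_def
    proof (elim UnE CollectE exE conjE)
      fix x
      assume x: "(a, b) = (x, n x)" "x \<in> wandering_space S"
      have "0 \<in> wandering_space S"
        using finite_cdim_csubspace[OF A.finite_cdim_wandering_space] cvs.subspace_0 by blast
      \<comment> \<open>\<open>n\<close> is known to be linear only on the wandering space; scaling
        by 0 gives \<open>n 0 = 0\<close>, so the pair of adjoints (0, 0) belongs to
        \<open>\<rho>\<close>.\<close>
      moreover have "n (0 *\<^sub>C x) = 0 *\<^sub>C n x"
        using n x(2) unfolding unitary_between_def by blast
      moreover have "cadjoint (S i) a = 0" "cadjoint (T i) b = 0"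
        using x n_in[OF x(2)] by (simp_all add: wandering_space_def)
      ultimately show "(cadjoint (S i) a, cadjoint (T i) b) \<in> {(x, n x) |x. x \<in> wandering_space S} \<union>
          {(J\<^sub>A v, J\<^sub>B (u v)) |v. v \<in> tilde_space A}"
        by force
    next
      fix v
      assume v: "(a, b) = (J\<^sub>A v, J\<^sub>B (u v))" "v \<in> tilde_space A"
      have "cadjoint (A i) v \<in> tilde_space A"
        using A.coinvariant_tilde_space v(2) by (simp add: coinvariant_def)
      moreover have "cadjoint (S i) a = J\<^sub>A (cadjoint (A i) v)"
        "cadjoint (T i) b = J\<^sub>B (u (cadjoint (A i) v))"
        using v by (simp_all add: A.cadjoint_J B.cadjoint_J u_co)
      ultimately show "(cadjoint (S i) a, cadjoint (T i) b) \<in> {(x, n x) |x. x \<in> wandering_space S} \<union>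
          {(J\<^sub>A v, J\<^sub>B (u v)) |v. v \<in> tilde_space A}"
        by blast
    qed
    have "fst ` \<rho> = wandering_space S \<union> J\<^sub>A ` tilde_space A"
      unfolding \<rho>_def by force
    then have dense_S: "closure (cspan (\<Union>w. word_op S w ` fst ` \<rho>)) = UNIV"
      using A.wandering_core_dense A.tilde_space_image by simp
    have "snd ` \<rho> = n ` wandering_space S \<union> J\<^sub>B ` u ` tilde_space A"
      unfolding \<rho>_def by force
    moreover have "n ` wandering_space S = wandering_space T" "u ` tilde_space A = tilde_space B"
      using n u by (simp_all add: unitary_between_def)
    ultimately have dense_T: "closure (cspan (\<Union>w. word_op T w ` snd ` \<rho>)) = UNIV"
      using B.wandering_core_dense B.tilde_space_image by simp
    obtain U where U: "unitary_between UNIV UNIV U" and US: "\<And>i x. U (S i x) = T i (U x)"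
      by (rule unitary_of_generating_relation[OF A.isometry_tuple_axioms B.isometry_tuple_axioms gram
            co dense_S dense_T]) blast+
    have "U (\<sigma>\<^sub>A X x) = \<sigma>\<^sub>B X (U x)" if "X \<in> cuntz_toeplitz" for X x
    proof (rule unital_star_reps_intertwine[OF L_bounded \<sigma> U])
      show "U (\<sigma>\<^sub>A Y y) = \<sigma>\<^sub>B Y (U y)" if "Y \<in> range left_creation" for Y y
        using that US by (auto simp: gen)
    qed (use that in \<open>simp_all add: cuntz_toeplitz_def\<close>)
    then show "unitarily_equivalent_reps cuntz_toeplitz \<sigma>\<^sub>A \<sigma>\<^sub>B"
      unfolding unitarily_equivalent_reps_def using U by (intro exI[of _ U]) auto
  qed
qed

end
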